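(* Let $\nu>0$ and suppose $p,q\in\mathbb R$ satisfy $p>1$ and $q\ge 2\nu(1-p)$. Suppose that either: (a) $\nu>1$ and $\sigma$ is a $\nu(1-p)$-Riemannian section of $\mathcal E$; or (b) $\nu=1$ and $\sigma$ is a strictly $(1-p)$-Riemannian section of $\mathcal E$. Suppose also that $|\sigma|^2$ is a harmonic function on $M$. Then $\sigma$ is a $(p,q)$-harmonic section of $\mathcal E$ if and only if $\sigma$ is parallel ($\nabla\sigma=0$).
   Context: Setting: $(M,g)$ is a smooth, oriented, connected Riemannian manifold without boundary (not necessarily compact), and $\pi\colon\mathcal E\to M$ is a smooth oriented real vector bundle with a fibre metric $\langle\,,\rangle$ and a connection $\nabla$ for which the fibre metric is holonomy-invariant, i.e. $\nabla\langle\,,\rangle=0$. All sections are smooth. For a section $\sigma$, put $F=\tfrac12|\sigma|^2\colon M\to\mathbb R$, let $\nabla F$ be its gradient, and $|\nabla\sigma|^2=\sum_i|\nabla_{E_i}\sigma|^2$ for a local orthonormal tangent frame $\{E_i\}$. For $p,q\in\mathbb R$ define a symmetric 2-tensor on the total space $\mathcal E$ by $h_{p,q}(A,B)=g(d\pi(A),d\pi(B))+(1+|e|^2)^{-p}\big(\langle KA,KB\rangle+q\langle KA,e\rangle\langle KB,e\rangle\big)$ for $A,B\in T_e\mathcal E$, where $K\colon T\mathcal E\to\mathcal E$ is the connection map of $\nabla$. The vertical $(p,q)$-energy of $\sigma$ (half the integral of the $h_{p,q}$-square norm of the vertical part of $d\sigma$) is $$E^v_{p,q}(\sigma)=\frac12\int_M\frac{1}{(1+|\sigma|^2)^p}\big(|\nabla\sigma|^2+q|\nabla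 F|^2\big)\,\mathrm{vol}(g)$$ if $M$ is compact; if $M$ is non-compact the integral is taken over relatively compact domains. $\sigma$ is a $(p,q)$-harmonic section of $\mathcal E$ if $\frac{d}{dt}\big|_{t=0}E^v_{p,q}(\sigma_t)=0$ for every smooth variation $\sigma_t$ of $\sigma_0=\sigma$ through sections of $\mathcal E$ (for non-compact $M$: every variation that equals $\sigma$ outside a compact set independent of $t$, the energy being taken over a relatively compact domain containing that set). For $r\in\mathbb R$, a section $\sigma$ is $r$-Riemannian if $r|\sigma(x)|^2\ge -1$ for all $x\in M$; an $r$-Riemannian section is strictly $r$-Riemannian if $r|\sigma(x)|^2>-1$ for some $x\in M$. *)

theory Defs
  imports "HOL-Analysis.Analysis"
begin

section \<open>Smooth maps between Euclidean spaces\<close>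

text \<open>The domain \<open>S\<close> is always meant to be open.\<close>

primrec Ck_on :: "nat \<Rightarrow> 'a::euclidean_space set \<Rightarrow> ('a \<Rightarrow> 'b::euclidean_space) \<Rightarrow> bool" where
  "Ck_on 0 S f = continuous_on S f"
| "Ck_on (Suc k) S f =
     ((\<forall>x\<in>S. f differentiable (at x)) \<and>
      (\<forall>v. Ck_on k S (\<lambda>x. frechet_derivative f (at x) v)))"

definition smooth_on :: "'a::euclidean_space set \<Rightarrow> ('a \<Rightarrow> 'b::euclidean_space) \<Rightarrow> bool" where
  "smooth_on S f \<longleftrightarrow> (\<forall>k. Ck_on k S f)"


section \<open>Oriented smooth manifolds\<close>

text \<open>
  A manifold is a whole type \<open>'m\<close> with a set of charts \<open>(U, \<phi>)\<close>, where the values of \<open>\<phi>\<close>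
  outside \<open>U\<close> are irrelevant. The Hausdorff property and second countability are carried by the
  type classes of \<open>'m\<close>. The atlas need not be maximal.
\<close>

type_synonym ('m, 'n) chart = "'m set \<times> ('m \<Rightarrow> real ^ 'n)"

definition chart_inv :: "('m, 'n::finite) chart \<Rightarrow> real ^ 'n \<Rightarrow> 'm" where
  "chart_inv c = inv_into (fst c) (snd c)"

definition is_chart :: "('m::topological_space, 'n::finite) chart \<Rightarrow> bool" where
  "is_chart c \<longleftrightarrow> open (fst c) \<and> open (snd c ` fst c) \<and>
     homeomorphism (fst c) (snd c ` fst c) (snd c) (chart_inv c)"

locale oriented_manifold =
  fixes A :: "('m::{t2_space, second_countable_topology}, 'n::finite) chart set"
  assumes charts: "\<And>c. c \<in> A \<Longrightarrow> is_chart c"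
    and charts_cover: "(\<Union>c\<in>A. fst c) = UNIV"
    and charts_compatible: "\<And>c d. c \<in> A \<Longrightarrow> d \<in> A \<Longrightarrow>
          smooth_on (snd c ` (fst c \<inter> fst d)) (snd d \<circ> chart_inv c)"
    and charts_oriented: "\<And>c d x. c \<in> A \<Longrightarrow> d \<in> A \<Longrightarrow> x \<in> fst c \<inter> fst d \<Longrightarrow>
          det (matrix (frechet_derivative (snd d \<circ> chart_inv c) (at (snd c x)))) > 0"

definition smooth_map_on ::
  "('m, 'n::finite) chart set \<Rightarrow> 'm set \<Rightarrow> ('m \<Rightarrow> 'b::euclidean_space) \<Rightarrow> bool" where
  "smooth_map_on A W f \<longleftrightarrow> (\<forall>c\<in>A. smooth_on (snd c ` (fst c \<inter> W)) (f \<circ> chart_inv c))"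


section \<open>Tangent vectors\<close>

text \<open>
  One chart around each point \<open>x\<close> is selected, and the tangent space at \<open>x\<close> is identified with
  \<open>real ^ 'n\<close> by means of it: a tangent vector at \<open>x\<close> is given by its components in the selected
  chart. The function \<open>components A c x\<close> converts it to its components in any other chart \<open>c\<close>
  around \<open>x\<close>, and \<open>coord_vector A c x \<xi>\<close> is the tangent vector at \<open>x\<close> which has components \<open>\<xi>\<close>
  in \<open>c\<close>. The selected charts need not depend continuously on \<open>x\<close>, so smoothness of tensor fields
  is always expressed through these two functions.
\<close>

definition chart_at :: "('m, 'n::finite) chart set \<Rightarrow> 'm \<Rightarrow> ('m, 'n) chart" where
  "chart_at A x = (SOME c. c \<in> A \<and> x \<in> fst c)"

definition components ::
  "('m, 'n::finite) chart set \<Rightarrow> ('m, 'n) chart \<Rightarrow> 'm \<Rightarrow> real ^ 'n \<Rightarrow> real ^ 'n" where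
  "components A c x v =
     frechet_derivative (snd c \<circ> chart_inv (chart_at A x)) (at (snd (chart_at A x) x)) v"

definition coord_vector ::
  "('m, 'n::finite) chart set \<Rightarrow> ('m, 'n) chart \<Rightarrow> 'm \<Rightarrow> real ^ 'n \<Rightarrow> real ^ 'n" where
  "coord_vector A c x \<xi> =
     frechet_derivative (snd (chart_at A x) \<circ> chart_inv c) (at (snd c x)) \<xi>"

definition smooth_vector_field :: "('m, 'n::finite) chart set \<Rightarrow> ('m \<Rightarrow> real ^ 'n) \<Rightarrow> bool" where
  "smooth_vector_field A X \<longleftrightarrow> (\<forall>c\<in>A. smooth_map_on A (fst c) (\<lambda>x. components A c x (X x)))"

definition differential ::
  "('m, 'n::finite) chart set \<Rightarrow> ('m \<Rightarrow> real) \<Rightarrow> 'm \<Rightarrow> real ^ 'n \<Rightarrow> real" where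
  "differential A f x v =
     frechet_derivative (f \<circ> chart_inv (chart_at A x)) (at (snd (chart_at A x) x)) v"


section \<open>Riemannian metrics\<close>

definition inner_product_on :: "'v::real_vector set \<Rightarrow> ('v \<Rightarrow> 'v \<Rightarrow> real) \<Rightarrow> bool" where
  "inner_product_on S b \<longleftrightarrow>
     (\<forall>u\<in>S. \<forall>v\<in>S. b u v = b v u) \<and>
     (\<forall>u\<in>S. \<forall>v\<in>S. \<forall>w\<in>S. b (u + v) w = b u w + b v w) \<and>
     (\<forall>u\<in>S. \<forall>v\<in>S. \<forall>r. b (r *\<^sub>R u) v = r * b u v) \<and>
     (\<forall>u\<in>S. u \<noteq> 0 \<longrightarrow> b u u > 0)"

definition metric_matrix ::
  "('m, 'n::finite) chart set \<Rightarrow> ('m \<Rightarrow> real ^ 'n \<Rightarrow> real ^ 'n \<Rightarrow> real) \<Rightarrow>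
     ('m, 'n) chart \<Rightarrow> 'm \<Rightarrow> real ^ 'n ^ 'n" where
  "metric_matrix A g c x =
     (\<chi> i j. g x (coord_vector A c x (axis i 1)) (coord_vector A c x (axis j 1)))"

locale riemannian_manifold = oriented_manifold A
  for A :: "('m::{t2_space, second_countable_topology}, 'n::finite) chart set" +
  fixes g :: "'m \<Rightarrow> real ^ 'n \<Rightarrow> real ^ 'n \<Rightarrow> real"
  assumes metric_inner_product: "\<And>x. inner_product_on UNIV (g x)"
    and metric_smooth: "\<And>c. c \<in> A \<Longrightarrow> smooth_map_on A (fst c) (metric_matrix A g c)"

definition gradient ::
  "('m, 'n::finite) chart set \<Rightarrow> ('m \<Rightarrow> real ^ 'n \<Rightarrow> real ^ 'n \<Rightarrow> real) \<Rightarrow>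
     ('m \<Rightarrow> real) \<Rightarrow> 'm \<Rightarrow> real ^ 'n" where
  "gradient A g f x = (THE w. \<forall>v. g x w v = differential A f x v)"

text \<open>
  The divergence, computed in the chart \<open>c\<close> as \<open>(\<Sum>i. \<partial>\<^sub>i (sqrt (det G) * X\<^sub>i)) / sqrt (det G)\<close>.
  Its value at a point does not depend on the chart around that point.
\<close>

definition divergence_in ::
  "('m, 'n::finite) chart set \<Rightarrow> ('m \<Rightarrow> real ^ 'n \<Rightarrow> real ^ 'n \<Rightarrow> real) \<Rightarrow>
     ('m, 'n) chart \<Rightarrow> ('m \<Rightarrow> real ^ 'n) \<Rightarrow> 'm \<Rightarrow> real" where
  "divergence_in A g c X x =
     (\<Sum>i\<in>UNIV. frechet_derivative
        ((\<lambda>z. sqrt (det (metric_matrix A g c z)) * components A c z (X z) $ i) \<circ> chart_inv c)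
        (at (snd c x)) (axis i 1)) / sqrt (det (metric_matrix A g c x))"

definition laplacian_in ::
  "('m, 'n::finite) chart set \<Rightarrow> ('m \<Rightarrow> real ^ 'n \<Rightarrow> real ^ 'n \<Rightarrow> real) \<Rightarrow>
     ('m, 'n) chart \<Rightarrow> ('m \<Rightarrow> real) \<Rightarrow> 'm \<Rightarrow> real" where
  "laplacian_in A g c f x = divergence_in A g c (gradient A g f) x"

definition harmonic_function ::
  "('m, 'n::finite) chart set \<Rightarrow> ('m \<Rightarrow> real ^ 'n \<Rightarrow> real ^ 'n \<Rightarrow> real) \<Rightarrow> ('m \<Rightarrow> real) \<Rightarrow> bool"
where
  "harmonic_function A g f \<longleftrightarrow>
     smooth_map_on A UNIV f \<and> (\<forall>c\<in>A. \<forall>x\<in>fst c. laplacian_in A g c f x = 0)"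

text \<open>
  The Riemannian measure is the unique Borel measure that has density \<open>sqrt (det G)\<close>
  with respect to Lebesgue measure in every chart.
\<close>

definition is_riemannian_volume ::
  "('m::topological_space, 'n::finite) chart set \<Rightarrow> ('m \<Rightarrow> real ^ 'n \<Rightarrow> real ^ 'n \<Rightarrow> real) \<Rightarrow>
     'm measure \<Rightarrow> bool" where
  "is_riemannian_volume A g \<mu> \<longleftrightarrow> sets \<mu> = sets borel \<and>
     (\<forall>c\<in>A. \<forall>B\<in>sets borel. B \<subseteq> fst c \<longrightarrow>
        emeasure \<mu> B =
          (\<integral>\<^sup>+y\<in>snd c ` B. ennreal (sqrt (det (metric_matrix A g c (chart_inv c y)))) \<partial>lborel))"

definition vol ::
  "('m::topological_space, 'n::finite) chart set \<Rightarrow> ('m \<Rightarrow> real ^ 'n \<Rightarrow> real ^ 'n \<Rightarrow> real) \<Rightarrow>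
     'm measure" where
  "vol A g = (SOME \<mu>. is_riemannian_volume A g \<mu>)"


section \<open>Oriented vector bundles with metric and connection\<close>

text \<open>
  The fibres \<open>E x\<close> of a vector bundle are linear subspaces of one ambient real vector space \<open>'v\<close>,
  which has no topology and does not relate different fibres to each other; the total space is
  \<open>Sigma UNIV E\<close>. The smooth structure is given by local trivialisations \<open>(V, \<Psi>)\<close>, where \<open>\<Psi> x\<close>,
  for \<open>x\<close> in \<open>V\<close>, is a linear isomorphism from \<open>real ^ 'k\<close> onto \<open>E x\<close>.
\<close>

type_synonym ('m, 'k, 'v) trivialisation = "'m set \<times> ('m \<Rightarrow> real ^ 'k \<Rightarrow> 'v)"

locale oriented_vector_bundle = oriented_manifold A
  for A :: "('m::{t2_space, second_countable_topology}, 'n::finite) chart set" +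
  fixes E :: "'m \<Rightarrow> 'v::real_vector set"
    and T :: "('m, 'k::finite, 'v) trivialisation set"
  assumes triv_open: "\<And>V \<Psi>. (V, \<Psi>) \<in> T \<Longrightarrow> open V"
    and triv_iso: "\<And>V \<Psi> x. (V, \<Psi>) \<in> T \<Longrightarrow> x \<in> V \<Longrightarrow>
          linear (\<Psi> x) \<and> inj (\<Psi> x) \<and> range (\<Psi> x) = E x"
    and triv_cover: "(\<Union>(V, \<Psi>)\<in>T. V) = UNIV"
    and triv_compatible: "\<And>V \<Psi> W \<Theta>. (V, \<Psi>) \<in> T \<Longrightarrow> (W, \<Theta>) \<in> T \<Longrightarrow>
          smooth_map_on A (V \<inter> W) (\<lambda>x. matrix (inv (\<Theta> x) \<circ> \<Psi> x))"
    and triv_oriented: "\<And>V \<Psi> W \<Theta> x. (V, \<Psi>) \<in> T \<Longrightarrow> (W, \<Theta>) \<in> T \<Longrightarrow> x \<in> V \<inter> W \<Longrightarrow>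
          det (matrix (inv (\<Theta> x) \<circ> \<Psi> x)) > 0"

definition smooth_section ::
  "('m, 'n::finite) chart set \<Rightarrow> ('m \<Rightarrow> 'v::real_vector set) \<Rightarrow>
     ('m, 'k::finite, 'v) trivialisation set \<Rightarrow> ('m \<Rightarrow> 'v) \<Rightarrow> bool" where
  "smooth_section A E T \<sigma> \<longleftrightarrow>
     (\<forall>x. \<sigma> x \<in> E x) \<and> (\<forall>(V, \<Psi>)\<in>T. smooth_map_on A V (\<lambda>x. inv (\<Psi> x) (\<sigma> x)))"

text \<open>
  The fibre metric is \<open>h\<close>, and \<open>D x v \<sigma>\<close> is the covariant derivative of the section \<open>\<sigma>\<close> in the
  direction of the tangent vector \<open>v\<close> at \<open>x\<close>; it is relevant for smooth \<open>\<sigma>\<close> only.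
\<close>

locale riemannian_vector_bundle =
  riemannian_manifold A g + oriented_vector_bundle A E T
  for A :: "('m::{t2_space, second_countable_topology}, 'n::finite) chart set"
    and g :: "'m \<Rightarrow> real ^ 'n \<Rightarrow> real ^ 'n \<Rightarrow> real"
    and E :: "'m \<Rightarrow> 'v::real_vector set"
    and T :: "('m, 'k::finite, 'v) trivialisation set" +
  fixes h :: "'m \<Rightarrow> 'v \<Rightarrow> 'v \<Rightarrow> real"
    and D :: "'m \<Rightarrow> real ^ 'n \<Rightarrow> ('m \<Rightarrow> 'v) \<Rightarrow> 'v"
  assumes fibre_inner_product: "\<And>x. inner_product_on (E x) (h x)"
    and fibre_metric_smooth: "\<And>V \<Psi>. (V, \<Psi>) \<in> T \<Longrightarrow>
          smooth_map_on A V (\<lambda>x. \<chi> i j. h x (\<Psi> x (axis i 1)) (\<Psi> x (axis j 1)))"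
    and conn_fibre: "\<And>x v \<sigma>. smooth_section A E T \<sigma> \<Longrightarrow> D x v \<sigma> \<in> E x"
    and conn_linear: "\<And>x \<sigma>. smooth_section A E T \<sigma> \<Longrightarrow> linear (\<lambda>v. D x v \<sigma>)"
    and conn_smooth: "\<And>X \<sigma>. smooth_vector_field A X \<Longrightarrow> smooth_section A E T \<sigma> \<Longrightarrow>
          smooth_section A E T (\<lambda>x. D x (X x) \<sigma>)"
    and conn_add: "\<And>x v \<sigma> \<tau>. smooth_section A E T \<sigma> \<Longrightarrow> smooth_section A E T \<tau> \<Longrightarrow>
          D x v (\<lambda>y. \<sigma> y + \<tau> y) = D x v \<sigma> + D x v \<tau>"
    and conn_Leibniz: "\<And>x v f \<sigma>. smooth_map_on A UNIV f \<Longrightarrow> smooth_section A E T \<sigma> \<Longrightarrow>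
          D x v (\<lambda>y. f y *\<^sub>R \<sigma> y) = differential A f x v *\<^sub>R \<sigma> x + f x *\<^sub>R D x v \<sigma>"
    and conn_metric: "\<And>x v \<sigma> \<tau>. smooth_section A E T \<sigma> \<Longrightarrow> smooth_section A E T \<tau> \<Longrightarrow>
          differential A (\<lambda>y. h y (\<sigma> y) (\<tau> y)) x v = h x (D x v \<sigma>) (\<tau> x) + h x (\<sigma> x) (D x v \<tau>)"

definition parallel_section :: "('m \<Rightarrow> real ^ 'n \<Rightarrow> ('m \<Rightarrow> 'v::zero) \<Rightarrow> 'v) \<Rightarrow> ('m \<Rightarrow> 'v) \<Rightarrow> bool"
where
  "parallel_section D \<sigma> \<longleftrightarrow> (\<forall>x v. D x v \<sigma> = 0)"

definition norm_sq :: "('m \<Rightarrow> 'v \<Rightarrow> 'v \<Rightarrow> real) \<Rightarrow> ('m \<Rightarrow> 'v) \<Rightarrow> 'm \<Rightarrow> real" where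
  "norm_sq h \<sigma> x = h x (\<sigma> x) (\<sigma> x)"

definition r_Riemannian :: "('m \<Rightarrow> 'v \<Rightarrow> 'v \<Rightarrow> real) \<Rightarrow> real \<Rightarrow> ('m \<Rightarrow> 'v) \<Rightarrow> bool" where
  "r_Riemannian h r \<sigma> \<longleftrightarrow> (\<forall>x. r * norm_sq h \<sigma> x \<ge> -1)"

definition strictly_r_Riemannian :: "('m \<Rightarrow> 'v \<Rightarrow> 'v \<Rightarrow> real) \<Rightarrow> real \<Rightarrow> ('m \<Rightarrow> 'v) \<Rightarrow> bool" where
  "strictly_r_Riemannian h r \<sigma> \<longleftrightarrow> r_Riemannian h r \<sigma> \<and> (\<exists>x. r * norm_sq h \<sigma> x > -1)"


section \<open>The vertical energy and its critical points\<close>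

definition orthonormal_basis_for ::
  "(real ^ 'n \<Rightarrow> real ^ 'n \<Rightarrow> real) \<Rightarrow> ('n::finite \<Rightarrow> real ^ 'n) \<Rightarrow> bool" where
  "orthonormal_basis_for b e \<longleftrightarrow> (\<forall>i j. b (e i) (e j) = (if i = j then 1 else 0))"

text \<open>The sum below does not depend on the choice of the orthonormal basis.\<close>

definition nabla_norm_sq ::
  "('m \<Rightarrow> real ^ 'n \<Rightarrow> real ^ 'n \<Rightarrow> real) \<Rightarrow> ('m \<Rightarrow> 'v \<Rightarrow> 'v \<Rightarrow> real) \<Rightarrow>
     ('m \<Rightarrow> real ^ 'n::finite \<Rightarrow> ('m \<Rightarrow> 'v) \<Rightarrow> 'v) \<Rightarrow> ('m \<Rightarrow> 'v) \<Rightarrow> 'm \<Rightarrow> real" where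
  "nabla_norm_sq g h D \<sigma> x =
     (let e = (SOME e. orthonormal_basis_for (g x) e)
      in \<Sum>i\<in>UNIV. h x (D x (e i) \<sigma>) (D x (e i) \<sigma>))"

text \<open>
  The gradient in the second summand is that of \<open>F = norm_sq h \<sigma> / 2\<close>. The domain \<open>\<Omega>\<close> of
  integration is the whole manifold if this is compact, and relatively compact otherwise.
\<close>

definition vertical_energy ::
  "('m::topological_space, 'n::finite) chart set \<Rightarrow> ('m \<Rightarrow> real ^ 'n \<Rightarrow> real ^ 'n \<Rightarrow> real) \<Rightarrow>
     ('m \<Rightarrow> 'v \<Rightarrow> 'v \<Rightarrow> real) \<Rightarrow> ('m \<Rightarrow> real ^ 'n \<Rightarrow> ('m \<Rightarrow> 'v) \<Rightarrow> 'v) \<Rightarrow>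
     real \<Rightarrow> real \<Rightarrow> 'm set \<Rightarrow> ('m \<Rightarrow> 'v) \<Rightarrow> real" where
  "vertical_energy A g h D p q \<Omega> \<sigma> =
     1 / 2 * (LINT x:\<Omega>|vol A g.
       1 / (1 + norm_sq h \<sigma> x) powr p *
       (nabla_norm_sq g h D \<sigma> x +
        q * (let w = gradient A g (\<lambda>y. 1 / 2 * norm_sq h \<sigma> y) x in g x w w)))"

definition smooth_variation ::
  "('m, 'n::finite) chart set \<Rightarrow> ('m \<Rightarrow> 'v::real_vector set) \<Rightarrow>
     ('m, 'k::finite, 'v) trivialisation set \<Rightarrow> real \<Rightarrow> ('m \<Rightarrow> 'v) \<Rightarrow> (real \<Rightarrow> 'm \<Rightarrow> 'v) \<Rightarrow> bool"
where
  "smooth_variation A E T \<epsilon> \<sigma> s \<longleftrightarrow>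
     s 0 = \<sigma> \<and>
     (\<forall>t\<in>{-\<epsilon><..<\<epsilon>}. \<forall>x. s t x \<in> E x) \<and>
     (\<forall>c\<in>A. \<forall>(V, \<Psi>)\<in>T.
        smooth_on ({-\<epsilon><..<\<epsilon>} \<times> snd c ` (fst c \<inter> V))
          (\<lambda>(t, y). inv (\<Psi> (chart_inv c y)) (s t (chart_inv c y))))"

definition pq_harmonic_section ::
  "('m::topological_space, 'n::finite) chart set \<Rightarrow> ('m \<Rightarrow> real ^ 'n \<Rightarrow> real ^ 'n \<Rightarrow> real) \<Rightarrow>
     ('m \<Rightarrow> 'v::real_vector set) \<Rightarrow> ('m, 'k::finite, 'v) trivialisation set \<Rightarrow>
     ('m \<Rightarrow> 'v \<Rightarrow> 'v \<Rightarrow> real) \<Rightarrow> ('m \<Rightarrow> real ^ 'n \<Rightarrow> ('m \<Rightarrow> 'v) \<Rightarrow> 'v) \<Rightarrow>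
     real \<Rightarrow> real \<Rightarrow> ('m \<Rightarrow> 'v) \<Rightarrow> bool" where
  "pq_harmonic_section A g E T h D p q \<sigma> \<longleftrightarrow>
     (if compact (UNIV :: 'm set) then
        \<forall>\<epsilon>>0. \<forall>s. smooth_variation A E T \<epsilon> \<sigma> s \<longrightarrow>
          ((\<lambda>t. vertical_energy A g h D p q UNIV (s t)) has_real_derivative 0) (at 0)
      else
        \<forall>\<epsilon>>0. \<forall>s K \<Omega>. smooth_variation A E T \<epsilon> \<sigma> s \<and>
          compact K \<and> (\<forall>t\<in>{-\<epsilon><..<\<epsilon>}. \<forall>x. x \<notin> K \<longrightarrow> s t x = \<sigma> x) \<and>
          open \<Omega> \<and> connected \<Omega> \<and> compact (closure \<Omega>) \<and> K \<subseteq> \<Omega> \<longrightarrow>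
          ((\<lambda>t. vertical_energy A g h D p q \<Omega> (s t)) has_real_derivative 0) (at 0))"

end

theory Submission
  imports Defs "HOL-Library.Landau_Symbols"
begin

text \<open>
  Write \<open>N = |\<sigma>|\<^sup>2\<close>. The first variation of the energy along the radial variations \<open>(1 + t \<phi>) \<sigma>\<close>
  is an integral that is linear in \<open>\<phi>\<close> and \<open>\<nabla>\<phi>\<close>. As \<open>N\<close> is harmonic, the integral of
  \<open>\<langle>\<nabla>\<psi>, \<nabla>N\<rangle>\<close> vanishes for every test function \<open>\<psi>\<close>, and subtracting it for
  \<open>\<psi> = \<phi> (1 + N)\<^sup>-\<^sup>p (1 + q N)\<close> removes \<open>\<nabla>\<phi>\<close>. What remains is that
  \<open>2 |\<nabla>\<sigma>|\<^sup>2 (1 + (1 - p) N) + (p/2) |\<nabla>N|\<^sup>2 (2 + q N)\<close> vanishes identically. Both summands are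
  nonnegative by hypothesis, hence \<open>|\<nabla>\<sigma>|\<^sup>2 (1 + (1 - p) N) = 0\<close>. If \<open>\<nu> > 1\<close>, the last factor is
  positive. If \<open>\<nu> = 1\<close>, it is positive somewhere, and \<open>N\<close> is locally constant where it is positive,
  so \<open>N\<close> is constant by connectedness.

  Conversely, if \<open>\<sigma>\<close> is parallel, then \<open>|\<nabla>\<sigma>\<^sub>t|\<^sup>2 = O(t\<^sup>2)\<close> locally uniformly, and the vertical
  energy of \<open>\<sigma>\<^sub>t\<close> is bounded by a multiple of the integral of this function.
\<close>

section \<open>Differentiability classes\<close>

text \<open>Two global notions have to be reduced to charts. The connection acts on global sections,
  and its smoothness axiom speaks of global vector fields; so frames and coordinate fields enter
  only after multiplication by a bump function, and the Leibniz rule makes the cutoff invisible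
  where it is 1. The measure \<open>vol\<close> is a choice, so the Riemannian volume has to be
  constructed before any integral can be computed. All test functions are supported in a single
  chart; integration by parts thus concerns compactly supported functions on
  \<open>real ^ 'n\<close>, and no partition of unity occurs. Origin of the two factors, with N =
  |\<sigma>|^2, S = |\<nabla>\<sigma>|^2, Q = |\<nabla>N|^2 and (1 + N)^(-p-1) taken out: the weight
  contributes -2 p N S and the variation of S contributes 2 (1 + N) S, in total 2 S (1 + (1 - p) N).
  Likewise Q has the coefficient q (1 + N) - p q N / 2, of which the integration by parts removes q
  (1 + N) - p (1 + q N); what is left is (p / 2) (2 + q N).\<close>

lemma has_derivative_cong_open:
  assumes "open S" "x \<in> S" "\<And>y. y \<in> S \<Longrightarrow> f y = g y"
  shows "(f has_derivative d) (at x) \<longleftrightarrow> (g has_derivative d) (at x)"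
  using has_derivative_transform_within_open[of f d x UNIV S g]
    has_derivative_transform_within_open[of g d x UNIV S f] assms by auto

lemma frechet_derivative_cong_open:
  assumes "open S" "x \<in> S" "\<And>y. y \<in> S \<Longrightarrow> f y = g y"
  shows "frechet_derivative f (at x) = frechet_derivative g (at x)"
  unfolding frechet_derivative_def using has_derivative_cong_open[OF assms] by simp

text \<open>Congruence on \<open>S\<close> at level \<open>k\<close> is a hypothesis because the
  lemma is applied inside the induction that proves congruence; \<open>Ck_on_Suc_derivative\<close>
  discharges it.\<close>

lemma Ck_on_SucI:
  fixes f :: "'a::euclidean_space \<Rightarrow> 'b::euclidean_space"
  assumes "open S" "\<And>x. x \<in> S \<Longrightarrow> (f has_derivative f' x) (at x)"
    and "\<And>v. Ck_on k S (\<lambda>x. f' x v)"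
    and cong: "\<And>f g :: 'a \<Rightarrow> 'b. (\<And>x. x \<in> S \<Longrightarrow> f x = g x) \<Longrightarrow> Ck_on k S f \<Longrightarrow> Ck_on k S g"
  shows "Ck_on (Suc k) S f"
proof -
  have "frechet_derivative f (at x) = f' x" if "x \<in> S" for x
    using frechet_derivative_at[OF assms(2)[OF that]] by simp
  then have "Ck_on k S (\<lambda>x. frechet_derivative f (at x) v)" for v
    by (intro cong[OF _ assms(3)]) auto
  then show ?thesis
    using assms(2) by (auto simp: differentiable_def)
qed

lemma Ck_on_cong_imp:
  assumes "open S" "\<And>x. x \<in> S \<Longrightarrow> f x = g x" "Ck_on k S f"
  shows "Ck_on k S g"
  using assms(2,3)
proof (induction k arbitrary: f g)
  case 0
  then show ?case by (auto cong: continuous_on_cong)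
next
  case (Suc k)
  show ?case
  proof (rule Ck_on_SucI[OF assms(1), of g "\<lambda>x. frechet_derivative f (at x)"])
    show "(g has_derivative frechet_derivative f (at x)) (at x)" if "x \<in> S" for x
      using has_derivative_cong_open[OF assms(1) that, of f g] Suc.prems that
      by (auto simp: frechet_derivative_works)
    show "Ck_on k S (\<lambda>x. frechet_derivative f (at x) v)" for v
      using Suc.prems by auto
    show "Ck_on k S g'" if "\<And>x. x \<in> S \<Longrightarrow> f' x = g' x" "Ck_on k S f'" for f' g' :: "'a \<Rightarrow> 'b"
      by (rule Suc.IH[OF that(1) that(2)])
  qed
qed

lemma Ck_on_cong:
  assumes "open S" "\<And>x. x \<in> S \<Longrightarrow> f x = g x"
  shows "Ck_on k S f \<longleftrightarrow> Ck_on k S g"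
  using Ck_on_cong_imp[OF assms(1), of f g] Ck_on_cong_imp[OF assms(1), of g f] assms(2)
  by metis

lemma Ck_on_Suc_derivative:
  assumes "open S" "\<And>x. x \<in> S \<Longrightarrow> (f has_derivative f' x) (at x)"
    and "\<And>v. Ck_on k S (\<lambda>x. f' x v)"
  shows "Ck_on (Suc k) S f"
  by (rule Ck_on_SucI[OF assms]) (use Ck_on_cong[OF assms(1)] in blast)+

lemma Ck_on_subset: "Ck_on k S f \<Longrightarrow> T \<subseteq> S \<Longrightarrow> Ck_on k T f"
  by (induction k arbitrary: f) (auto intro: continuous_on_subset)

lemma Ck_on_SucD: "Ck_on (Suc k) S f \<Longrightarrow> Ck_on k S f"
proof (induction k arbitrary: f)
  case 0
  then show ?case
    by (auto intro!: continuous_at_imp_continuous_on differentiable_imp_continuous_within)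
next
  case (Suc k)
  then show ?case by (metis Ck_on.simps(2))
qed

lemma Ck_on_mono: "Ck_on k S f \<Longrightarrow> j \<le> k \<Longrightarrow> Ck_on j S f"
  by (induction k) (auto simp: le_Suc_eq simp del: Ck_on.simps dest: Ck_on_SucD)

lemma Ck_on_imp_continuous_on: "Ck_on k S f \<Longrightarrow> continuous_on S f"
  using Ck_on_mono[of k S f 0] by simp

lemma Ck_on_local:
  assumes "open S" "\<And>x. x \<in> S \<Longrightarrow> \<exists>U. open U \<and> x \<in> U \<and> Ck_on k (U \<inter> S) f"
  shows "Ck_on k S f"
  using assms(2)
proof (induction k arbitrary: f)
  case 0
  have "isCont f x" if "x \<in> S" for x
  proof -
    from 0[OF that] obtain U where "open U" "x \<in> U" "continuous_on (U \<inter> S) f" by auto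
    with that assms(1) show ?thesis
      by (metis IntI continuous_on_eq_continuous_at open_Int)
  qed
  then show ?case by (simp add: continuous_at_imp_continuous_on)
next
  case (Suc k)
  then show ?case by simp (metis IntI)
qed

lemma Ck_on_const [simp]: "Ck_on k S (\<lambda>x. c)"
  by (induction k arbitrary: c) auto

lemma Ck_on_bounded_linear:
  assumes "bounded_linear f"
  shows "Ck_on k S f"
proof (cases k)
  case 0
  then show ?thesis
    using assms by (simp add: linear_continuous_on)
next
  case (Suc j)
  have "(f has_derivative f) (at x)" for x
    using assms by (simp add: bounded_linear_imp_has_derivative)
  then have "frechet_derivative f (at x) = f" "f differentiable (at x)" for x
    using frechet_derivative_at[of f f x] by (auto simp: differentiable_def)
  then show ?thesis using Suc by simp
qed

lemma Ck_on_id: "Ck_on k S (\<lambda>x. x)"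
  by (rule Ck_on_bounded_linear) (rule bounded_linear_ident)

lemma Ck_on_add:
  assumes "open S" "Ck_on k S f" "Ck_on k S g"
  shows "Ck_on k S (\<lambda>x. f x + g x)"
  using assms(2,3)
proof (induction k arbitrary: f g)
  case 0
  then show ?case by (simp add: continuous_on_add)
next
  case (Suc k)
  show ?case
  proof (rule Ck_on_Suc_derivative[OF assms(1)])
    show "((\<lambda>x. f x + g x) has_derivative
       (\<lambda>v. frechet_derivative f (at x) v + frechet_derivative g (at x) v)) (at x)" if "x \<in> S" for x
      using Suc.prems that by (auto intro!: derivative_intros simp: frechet_derivative_works)
  qed (use Suc in auto)
qed

lemma Ck_on_bilinear:
  assumes "bounded_bilinear b" "open S" "Ck_on k S f" "Ck_on k S g"
  shows "Ck_on k S (\<lambda>x. b (f x) (g x))"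
  using assms(3,4)
proof (induction k arbitrary: f g)
  case 0
  then show ?case using bounded_bilinear.continuous_on[OF assms(1)] by simp
next
  case (Suc k)
  have k: "Ck_on k S f" "Ck_on k S g"
    using Suc.prems Ck_on_SucD by blast+
  show ?case
  proof (rule Ck_on_Suc_derivative[OF assms(2)])
    show "((\<lambda>x. b (f x) (g x)) has_derivative
       (\<lambda>v. b (f x) (frechet_derivative g (at x) v) + b (frechet_derivative f (at x) v) (g x))) (at x)"
      if "x \<in> S" for x
      using Suc.prems that
      by (intro bounded_bilinear.FDERIV[OF assms(1)]) (auto simp: frechet_derivative_works)
  qed (use Suc k in \<open>auto intro!: Ck_on_add[OF assms(2)]\<close>)
qed

lemma Ck_on_scaleR:
  assumes "open S" "Ck_on k S f" "Ck_on k S g"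
  shows "Ck_on k S (\<lambda>x. f x *\<^sub>R g x)"
  using Ck_on_bilinear[OF bounded_bilinear_scaleR assms] .

lemma Ck_on_mult:
  fixes f g :: "'a::euclidean_space \<Rightarrow> real"
  assumes "open S" "Ck_on k S f" "Ck_on k S g"
  shows "Ck_on k S (\<lambda>x. f x * g x)"
  using Ck_on_bilinear[OF bounded_bilinear_mult assms] .

lemma Ck_on_sum:
  assumes "open S" "\<And>i. i \<in> I \<Longrightarrow> Ck_on k S (f i)"
  shows "Ck_on k S (\<lambda>x. \<Sum>i\<in>I. f i x)"
  using assms(2) by (induction I rule: infinite_finite_induct) (auto intro: Ck_on_add[OF assms(1)])

lemma Ck_on_prod:
  fixes f :: "'i \<Rightarrow> 'a::euclidean_space \<Rightarrow> real"
  assumes "open S" "\<And>i. i \<in> I \<Longrightarrow> Ck_on k S (f i)"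
  shows "Ck_on k S (\<lambda>x. \<Prod>i\<in>I. f i x)"
  using assms(2) by (induction I rule: infinite_finite_induct) (auto intro: Ck_on_mult[OF assms(1)])

lemma Ck_on_compose:
  fixes f :: "'b::euclidean_space \<Rightarrow> 'c::euclidean_space" and g :: "'a::euclidean_space \<Rightarrow> 'b"
  assumes "open S" "open T" "g ` S \<subseteq> T" "Ck_on k T f" "Ck_on k S g"
  shows "Ck_on k S (\<lambda>x. f (g x))"
  using assms(4,5)
proof (induction k arbitrary: f)
  case 0
  then show ?case using assms(3) by (auto intro: continuous_on_compose2)
next
  case (Suc k)
  have lin: "linear (frechet_derivative f (at (g x)))" if "x \<in> S" for x
    using Suc.prems that assms(3) by (auto intro: linear_frechet_derivative)
  have k: "Ck_on k S g"
    using Suc.prems Ck_on_SucD by blast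
  show ?case
  proof (rule Ck_on_Suc_derivative[OF assms(1)])
    \<comment> \<open>The chain rule evaluates the derivative of \<open>f\<close> in a moving
      direction. Expanding that direction in \<open>Basis\<close> leaves derivatives of
      \<open>f\<close> in fixed directions, to which the induction hypothesis applies, with
      coefficients of class C^k.\<close>
    show "((\<lambda>x. f (g x)) has_derivative
       (\<lambda>v. \<Sum>i\<in>Basis. (frechet_derivative g (at x) v \<bullet> i) *\<^sub>R frechet_derivative f (at (g x)) i)) (at x)"
      if "x \<in> S" for x
    proof -
      have "((\<lambda>x. f (g x)) has_derivative
         (\<lambda>v. frechet_derivative f (at (g x)) (frechet_derivative g (at x) v))) (at x)"
        using Suc.prems that assms(3)
        by (intro has_derivative_compose[of g _ x UNIV f]) (auto simp: frechet_derivative_works[symmetric])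
      moreover have "frechet_derivative f (at (g x)) w =
          (\<Sum>i\<in>Basis. (w \<bullet> i) *\<^sub>R frechet_derivative f (at (g x)) i)" for w
      proof -
        have "frechet_derivative f (at (g x)) w = frechet_derivative f (at (g x)) (\<Sum>i\<in>Basis. (w \<bullet> i) *\<^sub>R i)"
          by (simp add: euclidean_representation)
        also have "\<dots> = (\<Sum>i\<in>Basis. (w \<bullet> i) *\<^sub>R frechet_derivative f (at (g x)) i)"
          by (simp add: linear_sum[OF lin[OF that]] linear_scale[OF lin[OF that]])
        finally show ?thesis .
      qed
      then have "(\<lambda>v. frechet_derivative f (at (g x)) (frechet_derivative g (at x) v)) =
          (\<lambda>v. \<Sum>i\<in>Basis. (frechet_derivative g (at x) v \<bullet> i) *\<^sub>R frechet_derivative f (at (g x)) i)"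
        by (rule ext)
      ultimately show ?thesis by simp
    qed
    show "Ck_on k S (\<lambda>x. \<Sum>i\<in>Basis. (frechet_derivative g (at x) v \<bullet> i) *\<^sub>R frechet_derivative f (at (g x)) i)" for v
    proof (intro Ck_on_sum Ck_on_scaleR assms(1))
      fix i :: 'b
      show "Ck_on k S (\<lambda>x. frechet_derivative g (at x) v \<bullet> i)"
        by (rule Ck_on_bilinear[OF bounded_bilinear_inner assms(1)]) (use Suc.prems in auto)
      show "Ck_on k S (\<lambda>x. frechet_derivative f (at (g x)) i)"
        by (rule Suc.IH) (use Suc.prems k in auto)
    qed
  qed
qed

lemma Ck_on_inverse: "Ck_on k {x::real. x \<noteq> 0} inverse"
proof (induction k)
  case 0
  then show ?case by (auto intro: continuous_on_inverse)
next
  case (Suc k)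
  have op: "open {x::real. x \<noteq> 0}"
    by (rule open_Collect_neq) auto
  show ?case
  proof (rule Ck_on_Suc_derivative[OF op])
    show "(inverse has_derivative (\<lambda>v. (- v) * (inverse x * inverse x))) (at x)" if "x \<in> {x. x \<noteq> 0}" for x :: real
      using that by (auto intro!: derivative_eq_intros)
    show "Ck_on k {x::real. x \<noteq> 0} (\<lambda>x. (- v) * (inverse x * inverse x))" for v
      by (rule Ck_on_mult[OF op Ck_on_const Ck_on_mult[OF op Suc Suc]])
  qed
qed

lemma Ck_on_powr: "Ck_on k {0<..} (\<lambda>x. x powr a)" for a :: real
proof (induction k arbitrary: a)
  case 0
  then show ?case by (auto intro!: continuous_intros)
next
  case (Suc k)
  show ?case
  proof (rule Ck_on_Suc_derivative[of _ _ "\<lambda>x v. (a * v) * x powr (a - 1)"])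
    show "((\<lambda>x. x powr a) has_derivative (\<lambda>v. a * v * x powr (a - 1))) (at x)" if "x \<in> {0<..}" for x
      using that by (auto intro!: derivative_eq_intros simp: powr_diff)
    show "Ck_on k {0<..} (\<lambda>x. a * v * x powr (a - 1))" for v
      by (rule Ck_on_mult) (auto intro: Suc)
  qed auto
qed

section \<open>Smooth maps\<close>

lemma smooth_on_cong:
  assumes "open S" "\<And>x. x \<in> S \<Longrightarrow> f x = g x"
  shows "smooth_on S f \<longleftrightarrow> smooth_on S g"
  unfolding smooth_on_def using Ck_on_cong[OF assms(1), of f g] assms(2) by blast

lemma smooth_on_subset: "smooth_on S f \<Longrightarrow> T \<subseteq> S \<Longrightarrow> smooth_on T f"
  unfolding smooth_on_def using Ck_on_subset by blast

lemma smooth_on_imp_continuous_on: "smooth_on S f \<Longrightarrow> continuous_on S f"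
  unfolding smooth_on_def using Ck_on_imp_continuous_on by blast

lemma smooth_on_local:
  assumes "open S" "\<And>x. x \<in> S \<Longrightarrow> \<exists>U. open U \<and> x \<in> U \<and> smooth_on (U \<inter> S) f"
  shows "smooth_on S f"
  using assms(2) unfolding smooth_on_def by (metis Ck_on_local[OF assms(1)])

lemma smooth_on_const [simp]: "smooth_on S (\<lambda>x. c)"
  unfolding smooth_on_def by auto

lemma smooth_on_bounded_linear: "bounded_linear f \<Longrightarrow> smooth_on S f"
  unfolding smooth_on_def using Ck_on_bounded_linear by blast

lemma smooth_on_id: "smooth_on S (\<lambda>x. x)"
  unfolding smooth_on_def using Ck_on_id by blast

lemma smooth_on_add:
  assumes "open S" "smooth_on S f" "smooth_on S g"
  shows "smooth_on S (\<lambda>x. f x + g x)"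
  using assms by (simp add: smooth_on_def Ck_on_add)

lemma smooth_on_bilinear:
  assumes "bounded_bilinear b" "open S" "smooth_on S f" "smooth_on S g"
  shows "smooth_on S (\<lambda>x. b (f x) (g x))"
  using assms by (simp add: smooth_on_def Ck_on_bilinear)

lemma smooth_on_scaleR:
  assumes "open S" "smooth_on S f" "smooth_on S g"
  shows "smooth_on S (\<lambda>x. f x *\<^sub>R g x)"
  using smooth_on_bilinear[OF bounded_bilinear_scaleR assms] .

lemma smooth_on_mult:
  fixes f g :: "'a::euclidean_space \<Rightarrow> real"
  assumes "open S" "smooth_on S f" "smooth_on S g"
  shows "smooth_on S (\<lambda>x. f x * g x)"
  using smooth_on_bilinear[OF bounded_bilinear_mult assms] .

lemma smooth_on_sum:
  assumes "open S" "\<And>i. i \<in> I \<Longrightarrow> smooth_on S (f i)"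
  shows "smooth_on S (\<lambda>x. \<Sum>i\<in>I. f i x)"
  using assms by (simp add: smooth_on_def Ck_on_sum)

lemma smooth_on_prod:
  fixes f :: "'i \<Rightarrow> 'a::euclidean_space \<Rightarrow> real"
  assumes "open S" "\<And>i. i \<in> I \<Longrightarrow> smooth_on S (f i)"
  shows "smooth_on S (\<lambda>x. \<Prod>i\<in>I. f i x)"
  using assms by (simp add: smooth_on_def Ck_on_prod)

lemma smooth_on_compose:
  assumes "open S" "open T" "g ` S \<subseteq> T" "smooth_on T f" "smooth_on S g"
  shows "smooth_on S (\<lambda>x. f (g x))"
  using Ck_on_compose[OF assms(1-3)] assms(4,5) unfolding smooth_on_def by blast

lemma smooth_on_linear_compose:
  assumes "bounded_linear l" "open S" "smooth_on S f"
  shows "smooth_on S (\<lambda>x. l (f x))"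
  by (rule smooth_on_compose[OF assms(2) open_UNIV]) (use assms smooth_on_bounded_linear in auto)

lemma smooth_on_componentwise:
  assumes "open S" "\<And>i. i \<in> Basis \<Longrightarrow> smooth_on S (\<lambda>x. f x \<bullet> i)"
  shows "smooth_on S f"
proof -
  have "smooth_on S (\<lambda>x. \<Sum>i\<in>Basis. (f x \<bullet> i) *\<^sub>R i)"
    by (intro smooth_on_sum smooth_on_scaleR assms) auto
  then show ?thesis by (simp add: euclidean_representation)
qed

lemma smooth_on_vec:
  fixes f :: "'a::euclidean_space \<Rightarrow> real ^ 'n"
  assumes "open S" "\<And>i. smooth_on S (\<lambda>x. f x $ i)"
  shows "smooth_on S f"
  by (rule smooth_on_componentwise[OF assms(1)])
    (use assms(2) in \<open>auto simp: Basis_vec_def inner_axis\<close>)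

lemma smooth_on_vec_nth:
  fixes f :: "'a::euclidean_space \<Rightarrow> 'b::euclidean_space ^ 'n"
  assumes "open S" "smooth_on S f"
  shows "smooth_on S (\<lambda>x. f x $ i)"
  by (rule smooth_on_linear_compose[OF bounded_linear_vec_nth assms])

lemma smooth_on_matrix:
  fixes f :: "'a::euclidean_space \<Rightarrow> real ^ 'n ^ 'm"
  assumes "open S" "\<And>i j. smooth_on S (\<lambda>x. f x $ i $ j)"
  shows "smooth_on S f"
proof (rule smooth_on_componentwise[OF assms(1)])
  fix b :: "real ^ 'n ^ 'm"
  assume "b \<in> Basis"
  then obtain i j where "b = axis i (axis j 1)"
    by (auto simp: Basis_vec_def)
  then show "smooth_on S (\<lambda>x. f x \<bullet> b)"
    using assms(2) by (simp add: inner_axis)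
qed

lemma smooth_on_inverse:
  fixes f :: "'a::euclidean_space \<Rightarrow> real"
  assumes "open S" "smooth_on S f" "\<And>x. x \<in> S \<Longrightarrow> f x \<noteq> 0"
  shows "smooth_on S (\<lambda>x. inverse (f x))"
proof (rule smooth_on_compose[OF assms(1) _ _ _ assms(2), of "{x. x \<noteq> 0}"])
  show "open {x::real. x \<noteq> 0}"
    by (rule open_Collect_neq) auto
qed (use assms in \<open>auto simp: smooth_on_def Ck_on_inverse\<close>)

lemma smooth_on_divide:
  fixes f g :: "'a::euclidean_space \<Rightarrow> real"
  assumes "open S" "smooth_on S f" "smooth_on S g" "\<And>x. x \<in> S \<Longrightarrow> g x \<noteq> 0"
  shows "smooth_on S (\<lambda>x. f x / g x)"
  unfolding divide_inverse by (intro smooth_on_mult smooth_on_inverse assms)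

lemma smooth_on_powr:
  fixes f :: "'a::euclidean_space \<Rightarrow> real"
  assumes "open S" "smooth_on S f" "\<And>x. x \<in> S \<Longrightarrow> f x > 0"
  shows "smooth_on S (\<lambda>x. f x powr a)"
  by (rule smooth_on_compose[OF assms(1) _ _ _ assms(2), of "{0<..}"])
    (use assms in \<open>auto simp: smooth_on_def Ck_on_powr\<close>)

lemma smooth_on_det:
  fixes f :: "'a::euclidean_space \<Rightarrow> real ^ 'n ^ 'n"
  assumes "open S" "\<And>i j. smooth_on S (\<lambda>x. f x $ i $ j)"
  shows "smooth_on S (\<lambda>x. det (f x))"
  unfolding det_def by (intro smooth_on_sum smooth_on_mult smooth_on_prod assms smooth_on_const)

lemma smooth_on_has_derivative:
  assumes "smooth_on S f" "x \<in> S"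
  shows "(f has_derivative frechet_derivative f (at x)) (at x)"
proof -
  have "Ck_on (Suc 0) S f" using assms by (simp add: smooth_on_def del: Ck_on.simps)
  then show ?thesis using assms(2) by (auto simp: frechet_derivative_works)
qed

lemma smooth_on_frechet_derivative:
  assumes "smooth_on S f"
  shows "smooth_on S (\<lambda>x. frechet_derivative f (at x) v)"
  using assms unfolding smooth_on_def by (metis Ck_on.simps(2))

section \<open>Bump functions\<close>

text \<open>The flat function exp (-1/x) with the powers of 1/x that its derivatives produce:
  differentiation maps the family to linear combinations of its members, so all of them are shown to
  be C^k together.\<close>

definition flat_exp :: "nat \<Rightarrow> real \<Rightarrow> real" where
  "flat_exp n x = (if x > 0 then inverse x ^ n * exp (- inverse x) else 0)"

lemma flat_exp_tendsto_0: "((\<lambda>x. inverse x ^ n * exp (- inverse x)) \<longlongrightarrow> 0) (at_right (0::real))"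
proof -
  have "((\<lambda>x::real. x ^ n / exp x) \<longlongrightarrow> 0) at_top"
    by (rule tendsto_power_div_exp_0)
  from filterlim_compose[OF this filterlim_inverse_at_top_right]
  show ?thesis by (simp add: exp_minus divide_inverse)
qed

lemma flat_exp_has_derivative:
  "(flat_exp n has_real_derivative flat_exp (n + 2) x - n * flat_exp (n + 1) x) (at x)"
proof -
  consider "x > 0" | "x < 0" | "x = 0" by linarith
  then show ?thesis
  proof cases
    case 1
    have pw: "real n * inverse x ^ (n - 1) * (inverse x * inverse x) = real n * inverse x ^ (n + 1)"
      by (cases n) auto
    have "((\<lambda>x. inverse x ^ n * exp (- inverse x)) has_real_derivative
        flat_exp (n + 2) x - n * flat_exp (n + 1) x) (at x)"
      using 1 pw
      by (auto intro!: derivative_eq_intros simp: flat_exp_def algebra_simps power2_eq_square)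
    then show ?thesis
      by (rule DERIV_cong_ev[THEN iffD1, rotated -1])
        (use 1 in \<open>auto simp: flat_exp_def eventually_nhds intro!: exI[of _ "{0<..}"]\<close>)
  next
    case 2
    have "((\<lambda>x. 0) has_real_derivative flat_exp (n + 2) x - n * flat_exp (n + 1) x) (at x)"
      using 2 by (simp add: flat_exp_def)
    then show ?thesis
      by (rule DERIV_cong_ev[THEN iffD1, rotated -1])
        (use 2 in \<open>auto simp: flat_exp_def eventually_nhds intro!: exI[of _ "{..<0}"]\<close>)
  next
    case 3
    \<comment> \<open>To the right of 0 the difference quotient of \<open>flat_exp n\<close> is
      \<open>flat_exp (n + 1)\<close>, which tends to 0.\<close>
    have r: "((\<lambda>t. flat_exp n t / t) \<longlongrightarrow> 0) (at_right 0)"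
      by (rule Lim_transform_eventually[OF flat_exp_tendsto_0[of "n + 1"]])
        (auto simp: flat_exp_def eventually_at_filter divide_inverse mult_ac)
    have l: "((\<lambda>t. flat_exp n t / t) \<longlongrightarrow> 0) (at_left 0)"
      by (rule Lim_transform_eventually[OF tendsto_const])
        (auto simp: flat_exp_def eventually_at_filter)
    have "((\<lambda>t. flat_exp n t / t) \<longlongrightarrow> 0) (at 0)"
      using filterlim_split_at[OF l r] .
    then show ?thesis
      using 3 by (simp add: DERIV_def flat_exp_def)
  qed
qed

lemma Ck_on_flat_exp: "Ck_on k UNIV (flat_exp n)"
proof (induction k arbitrary: n)
  case 0
  then show ?case
    by (auto intro!: continuous_at_imp_continuous_on DERIV_isCont[OF flat_exp_has_derivative])
next
  case (Suc k)
  show ?case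
  proof (rule Ck_on_Suc_derivative[of _ _ "\<lambda>x v. (flat_exp (n + 2) x + (- real n) * flat_exp (n + 1) x) * v"])
    show "(flat_exp n has_derivative (\<lambda>v. (flat_exp (n + 2) x + (- real n) * flat_exp (n + 1) x) * v)) (at x)" for x
      using flat_exp_has_derivative[of n x] by (simp add: has_field_derivative_def)
    show "Ck_on k UNIV (\<lambda>x. (flat_exp (n + 2) x + (- real n) * flat_exp (n + 1) x) * v)" for v
      by (intro Ck_on_mult Ck_on_add Suc) auto
  qed auto
qed

lemma smooth_on_flat_exp: "open S \<Longrightarrow> smooth_on S f \<Longrightarrow> smooth_on S (\<lambda>x. flat_exp n (f x))"
  by (rule smooth_on_compose[OF _ open_UNIV]) (auto simp: smooth_on_def Ck_on_flat_exp)

text \<open>A quotient \<open>u / (u + v)\<close> of flat functions of the squared distance: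
  \<open>u\<close> is positive exactly inside the ball of radius 2 r and \<open>v\<close> exactly
  outside the closed ball of radius r, so the denominator has no zero.\<close>

lemma smooth_bump_exists:
  fixes a :: "'a::euclidean_space"
  assumes "r > 0"
  obtains b :: "'a \<Rightarrow> real" where "smooth_on UNIV b" "\<And>x. 0 \<le> b x" "\<And>x. b x \<le> 1"
    "\<And>x. x \<in> ball a r \<Longrightarrow> b x = 1" "\<And>x. x \<notin> ball a (2 * r) \<Longrightarrow> b x = 0"
proof
  define s where "s x = (x - a) \<bullet> (x - a)" for x
  define u where "u x = flat_exp 0 (4 * r\<^sup>2 - s x)" for x
  define v where "v x = flat_exp 0 (s x - r\<^sup>2)" for x
  define b where "b x = u x / (u x + v x)" for x
  have s: "smooth_on UNIV s"
  proof -
    have "smooth_on UNIV (\<lambda>x. (x + (- a)) \<bullet> (x + (- a)))"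
      by (intro smooth_on_bilinear[OF bounded_bilinear_inner] smooth_on_add smooth_on_id) auto
    then show ?thesis by (simp add: s_def[abs_def])
  qed
  have "smooth_on UNIV (\<lambda>x. flat_exp 0 (4 * r\<^sup>2 + (-1) * s x))"
    by (intro smooth_on_flat_exp smooth_on_add smooth_on_mult s) auto
  then have u: "smooth_on UNIV u" by (simp add: u_def[abs_def])
  have "smooth_on UNIV (\<lambda>x. flat_exp 0 (s x + (- r\<^sup>2)))"
    by (intro smooth_on_flat_exp smooth_on_add s) auto
  then have v: "smooth_on UNIV v" by (simp add: v_def[abs_def])
  have nonneg: "0 \<le> u x" "0 \<le> v x" for x
    by (auto simp: u_def v_def flat_exp_def)
  have pos: "0 < u x + v x" for x
  proof (cases "s x < 4 * r\<^sup>2")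
    case True
    then have "0 < u x" by (auto simp: u_def flat_exp_def)
    then show ?thesis using nonneg(2)[of x] by linarith
  next
    case False
    then have "r\<^sup>2 < s x" using assms by (smt (verit) zero_less_power2)
    then have "0 < v x" by (auto simp: v_def flat_exp_def)
    then show ?thesis using nonneg(1)[of x] by linarith
  qed
  have sd: "s x = (dist a x)\<^sup>2" for x
    by (simp add: s_def dist_norm norm_minus_commute power2_norm_eq_inner[symmetric])
  show "smooth_on UNIV b"
    unfolding b_def by (intro smooth_on_divide smooth_on_add u v) (auto, metis less_irrefl pos)
  show "0 \<le> b x" "b x \<le> 1" for x
    using nonneg[of x] pos[of x] by (auto simp: b_def field_simps)
  show "b x = 1" if "x \<in> ball a r" for x
  proof -
    have "s x < r\<^sup>2" using that assms by (auto simp: sd intro!: power_strict_mono)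
    then have "v x = 0" by (simp add: v_def flat_exp_def)
    then show ?thesis using pos[of x] by (simp add: b_def)
  qed
  show "b x = 0" if "x \<notin> ball a (2 * r)" for x
  proof -
    have "(2 * r)\<^sup>2 \<le> s x" unfolding sd by (rule power_mono) (use that assms in auto)
    then have "u x = 0" by (simp add: u_def flat_exp_def power_mult_distrib)
    then show ?thesis by (simp add: b_def)
  qed
qed

section \<open>Integration by parts\<close>

text \<open>Translation invariance of Lebesgue measure makes the integral of every difference
  quotient 0; dominated convergence carries this over to the derivative. All integration by parts
  below rests on it.\<close>

lemma integral_directional_derivative_eq_0:
  fixes f :: "'a::euclidean_space \<Rightarrow> real"
  assumes f': "\<And>x. (f has_derivative f' x) (at x)"
    and cont: "continuous_on UNIV (\<lambda>x. f' x v)"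
    and K: "compact K" "\<And>x. x \<notin> K \<Longrightarrow> f x = 0"
  shows "(\<integral>x. f' x v \<partial>lborel) = 0"
proof -
  \<comment> \<open>The points that reach \<open>K\<close> when some s v with 0 \<le> s \<le> 1 is
    added. By the mean value theorem all difference quotients below vanish outside this compact
    set.\<close>
  define R where "R = (\<lambda>p. fst p + snd p *\<^sub>R v) ` (K \<times> {-1..0})"
  have R: "compact R"
    unfolding R_def by (intro compact_continuous_image compact_Times K) (auto intro!: continuous_intros)
  have f'K: "f' x v = 0" if "x \<notin> K" for x
  proof -
    have "(f has_derivative (\<lambda>_. 0)) (at x)"
      by (rule has_derivative_transform_within_open[of "\<lambda>_. 0" _ _ _ "- K"])
        (use that K in \<open>auto simp: compact_imp_closed open_Compl\<close>)
    then show ?thesis using has_derivative_unique[OF f'[of x]] by metis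
  qed
  obtain C where C: "\<And>x. \<bar>f' x v\<bar> \<le> C"
  proof -
    have "bounded ((\<lambda>x. f' x v) ` K)"
      by (intro compact_imp_bounded compact_continuous_image continuous_on_subset[OF cont] K) auto
    then obtain B where "\<And>x. x \<in> K \<Longrightarrow> \<bar>f' x v\<bar> \<le> B"
      by (auto simp: bounded_iff)
    then have "\<bar>f' x v\<bar> \<le> max B 0" for x
      using f'K[of x] by (cases "x \<in> K") fastforce+
    then show thesis by (rule that)
  qed
  have contf: "continuous_on UNIV f"
    using f' has_derivative_continuous by (blast intro: continuous_at_imp_continuous_on)
  have intf: "integrable lborel f"
  proof -
    have "integrable lborel (\<lambda>x. indicator K x *\<^sub>R f x)"
      by (intro borel_integrable_compact K continuous_on_subset[OF contf]) auto
    moreover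
    have "indicator K x *\<^sub>R f x = f x" for x
      using K(2)[of x] by (cases "x \<in> K") auto
    then have "(\<lambda>x. indicator K x *\<^sub>R f x) = f" by (rule ext)
    ultimately show ?thesis by simp
  qed
  define q where "q k x = (f (x + inverse (real (Suc k)) *\<^sub>R v) - f x) / inverse (real (Suc k))" for k x
  have shift: "integrable lborel (\<lambda>x. f (x + w))" "(\<integral>x. f (x + w) \<partial>lborel) = (\<integral>x. f x \<partial>lborel)" for w
    using lborel_distr_plus[of w] intf borel_measurable_continuous_onI[OF contf]
      integrable_distr_eq[of "(+) w" lborel borel f] integral_distr[of "(+) w" lborel borel f]
    by (auto simp: add.commute[of w])
  have q0: "(\<integral>x. q k x \<partial>lborel) = 0" for k
    unfolding q_def using shift intf by simp
  have "(\<lambda>k. \<integral>x. q k x \<partial>lborel) \<longlonglongrightarrow> (\<integral>x. f' x v \<partial>lborel)"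
  proof (rule integral_dominated_convergence[where w = "\<lambda>x. indicator R x *\<^sub>R C"])
    show "(\<lambda>x. f' x v) \<in> borel_measurable lborel"
      using borel_measurable_continuous_onI[OF cont] by simp
    show "q k \<in> borel_measurable lborel" for k
      unfolding q_def using shift intf by (intro borel_measurable_integrable) auto
    show "integrable lborel (\<lambda>x. indicator R x *\<^sub>R C)"
      by (intro borel_integrable_compact R) auto
    show "AE x in lborel. (\<lambda>k. q k x) \<longlonglongrightarrow> f' x v"
    proof (rule AE_I2)
      fix x
      have "((\<lambda>t. f (x + t *\<^sub>R v)) has_derivative (\<lambda>t. f' x (t *\<^sub>R v))) (at 0)"
        by (rule has_derivative_compose[of "\<lambda>t. x + t *\<^sub>R v" "\<lambda>t. t *\<^sub>R v" 0 UNIV f, simplified])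
          (auto intro!: derivative_eq_intros f')
      then have "((\<lambda>t. f (x + t *\<^sub>R v)) has_real_derivative f' x v) (at 0)"
        using has_derivative_linear[OF f'[of x]]
        by (simp add: has_field_derivative_def linear_scale mult.commute[of _ "f' x v"])
      then have "((\<lambda>t. (f (x + t *\<^sub>R v) - f x) / t) \<longlongrightarrow> f' x v) (at 0)"
        by (simp add: DERIV_def)
      moreover have "filterlim (\<lambda>k. inverse (real (Suc k))) (at 0) sequentially"
        by (rule filterlim_atI[OF LIMSEQ_inverse_real_of_nat]) auto
      ultimately show "(\<lambda>k. q k x) \<longlonglongrightarrow> f' x v"
        unfolding q_def by (rule filterlim_compose)
    qed
    show "AE x in lborel. norm (q k x) \<le> indicator R x *\<^sub>R C" for k
    proof (rule AE_I2)
      fix x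
      define t where "t = inverse (real (Suc k))"
      have t: "0 < t" "t \<le> 1" by (auto simp: t_def field_simps)
      have "\<exists>s\<in>{0<..<t}. f (x + t *\<^sub>R v) - f (x + 0 *\<^sub>R v) = (\<lambda>u. u * f' (x + s *\<^sub>R v) v) (t - 0)"
      proof (rule mvt_simple[OF t(1)])
        fix s
        show "((\<lambda>t. f (x + t *\<^sub>R v)) has_derivative (\<lambda>u. u * f' (x + s *\<^sub>R v) v)) (at s within {0..t})"
        proof -
          have "((\<lambda>t. f (x + t *\<^sub>R v)) has_derivative (\<lambda>t. f' (x + s *\<^sub>R v) (t *\<^sub>R v))) (at s within {0..t})"
            by (rule has_derivative_compose[of "\<lambda>t. x + t *\<^sub>R v" "\<lambda>t. t *\<^sub>R v" s "{0..t}" f])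
              (auto intro!: derivative_eq_intros f')
          then show ?thesis
            using has_derivative_linear[OF f'[of "x + s *\<^sub>R v"]] by (simp add: linear_scale)
        qed
      qed
      then obtain s where s: "0 < s" "s < t" "f (x + t *\<^sub>R v) - f x = t * f' (x + s *\<^sub>R v) v"
        by auto
      have q: "q k x = f' (x + s *\<^sub>R v) v"
        unfolding q_def t_def[symmetric] using s t by simp
      show "norm (q k x) \<le> indicator R x *\<^sub>R C"
      proof (cases "x + s *\<^sub>R v \<in> K")
        case True
        then have "x \<in> R"
          unfolding R_def using s t by (intro image_eqI[of _ _ "(x + s *\<^sub>R v, - s)"]) auto
        then show ?thesis using q C by simp
      next
        case False
        then show ?thesis using q f'K C[of x] by (auto simp: indicator_def)
      qed
    qed
  qed
  then show ?thesis
    by (simp add: q0 LIMSEQ_const_iff)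
qed

section \<open>Linear algebra of inner products\<close>

lemma inner_product_on_UNIV_simps:
  assumes "inner_product_on UNIV b"
  shows "b u v = b v u" "b (u + v) w = b u w + b v w" "b u (v + w) = b u v + b u w"
    "b (r *\<^sub>R u) v = r * b u v" "b u (r *\<^sub>R v) = r * b u v" "u \<noteq> 0 \<Longrightarrow> b u u > 0"
  using assms by (auto simp: inner_product_on_def; metis)+

lemma inner_product_on_UNIV_bilinear:
  assumes "inner_product_on UNIV b"
  shows "bilinear b"
  unfolding bilinear_def by (auto intro!: linearI simp: inner_product_on_UNIV_simps(2-5)[OF assms])

lemma inner_product_on_UNIV_eq_0: "inner_product_on UNIV b \<Longrightarrow> b u u = 0 \<Longrightarrow> u = 0"
  using inner_product_on_UNIV_simps(6) by fastforce

text \<open>Gram-Schmidt along the index type: as long as an index is missing, the vectors found so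
  far span a proper subspace, and an outside vector can be made orthogonal to them and
  normalised.\<close>

lemma orthonormal_basis_exists:
  fixes b :: "real ^ 'n \<Rightarrow> real ^ 'n \<Rightarrow> real"
  assumes b: "inner_product_on UNIV b"
  shows "\<exists>e. orthonormal_basis_for b e"
proof -
  note bs = inner_product_on_UNIV_simps[OF b]
  have lin: "linear (\<lambda>u. b u w)" for w
    by (auto intro!: linearI simp: bs(2,4))
  have "\<exists>e. \<forall>i\<in>I. \<forall>j\<in>I. b (e i) (e j) = (if i = j then 1 else 0)" for I :: "'n set"
    using finite[of I]
  proof (induction I rule: finite_induct)
    case empty
    then show ?case by simp
  next
    case (insert k I)
    then obtain e where e: "\<And>i j. i \<in> I \<Longrightarrow> j \<in> I \<Longrightarrow> b (e i) (e j) = (if i = j then 1 else 0)"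
      by blast
    have "dim (e ` I) \<le> card I"
      using insert.hyps(1) by (meson card_image_le dim_le_card' finite_imageI order_trans)
    also have "card I < CARD('n)"
      using insert.hyps by (metis UNIV_I finite psubset_card_mono subset_UNIV psubsetI)
    finally have "dim (e ` I) < dim (UNIV :: (real ^ 'n) set)" by simp
    then have "span (e ` I) \<noteq> UNIV"
      by (metis dim_span less_irrefl)
    then obtain v where v: "v \<notin> span (e ` I)" by blast
    define u where "u = v - (\<Sum>i\<in>I. b v (e i) *\<^sub>R e i)"
    have "(\<Sum>i\<in>I. b v (e i) *\<^sub>R e i) \<in> span (e ` I)"
      by (intro span_sum span_scale span_base imageI)
    then have "u \<noteq> 0"
      using v by (auto simp: u_def)
    then have pos: "b u u > 0" by (rule bs(6))
    have orth: "b u (e j) = 0" if "j \<in> I" for j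
    proof -
      have "b u (e j) = b v (e j) - (\<Sum>i\<in>I. b v (e i) * b (e i) (e j))"
        by (simp add: u_def linear_diff[OF lin] linear_sum[OF lin] bs(4))
      also have "(\<Sum>i\<in>I. b v (e i) * b (e i) (e j)) = (\<Sum>i\<in>I. if i = j then b v (e i) else 0)"
        using e that by (intro sum.cong) auto
      also have "\<dots> = b v (e j)" using that insert.hyps(1) by simp
      finally show ?thesis by simp
    qed
    define w where "w = (1 / sqrt (b u u)) *\<^sub>R u"
    have ww: "b w w = 1" using pos by (simp add: w_def bs(4,5))
    have w: "b w (e j) = 0" "b (e j) w = 0" if "j \<in> I" for j
      using orth[OF that] bs(1)[of "e j" w] by (auto simp: w_def bs(4))
    show ?case
      using e ww w insert.hyps(2) by (intro exI[of _ "e(k := w)"]) auto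
  qed
  from this[of UNIV] show ?thesis
    by (auto simp: orthonormal_basis_for_def)
qed

lemma orthonormal_basis_for_some:
  "inner_product_on UNIV b \<Longrightarrow> orthonormal_basis_for b (SOME e. orthonormal_basis_for b e)"
  using orthonormal_basis_exists someI_ex by metis

lemma bilinear_expand:
  fixes B :: "'a::real_vector \<Rightarrow> 'b::real_vector \<Rightarrow> real" and L :: "real ^ 'n \<Rightarrow> 'a" and L' :: "real ^ 'm \<Rightarrow> 'b"
  assumes "bilinear B" "linear L" "linear L'"
  shows "B (L x) (L' y) = (\<Sum>a\<in>UNIV. \<Sum>c\<in>UNIV. x $ a * y $ c * B (L (axis a 1)) (L' (axis c 1)))"
proof -
  have "L x = L (\<Sum>a\<in>UNIV. x $ a *\<^sub>R axis a 1)" "L' y = L' (\<Sum>a\<in>UNIV. y $ a *\<^sub>R axis a 1)"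
    using basis_expansion[of x] basis_expansion[of y] by (simp_all add: scalar_mult_eq_scaleR)
  then have "L x = (\<Sum>a\<in>UNIV. x $ a *\<^sub>R L (axis a 1))" "L' y = (\<Sum>a\<in>UNIV. y $ a *\<^sub>R L' (axis a 1))"
    by (simp_all add: linear_sum[OF assms(2)] linear_scale[OF assms(2)] linear_sum[OF assms(3)] linear_scale[OF assms(3)])
  then show ?thesis
    by (simp add: bilinear_sum[OF assms(1)] sum.cartesian_product split_def
        bilinear_lmul[OF assms(1)] bilinear_rmul[OF assms(1)] mult_ac)
qed

lemma matrix_inv_eqI:
  fixes G :: "'a::field ^ 'n ^ 'n"
  assumes "G ** H = mat 1"
  shows "matrix_inv G = H"
proof -
  have "H ** G = mat 1" using assms matrix_left_right_inverse by blast
  then have "G ** matrix_inv G = mat 1"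
    unfolding matrix_inv_def using assms by (rule_tac someI2[of _ H]) auto
  then show ?thesis
    using \<open>H ** G = mat 1\<close> by (metis matrix_mul_assoc matrix_mul_lid matrix_mul_rid)
qed

text \<open>Let the rows of P be the coordinates of an orthonormal basis with respect to
  \<open>L\<close>. Orthonormality reads P G P^T = 1, which yields at once det G > 0 and G^-1 = P^T
  P; the trace formula is the latter identity summed against the values of \<open>B\<close>.\<close>

lemma
  fixes b :: "real ^ 'n \<Rightarrow> real ^ 'n \<Rightarrow> real" and L :: "real ^ 'n \<Rightarrow> real ^ 'n"
  assumes b: "inner_product_on UNIV b" and L: "linear L" "surj L"
  defines "G \<equiv> \<chi> i j. b (L (axis i 1)) (L (axis j 1))"
  shows gram_matrix_det_pos: "det G > 0"
    and orthonormal_trace: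
      "orthonormal_basis_for b e \<Longrightarrow> bilinear B \<Longrightarrow>
       (\<Sum>i\<in>UNIV. B (e i) (e i)) =
       (\<Sum>a\<in>UNIV. \<Sum>c\<in>UNIV. matrix_inv G $ a $ c * B (L (axis a 1)) (L (axis c 1)))"
proof -
  have *: "det G > 0 \<and> (bilinear B \<longrightarrow> (\<Sum>i\<in>UNIV. B (e i) (e i)) =
       (\<Sum>a\<in>UNIV. \<Sum>c\<in>UNIV. matrix_inv G $ a $ c * B (L (axis a 1)) (L (axis c 1))))"
    if e: "orthonormal_basis_for b e" for e and B :: "real ^ 'n \<Rightarrow> real ^ 'n \<Rightarrow> real"
  proof -
    define P where "P = (\<chi> i. inv L (e i))"
    have P: "L (P $ i) = e i" for i
      using L(2) by (simp add: P_def surj_f_inv_f)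
    have "(P ** G ** transpose P) $ i $ j = (mat 1 :: real ^ 'n ^ 'n) $ i $ j" for i j
    proof -
      have "b (e i) (e j) = (\<Sum>a\<in>UNIV. \<Sum>c\<in>UNIV. P $ i $ a * P $ j $ c * G $ a $ c)"
        using bilinear_expand[OF inner_product_on_UNIV_bilinear[OF b] L(1) L(1), of "P $ i" "P $ j"]
        by (simp add: P G_def)
      also have "\<dots> = (P ** G ** transpose P) $ i $ j"
        by (subst sum.swap)
          (simp add: matrix_matrix_mult_def transpose_def sum_distrib_left sum_distrib_right mult_ac)
      finally show ?thesis
        using e by (simp add: orthonormal_basis_for_def mat_def)
    qed
    then have PGP: "P ** G ** transpose P = mat 1"
      by (simp add: vec_eq_iff)
    have "(det P)\<^sup>2 * det G = 1"
      using arg_cong[OF PGP, of det] by (simp add: det_mul det_transpose power2_eq_square mult_ac)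
    then have det: "det G > 0"
      by (metis zero_less_mult_pos zero_less_one zero_le_power2 less_eq_real_def mult_zero_left zero_neq_one)
    have "(G ** transpose P) ** P = mat 1"
      using PGP matrix_left_right_inverse by (metis matrix_mul_assoc)
    then have inv1: "G ** (transpose P ** P) = mat 1"
      by (simp add: matrix_mul_assoc)
    then have inv: "matrix_inv G = transpose P ** P"
      by (rule matrix_inv_eqI)
    have "(\<Sum>i\<in>UNIV. B (e i) (e i)) =
       (\<Sum>a\<in>UNIV. \<Sum>c\<in>UNIV. matrix_inv G $ a $ c * B (L (axis a 1)) (L (axis c 1)))" if B: "bilinear B"
    proof -
      have "(\<Sum>i\<in>UNIV. B (e i) (e i)) =
         (\<Sum>i\<in>UNIV. \<Sum>a\<in>UNIV. \<Sum>c\<in>UNIV. P $ i $ a * P $ i $ c * B (L (axis a 1)) (L (axis c 1)))"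
        using bilinear_expand[OF B L(1) L(1), of "P $ i" "P $ i" for i] by (intro sum.cong refl) (simp only: P)
      also have "\<dots> = (\<Sum>a\<in>UNIV. \<Sum>c\<in>UNIV. \<Sum>i\<in>UNIV. P $ i $ a * P $ i $ c * B (L (axis a 1)) (L (axis c 1)))"
        by (subst sum.swap) (intro sum.cong refl sum.swap)
      also have "\<dots> = (\<Sum>a\<in>UNIV. \<Sum>c\<in>UNIV. matrix_inv G $ a $ c * B (L (axis a 1)) (L (axis c 1)))"
        by (simp add: inv matrix_matrix_mult_def transpose_def sum_distrib_right)
      finally show ?thesis .
    qed
    with det show ?thesis by blast
  qed
  show "det G > 0" using * orthonormal_basis_exists[OF b] by blast
  show "(\<Sum>i\<in>UNIV. B (e i) (e i)) =
       (\<Sum>a\<in>UNIV. \<Sum>c\<in>UNIV. matrix_inv G $ a $ c * B (L (axis a 1)) (L (axis c 1)))"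
    if "orthonormal_basis_for b e" "bilinear B" using * that by blast
qed

text \<open>\<open>matrix_inv\<close> is defined by a choice, which says nothing about regularity.
  Cramer's rule exhibits its entries as quotients of determinants, hence as smooth functions of the
  entries of \<open>G\<close>.\<close>

lemma matrix_inv_cramer:
  fixes G :: "real ^ 'n ^ 'n"
  assumes "det G \<noteq> 0"
  shows "matrix_inv G $ a $ c = det (\<chi> i j. if j = a then axis c 1 $ i else G $ i $ j) / det G"
proof -
  have "G ** matrix_inv G = mat 1"
    using assms invertible_det_nz[of G] matrix_inv_eqI unfolding invertible_def by blast
  then have "G *v (matrix_inv G *v axis c 1) = axis c 1"
    by (simp add: matrix_vector_mul_assoc)
  then have "matrix_inv G *v axis c 1 = (\<chi> k. det (\<chi> i j. if j = k then axis c 1 $ i else G $ i $ j) / det G)"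
    using cramer[OF assms, of "matrix_inv G *v axis c 1" "axis c 1"] by (simp only:)
  then show ?thesis
    by (simp add: matrix_vector_mult_basis column_def vec_eq_iff)
qed

lemma orthonormal_expand:
  fixes b :: "real ^ 'n \<Rightarrow> real ^ 'n \<Rightarrow> real"
  assumes b: "inner_product_on UNIV b" and e: "orthonormal_basis_for b e"
  shows "v = (\<Sum>i\<in>UNIV. b v (e i) *\<^sub>R e i)"
proof -
  note bs = inner_product_on_UNIV_simps[OF b]
  have linl: "linear (\<lambda>u. b u v)" for v
    using inner_product_on_UNIV_bilinear[OF b] by (auto simp: bilinear_def)
  have ee: "b (e i) (e j) = (if i = j then 1 else 0)" for i j
    using e by (simp add: orthonormal_basis_for_def)
  have comb: "b (\<Sum>i\<in>UNIV. c i *\<^sub>R e i) (e j) = c j" for c j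
    by (simp add: linear_sum[OF linl] bs(4) ee if_distrib cong: if_cong)
  have "inj e"
    using ee by (auto simp: inj_def) (metis zero_neq_one)
  have "independent (range e)"
  proof (rule independent_if_scalars_zero)
    fix f x assume s: "(\<Sum>x\<in>range e. f x *\<^sub>R x) = 0" and "x \<in> range e"
    then obtain j where j: "x = e j" by blast
    have "(\<Sum>i\<in>UNIV. f (e i) *\<^sub>R e i) = 0"
      using s by (simp add: sum.reindex[OF \<open>inj e\<close>])
    then show "f x = 0"
      using comb[of "\<lambda>i. f (e i)" j] linear_0[OF linl] by (simp add: j)
  qed auto
  moreover have "card (range e) = dim (UNIV :: (real ^ 'n) set)"
    using \<open>inj e\<close> by (simp add: card_image)
  ultimately have "span (range e) = UNIV"
    by (metis card_eq_dim subset_UNIV top.extremum_unique finite_imageI finite dim_UNIV)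
  then have "v \<in> span (range e)" by simp
  then obtain f where "v = (\<Sum>x\<in>range e. f x *\<^sub>R x)"
    by (auto simp: span_finite)
  then have v: "v = (\<Sum>i\<in>UNIV. f (e i) *\<^sub>R e i)"
    by (simp add: sum.reindex[OF \<open>inj e\<close>])
  have "b v (e j) = f (e j)" for j
    using comb[of "\<lambda>i. f (e i)" j] unfolding v[symmetric] .
  with v show ?thesis by simp
qed

text \<open>The definite description has the form of \<open>gradient\<close>, so this provides both
  the defining property of the gradient and its squared length as the trace of \<alpha> \<otimes>
  \<alpha>.\<close>

lemma riesz_orthonormal:
  fixes b :: "real ^ 'n \<Rightarrow> real ^ 'n \<Rightarrow> real" and \<alpha> :: "real ^ 'n \<Rightarrow> real"
  assumes b: "inner_product_on UNIV b" and \<alpha>: "linear \<alpha>" and e: "orthonormal_basis_for b e"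
  defines "w \<equiv> THE w. \<forall>v. b w v = \<alpha> v"
  shows "b w v = \<alpha> v" "b w w = (\<Sum>i\<in>UNIV. \<alpha> (e i) * \<alpha> (e i))"
proof -
  note bs = inner_product_on_UNIV_simps[OF b]
  have linl: "linear (\<lambda>u. b u v)" for v
    using inner_product_on_UNIV_bilinear[OF b] by (auto simp: bilinear_def)
  define u where "u = (\<Sum>i\<in>UNIV. \<alpha> (e i) *\<^sub>R e i)"
  have u: "b u v = \<alpha> v" for v
  proof -
    have "b u v = (\<Sum>i\<in>UNIV. \<alpha> (e i) * b v (e i))"
      by (simp add: u_def linear_sum[OF linl] bs(4) bs(1)[of v])
    also have "\<dots> = \<alpha> (\<Sum>i\<in>UNIV. b v (e i) *\<^sub>R e i)"
      by (simp add: linear_sum[OF \<alpha>] linear_scale[OF \<alpha>] mult.commute)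
    also have "\<dots> = \<alpha> v" by (simp flip: orthonormal_expand[OF b e])
    finally show ?thesis .
  qed
  have "w = u"
    unfolding w_def
  proof (rule the_equality)
    show "\<forall>v. b u v = \<alpha> v" using u by blast
    fix w' assume "\<forall>v. b w' v = \<alpha> v"
    then have "b (w' - u) (w' - u) = 0"
      using u linear_diff[OF linl] by simp
    then show "w' = u" using inner_product_on_UNIV_eq_0[OF b] by fastforce
  qed
  then show "b w v = \<alpha> v" and "b w w = (\<Sum>i\<in>UNIV. \<alpha> (e i) * \<alpha> (e i))"
    using u by (simp, simp add: u_def linear_sum[OF \<alpha>] linear_scale[OF \<alpha>])
qed

section \<open>Charts and smooth functions\<close>

context oriented_manifold
begin

lemma chart_open: "c \<in> A \<Longrightarrow> open (fst c)"
  and chart_inv_left: "c \<in> A \<Longrightarrow> x \<in> fst c \<Longrightarrow> chart_inv c (snd c x) = x"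
  and chart_inv_right: "c \<in> A \<Longrightarrow> y \<in> snd c ` fst c \<Longrightarrow> snd c (chart_inv c y) = y"
  and chart_inv_mem: "c \<in> A \<Longrightarrow> y \<in> snd c ` fst c \<Longrightarrow> chart_inv c y \<in> fst c"
  and chart_continuous: "c \<in> A \<Longrightarrow> continuous_on (fst c) (snd c)"
  and chart_inv_continuous: "c \<in> A \<Longrightarrow> continuous_on (snd c ` fst c) (chart_inv c)"
  using charts[of c] by (auto simp: is_chart_def homeomorphism_def)

lemma chart_image_eq:
  assumes "c \<in> A" "W \<subseteq> fst c"
  shows "snd c ` W = snd c ` fst c \<inter> chart_inv c -` W"
  using assms(2) chart_inv_left[OF assms(1)] chart_inv_right[OF assms(1)] by (auto simp: image_iff subset_iff; metis)

lemma chart_image_open: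
  assumes "c \<in> A" "open W" "W \<subseteq> fst c"
  shows "open (snd c ` W)"
  unfolding chart_image_eq[OF assms(1,3)]
  by (rule continuous_open_preimage[OF chart_inv_continuous[OF assms(1)] _ assms(2)])
    (use charts[OF assms(1)] in \<open>simp add: is_chart_def\<close>)

lemma chart_image_Int_open: "c \<in> A \<Longrightarrow> open W \<Longrightarrow> open (snd c ` (fst c \<inter> W))"
  by (intro chart_image_open) (auto simp: chart_open)

lemma chart_inv_image_open:
  assumes "c \<in> A" "open V" "V \<subseteq> snd c ` fst c"
  shows "open (chart_inv c ` V)"
proof -
  have "chart_inv c ` V = fst c \<inter> snd c -` V"
    using assms by (auto simp: chart_inv_left chart_inv_right chart_inv_mem image_iff subset_iff)
      (metis chart_inv_left)+
  then show ?thesis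
    using continuous_open_preimage[OF chart_continuous[OF assms(1)] chart_open[OF assms(1)] assms(2)] by simp
qed

lemma chart_exists: obtains c where "c \<in> A" "x \<in> fst c"
  using charts_cover by blast

lemma chart_at: "chart_at A x \<in> A" "x \<in> fst (chart_at A x)"
  using someI_ex[of "\<lambda>c. c \<in> A \<and> x \<in> fst c"] chart_exists[of x] unfolding chart_at_def by blast+

lemma smooth_map_onD:
  assumes "smooth_map_on A W f" "c \<in> A"
  shows "smooth_on (snd c ` (fst c \<inter> W)) (f \<circ> chart_inv c)"
  using assms by (simp add: smooth_map_on_def)

text \<open>\<open>smooth_map_on\<close> quantifies over all charts. As transition maps are smooth,
  one chart around each point suffices.\<close>

lemma smooth_map_on_chartI:
  assumes W: "open W"
    and loc: "\<And>x. x \<in> W \<Longrightarrow> \<exists>c\<in>A. \<exists>U. open U \<and> x \<in> U \<and> U \<subseteq> fst c \<and> smooth_on (snd c ` U) (f \<circ> chart_inv c)"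
  shows "smooth_map_on A W f"
  unfolding smooth_map_on_def
proof
  fix d assume d: "d \<in> A"
  show "smooth_on (snd d ` (fst d \<inter> W)) (f \<circ> chart_inv d)"
  proof (rule smooth_on_local[OF chart_image_Int_open[OF d W]])
    fix y assume "y \<in> snd d ` (fst d \<inter> W)"
    then obtain x where x: "x \<in> fst d" "x \<in> W" "y = snd d x" by blast
    from loc[OF x(2)] obtain c U where c: "c \<in> A" and U: "open U" "x \<in> U" "U \<subseteq> fst c"
      and sm: "smooth_on (snd c ` U) (f \<circ> chart_inv c)" by blast
    define V where "V = snd d ` (fst d \<inter> (W \<inter> U))"
    have V: "open V" unfolding V_def by (rule chart_image_Int_open[OF d]) (use W U in auto)
    have "smooth_on V (\<lambda>y. (f \<circ> chart_inv c) ((snd c \<circ> chart_inv d) y))"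
    proof (rule smooth_on_compose[OF V _ _ sm])
      show "open (snd c ` U)" by (rule chart_image_open[OF c U(1,3)])
      show "(snd c \<circ> chart_inv d) ` V \<subseteq> snd c ` U"
        unfolding V_def using d by (auto simp: chart_inv_left)
      show "smooth_on V (snd c \<circ> chart_inv d)"
        by (rule smooth_on_subset[OF charts_compatible[OF d c]]) (use U in \<open>auto simp: V_def\<close>)
    qed
    moreover have "(f \<circ> chart_inv c) ((snd c \<circ> chart_inv d) y) = (f \<circ> chart_inv d) y" if "y \<in> V" for y
      using that U(3) unfolding V_def by (auto simp: chart_inv_left[OF d] chart_inv_left[OF c])
    ultimately have "smooth_on V (f \<circ> chart_inv d)"
      by (rule smooth_on_cong[OF V, THEN iffD1, rotated])
    then show "\<exists>V. open V \<and> y \<in> V \<and> smooth_on (V \<inter> snd d ` (fst d \<inter> W)) (f \<circ> chart_inv d)"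
      using V x U(2) by (intro exI[of _ V] conjI) (auto simp: V_def intro: smooth_on_subset)
  qed
qed

lemma smooth_map_on_subset: "smooth_map_on A W f \<Longrightarrow> V \<subseteq> W \<Longrightarrow> smooth_map_on A V f"
  unfolding smooth_map_on_def by (meson Int_mono image_mono order_refl smooth_on_subset)

lemma smooth_map_on_local:
  assumes "open W" "\<And>x. x \<in> W \<Longrightarrow> \<exists>U. open U \<and> x \<in> U \<and> smooth_map_on A (U \<inter> W) f"
  shows "smooth_map_on A W f"
proof (rule smooth_map_on_chartI[OF assms(1)])
  fix x assume "x \<in> W"
  with assms(2) obtain U where U: "open U" "x \<in> U" "smooth_map_on A (U \<inter> W) f" by blast
  obtain c where c: "c \<in> A" "x \<in> fst c" by (rule chart_exists)
  show "\<exists>c\<in>A. \<exists>U. open U \<and> x \<in> U \<and> U \<subseteq> fst c \<and> smooth_on (snd c ` U) (f \<circ> chart_inv c)"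
    using c U \<open>x \<in> W\<close> assms(1) chart_open[OF c(1)] smooth_map_onD[OF U(3) c(1)]
    by (intro bexI[of _ c] exI[of _ "fst c \<inter> (U \<inter> W)"]) auto
qed

lemma smooth_map_on_cong:
  assumes "open W" "\<And>x. x \<in> W \<Longrightarrow> f x = g x"
  shows "smooth_map_on A W f \<longleftrightarrow> smooth_map_on A W g"
  unfolding smooth_map_on_def
proof (intro ball_cong refl smooth_on_cong chart_image_Int_open assms(1))
  fix c y assume "c \<in> A" "y \<in> snd c ` (fst c \<inter> W)"
  then show "(f \<circ> chart_inv c) y = (g \<circ> chart_inv c) y"
    using assms(2) chart_inv_left[of c] by auto
qed

lemma smooth_map_on_compose:
  assumes "open W" "open T" "f ` W \<subseteq> T" "smooth_map_on A W f" "smooth_on T u"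
  shows "smooth_map_on A W (\<lambda>x. u (f x))"
  unfolding smooth_map_on_def
proof
  fix c assume c: "c \<in> A"
  have "smooth_on (snd c ` (fst c \<inter> W)) (\<lambda>y. u ((f \<circ> chart_inv c) y))"
    by (rule smooth_on_compose[OF chart_image_Int_open[OF c assms(1)] assms(2) _ assms(5) smooth_map_onD[OF assms(4) c]])
      (use assms(3) c in \<open>auto simp: chart_inv_left\<close>)
  then show "smooth_on (snd c ` (fst c \<inter> W)) ((\<lambda>x. u (f x)) \<circ> chart_inv c)" by (simp add: o_def)
qed

lemma smooth_map_on_const [simp]: "smooth_map_on A W (\<lambda>x. a)"
  by (simp add: smooth_map_on_def o_def)

lemma smooth_map_on_bilinear:
  assumes "bounded_bilinear b" "open W" "smooth_map_on A W f" "smooth_map_on A W g"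
  shows "smooth_map_on A W (\<lambda>x. b (f x) (g x))"
  unfolding smooth_map_on_def o_def
  by (intro ballI smooth_on_bilinear[OF assms(1)] chart_image_Int_open assms(2))
    (use assms(3,4) in \<open>simp_all add: smooth_map_on_def o_def\<close>)

lemma smooth_map_on_add:
  assumes "open W" "smooth_map_on A W f" "smooth_map_on A W g"
  shows "smooth_map_on A W (\<lambda>x. f x + g x)"
  unfolding smooth_map_on_def o_def
  by (intro ballI smooth_on_add chart_image_Int_open assms(1))
    (use assms(2,3) in \<open>simp_all add: smooth_map_on_def o_def\<close>)

lemma smooth_map_on_scaleR:
  assumes "open W" "smooth_map_on A W f" "smooth_map_on A W g"
  shows "smooth_map_on A W (\<lambda>x. f x *\<^sub>R g x)"
  by (rule smooth_map_on_bilinear[OF bounded_bilinear_scaleR assms])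

lemma smooth_map_on_mult:
  fixes f g :: "'m \<Rightarrow> real"
  assumes "open W" "smooth_map_on A W f" "smooth_map_on A W g"
  shows "smooth_map_on A W (\<lambda>x. f x * g x)"
  by (rule smooth_map_on_bilinear[OF bounded_bilinear_mult assms])

lemma smooth_map_on_sum:
  assumes "open W" "\<And>i. i \<in> I \<Longrightarrow> smooth_map_on A W (f i)"
  shows "smooth_map_on A W (\<lambda>x. \<Sum>i\<in>I. f i x)"
  unfolding smooth_map_on_def o_def
  by (intro ballI smooth_on_sum chart_image_Int_open assms(1))
    (use assms(2) in \<open>simp_all add: smooth_map_on_def o_def\<close>)

lemma smooth_map_on_powr:
  fixes f :: "'m \<Rightarrow> real"
  assumes "open W" "smooth_map_on A W f" "\<And>x. x \<in> W \<Longrightarrow> f x > 0"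
  shows "smooth_map_on A W (\<lambda>x. f x powr a)"
  by (rule smooth_map_on_compose[OF assms(1) _ _ assms(2), of "{0<..}"])
    (use assms smooth_on_powr[of "{0<..}" "\<lambda>x. x" a] in \<open>auto simp: smooth_on_id\<close>)

lemma smooth_map_on_linear:
  assumes "bounded_linear l" "open W" "smooth_map_on A W f"
  shows "smooth_map_on A W (\<lambda>x. l (f x))"
  by (rule smooth_map_on_compose[OF assms(2) open_UNIV _ assms(3)])
    (use assms smooth_on_bounded_linear in auto)

lemma smooth_map_on_vec:
  fixes f :: "'m \<Rightarrow> real ^ 'k"
  assumes "open W" "\<And>i. smooth_map_on A W (\<lambda>x. f x $ i)"
  shows "smooth_map_on A W f"
  unfolding smooth_map_on_def o_def
  by (intro ballI smooth_on_vec chart_image_Int_open assms(1))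
    (use assms(2) in \<open>simp_all add: smooth_map_on_def o_def\<close>)

lemma smooth_map_on_vec_nth:
  fixes f :: "'m \<Rightarrow> 'b::euclidean_space ^ 'k"
  assumes "open W" "smooth_map_on A W f"
  shows "smooth_map_on A W (\<lambda>x. f x $ i)"
  by (rule smooth_map_on_linear[OF bounded_linear_vec_nth assms])

lemma smooth_map_on_imp_continuous_on:
  assumes "open W" "smooth_map_on A W f"
  shows "continuous_on W f"
proof (rule continuous_at_imp_continuous_on, rule ballI)
  fix x assume x: "x \<in> W"
  obtain c where c: "c \<in> A" "x \<in> fst c" by (rule chart_exists)
  have U: "open (fst c \<inter> W)" using chart_open[OF c(1)] assms(1) by auto
  have "continuous_on (fst c \<inter> W) (\<lambda>x. (f \<circ> chart_inv c) (snd c x))"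
    by (rule continuous_on_compose2[OF smooth_on_imp_continuous_on[OF smooth_map_onD[OF assms(2) c(1)]]
          continuous_on_subset[OF chart_continuous[OF c(1)]]]) auto
  then have "continuous_on (fst c \<inter> W) f"
    by (rule continuous_on_cong[THEN iffD1, rotated -1]) (auto simp: chart_inv_left c)
  then show "isCont f x"
    using continuous_on_eq_continuous_at[OF U] c x by auto
qed

lemma smooth_map_on_chart_compose:
  assumes "c \<in> A" "open W" "W \<subseteq> fst c" "smooth_on (snd c ` W) u"
  shows "smooth_map_on A W (\<lambda>x. u (snd c x))"
proof (rule smooth_map_on_chartI[OF assms(2)])
  fix x assume x: "x \<in> W"
  have "smooth_on (snd c ` W) ((\<lambda>x. u (snd c x)) \<circ> chart_inv c)"
    by (rule smooth_on_cong[THEN iffD1, OF chart_image_open[OF assms(1-3)] _ assms(4)])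
      (use assms in \<open>auto simp: chart_inv_left subset_iff\<close>)
  then show "\<exists>d\<in>A. \<exists>U. open U \<and> x \<in> U \<and> U \<subseteq> fst d \<and> smooth_on (snd d ` U) ((\<lambda>x. u (snd c x)) \<circ> chart_inv d)"
    using assms x by blast
qed

lemma smooth_map_on_zero_extension:
  assumes "open W" "closed C" "C \<subseteq> W" "smooth_map_on A W f" "\<And>x. x \<notin> C \<Longrightarrow> f x = 0"
  shows "smooth_map_on A UNIV f"
proof (rule smooth_map_on_local[OF open_UNIV])
  fix x
  show "\<exists>U. open U \<and> x \<in> U \<and> smooth_map_on A (U \<inter> UNIV) f"
  proof (cases "x \<in> W")
    case True
    then show ?thesis using assms by auto
  next
    case False
    have "smooth_map_on A (- C) f"
      using smooth_map_on_cong[of "- C" f "\<lambda>x. 0"] assms by (auto simp: open_Compl)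
    then show ?thesis using False assms by (intro exI[of _ "- C"]) (auto simp: open_Compl)
  qed
qed

lemma chart_ball_exists:
  assumes "c \<in> A" "x \<in> fst c" "open W" "x \<in> W"
  obtains r where "r > 0" "cball (snd c x) r \<subseteq> snd c ` (fst c \<inter> W)"
proof -
  have "open (snd c ` (fst c \<inter> W))" "snd c x \<in> snd c ` (fst c \<inter> W)"
    using assms chart_image_Int_open by auto
  then show thesis using that open_contains_cball by blast
qed

text \<open>The open set \<open>\<Omega>\<close> serves as the domain of integration in the energy of a variation that is
  supported in \<open>K\<close>.\<close>

lemma bump_exists:
  assumes c: "c \<in> A" and W: "open W" "x \<in> W" "W \<subseteq> fst c"
  obtains \<phi> :: "'m \<Rightarrow> real" and U K \<Omega>
  where "smooth_map_on A UNIV \<phi>" "\<And>y. 0 \<le> \<phi> y" "open U" "x \<in> U" "\<And>y. y \<in> U \<Longrightarrow> \<phi> y = 1"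
    "compact K" "U \<subseteq> K" "K \<subseteq> \<Omega>" "\<And>y. y \<notin> K \<Longrightarrow> \<phi> y = 0"
    "open \<Omega>" "connected \<Omega>" "compact (closure \<Omega>)" "closure \<Omega> \<subseteq> W"
proof -
  obtain r where r: "r > 0" "cball (snd c x) r \<subseteq> snd c ` (fst c \<inter> W)"
    using chart_ball_exists[of c x W] assms by blast
  \<comment> \<open>Concentric coordinate balls of radii s, 2 s and 3 s = r become \<open>U\<close>,
    \<open>K\<close> and \<open>\<Omega>\<close>; \<open>K\<close> and the closure of
    \<open>\<Omega>\<close> then stay inside the compact set \<open>C\<close>, which lies in
    \<open>W\<close>.\<close>
  define s where "s = r / 3"
  have s: "s > 0" "r = 3 * s" using r by (auto simp: s_def)
  let ?a = "snd c x"
  obtain b where b: "smooth_on UNIV b" "\<And>y. 0 \<le> b y" "\<And>y. y \<in> ball ?a s \<Longrightarrow> b y = 1"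
    "\<And>y. y \<notin> ball ?a (2 * s) \<Longrightarrow> b y = (0::real)"
    using smooth_bump_exists[OF s(1), of ?a] by metis
  have sub: "B \<subseteq> snd c ` fst c" "chart_inv c ` B \<subseteq> W" if "B \<subseteq> cball ?a r" for B
    using that r(2) c by (auto simp: chart_inv_left dest!: subsetD)
  define U where "U = chart_inv c ` ball ?a s"
  define K where "K = chart_inv c ` cball ?a (2 * s)"
  define \<Omega> where "\<Omega> = chart_inv c ` ball ?a r"
  define C where "C = chart_inv c ` cball ?a r"
  have balls: "ball ?a s \<subseteq> cball ?a r" "cball ?a (2 * s) \<subseteq> cball ?a r" "ball ?a r \<subseteq> cball ?a r"
    "cball ?a r \<subseteq> cball ?a r"
    using s by auto
  note cont = continuous_on_subset[OF chart_inv_continuous[OF c]]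
  have K: "compact K" unfolding K_def
    by (intro compact_continuous_image cont sub balls compact_cball)
  have C: "compact C" "C \<subseteq> W" unfolding C_def
    by (intro compact_continuous_image cont sub balls compact_cball) (rule sub(2)[OF balls(4)])
  have KW: "K \<subseteq> W" unfolding K_def by (rule sub(2)[OF balls(2)])
  define \<phi> where "\<phi> y = (if y \<in> W then b (snd c y) else 0)" for y
  have \<phi>W: "smooth_map_on A W \<phi>"
  proof -
    have "smooth_map_on A W (\<lambda>y. b (snd c y))"
      by (rule smooth_map_on_chart_compose[OF c W(1,3)]) (rule smooth_on_subset[OF b(1)], auto)
    then show ?thesis
      by (rule smooth_map_on_cong[THEN iffD1, OF W(1), rotated]) (auto simp: \<phi>_def)
  qed
  have \<phi>0: "\<phi> y = 0" if "y \<notin> K" for y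
  proof (cases "y \<in> W")
    case True
    then have "y = chart_inv c (snd c y)" using c W by (auto simp: chart_inv_left)
    then have "snd c y \<notin> ball ?a (2 * s)" using that by (auto simp: K_def image_iff)
    then show ?thesis by (simp add: \<phi>_def b)
  qed (simp add: \<phi>_def)
  have cl: "closure \<Omega> \<subseteq> C"
    unfolding \<Omega>_def by (rule closure_minimal) (use C compact_imp_closed in \<open>auto simp: C_def\<close>)
  show thesis
  proof
    show "smooth_map_on A UNIV \<phi>"
      by (rule smooth_map_on_zero_extension[OF W(1) compact_imp_closed[OF K] KW \<phi>W \<phi>0])
    show "0 \<le> \<phi> y" for y by (simp add: \<phi>_def b)
    show "open U" "open \<Omega>"
      unfolding U_def \<Omega>_def by (intro chart_inv_image_open c sub balls open_ball)+
    show "x \<in> U"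
      unfolding U_def using s c W by (intro image_eqI[of _ _ ?a]) (auto simp: chart_inv_left)
    show "\<phi> y = 1" if "y \<in> U" for y
    proof -
      obtain z where z: "z \<in> ball ?a s" "y = chart_inv c z" using \<open>y \<in> U\<close> unfolding U_def by blast
      then have "snd c y = z" using sub(1)[OF balls(1)] chart_inv_right[OF c, of z] by auto
      moreover have "y \<in> W" using z sub(2)[OF balls(1)] by auto
      ultimately show ?thesis using z b(3) by (simp add: \<phi>_def)
    qed
    show "U \<subseteq> K" "K \<subseteq> \<Omega>" unfolding U_def K_def \<Omega>_def using s by (auto intro!: image_mono)
    show "connected \<Omega>"
      unfolding \<Omega>_def by (intro connected_continuous_image cont sub balls convex_connected convex_ball)
    show "compact (closure \<Omega>)" "closure \<Omega> \<subseteq> W"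
      using cl C compact_Int_closed[OF C(1) closed_closure, of \<Omega>] by (auto simp: Int_absorb1)
  qed (use K \<phi>0 in auto)
qed

section \<open>Differentials in charts\<close>

abbreviation (input) chart_derivative :: "('m, 'n) chart \<Rightarrow> ('m \<Rightarrow> 'b::euclidean_space) \<Rightarrow> 'm \<Rightarrow> real ^ 'n \<Rightarrow> 'b" where
  "chart_derivative c f x \<equiv> frechet_derivative (f \<circ> chart_inv c) (at (snd c x))"

lemma smooth_map_on_chart_has_derivative:
  assumes "smooth_map_on A W f" "c \<in> A" "x \<in> fst c" "x \<in> W"
  shows "((f \<circ> chart_inv c) has_derivative chart_derivative c f x) (at (snd c x))"
  by (rule smooth_on_has_derivative[OF smooth_map_onD[OF assms(1,2)]]) (use assms in auto)

lemma smooth_map_on_chart: "c \<in> A \<Longrightarrow> smooth_map_on A (fst c) (snd c)"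
  using charts_compatible by (auto simp: smooth_map_on_def)

text \<open>The chain rule for a change of chart. The conversions between the selected chart of
  \<open>chart_at\<close> and another chart, for differentials as well as for components, are
  instances of it.\<close>

lemma chart_derivative_chain:
  assumes "c \<in> A" "d \<in> A" "x \<in> fst c" "x \<in> fst d"
    and f: "((f \<circ> chart_inv d) has_derivative f') (at (snd d x))"
  shows "((f \<circ> chart_inv c) has_derivative (\<lambda>\<xi>. f' (chart_derivative c (snd d) x \<xi>))) (at (snd c x))"
proof -
  have "((\<lambda>y. (f \<circ> chart_inv d) ((snd d \<circ> chart_inv c) y)) has_derivative
      (\<lambda>\<xi>. f' (chart_derivative c (snd d) x \<xi>))) (at (snd c x))"
    by (rule has_derivative_compose[OF smooth_map_on_chart_has_derivative[OF smooth_map_on_chart[OF assms(2)] assms(1,3,4)]])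
      (use f assms in \<open>simp add: chart_inv_left del: o_apply\<close>, simp add: chart_inv_left assms)
  then show ?thesis
    by (rule has_derivative_transform_within_open[OF _ chart_image_Int_open[OF assms(1) chart_open[OF assms(2)]]])
      (use assms in \<open>auto simp: chart_inv_left\<close>)
qed

lemma differential_eq: 
  assumes "((f \<circ> chart_inv (chart_at A x)) has_derivative f') (at (snd (chart_at A x) x))"
  shows "differential A f x = f'"
  using frechet_derivative_at[OF assms] by (auto simp: differential_def fun_eq_iff)

lemma differential_has_derivative:
  assumes "smooth_map_on A W f" "x \<in> W"
  shows "((f \<circ> chart_inv (chart_at A x)) has_derivative differential A f x) (at (snd (chart_at A x) x))"
  using smooth_map_on_chart_has_derivative[OF assms(1) chart_at(1,2) assms(2)]
  by (simp add: differential_def[abs_def])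

lemma linear_differential:
  assumes "smooth_map_on A W f" "x \<in> W"
  shows "linear (differential A f x)"
  using differential_has_derivative[OF assms] has_derivative_linear by blast

lemma differential_const: "differential A (\<lambda>x. a) x v = 0"
  by (subst differential_eq[of _ _ "\<lambda>_. 0"]) (auto simp: o_def)

lemma differential_mult:
  assumes "smooth_map_on A W f" "smooth_map_on A W g" "x \<in> W"
  shows "differential A (\<lambda>y. f y * g y) x v = f x * differential A g x v + differential A f x v * g x"
  by (subst differential_eq[OF _])
    (use has_derivative_mult[OF differential_has_derivative[OF assms(1,3)] differential_has_derivative[OF assms(2,3)]]
      in \<open>auto simp: o_def chart_inv_left chart_at\<close>)

lemma differential_compose:
  assumes "smooth_map_on A W f" "x \<in> W" "(u has_real_derivative u') (at (f x))"
  shows "differential A (\<lambda>y. u (f y)) x v = u' * differential A f x v"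
proof -
  have "((\<lambda>z. u ((f \<circ> chart_inv (chart_at A x)) z)) has_derivative (\<lambda>v. u' * differential A f x v))
      (at (snd (chart_at A x) x))"
    by (rule has_derivative_compose[OF differential_has_derivative[OF assms(1,2)]])
      (use assms(3) in \<open>simp add: chart_inv_left chart_at has_field_derivative_def\<close>)
  then show ?thesis by (subst differential_eq) (auto simp: o_def)
qed

lemma differential_cong:
  assumes "open W" "x \<in> W" "\<And>y. y \<in> W \<Longrightarrow> f y = g y"
  shows "differential A f x v = differential A g x v"
  unfolding differential_def
  by (rule fun_cong[OF frechet_derivative_cong_open[OF chart_image_Int_open[OF chart_at(1)[of x] assms(1)]]])
    (use assms chart_at in \<open>auto simp: chart_inv_left\<close>)

lemma differential_coord_vector:
  assumes "c \<in> A" "x \<in> fst c" "smooth_map_on A W f" "x \<in> W"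
  shows "differential A f x (coord_vector A c x \<xi>) = chart_derivative c f x \<xi>"
  unfolding coord_vector_def
  by (rule fun_cong[OF frechet_derivative_at[OF chart_derivative_chain[OF assms(1) chart_at(1) assms(2) chart_at(2)
      differential_has_derivative[OF assms(3,4)]]]])

lemma chart_derivative_same:
  assumes "c \<in> A" "x \<in> fst c"
  shows "chart_derivative c (snd c) x \<xi> = \<xi>"
proof -
  have "((\<lambda>y. y) has_derivative (\<lambda>\<xi>. \<xi>)) (at (snd c x))" by (rule has_derivative_ident)
  then have "((snd c \<circ> chart_inv c) has_derivative (\<lambda>\<xi>. \<xi>)) (at (snd c x))"
    by (rule has_derivative_transform_within_open[OF _ chart_image_open[OF assms(1) chart_open[OF assms(1)] order_refl]])
      (use assms in \<open>auto simp: chart_inv_left\<close>)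
  then show ?thesis by (rule fun_cong[OF frechet_derivative_at, symmetric])
qed

lemma components_coord_vector:
  assumes "c \<in> A" "d \<in> A" "x \<in> fst c" "x \<in> fst d"
  shows "components A d x (coord_vector A c x \<xi>) = chart_derivative c (snd d) x \<xi>"
  unfolding coord_vector_def components_def
  by (rule fun_cong[OF frechet_derivative_at[OF chart_derivative_chain[OF assms(1) chart_at(1) assms(3) chart_at(2)
      smooth_map_on_chart_has_derivative[OF smooth_map_on_chart[OF assms(2)] chart_at assms(4)]]]])

lemma coord_vector_components:
  assumes "c \<in> A" "x \<in> fst c"
  shows "coord_vector A c x (components A c x v) = v"
  unfolding coord_vector_def components_def
  using fun_cong[OF frechet_derivative_at[OF chart_derivative_chain[OF chart_at(1) assms(1) chart_at(2) assms(2)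
      smooth_map_on_chart_has_derivative[OF smooth_map_on_chart[OF chart_at(1)] assms chart_at(2)]]], of v]
    chart_derivative_same[OF chart_at, of x v] by simp

lemma linear_coord_vector:
  assumes "c \<in> A" "x \<in> fst c"
  shows "linear (coord_vector A c x)"
  unfolding coord_vector_def[abs_def]
  using has_derivative_linear[OF smooth_map_on_chart_has_derivative[OF smooth_map_on_chart[OF chart_at(1)] assms chart_at(2)]] .

lemma surj_coord_vector: "c \<in> A \<Longrightarrow> x \<in> fst c \<Longrightarrow> surj (coord_vector A c x)"
  by (metis coord_vector_components surjI)

lemma smooth_map_on_chart_derivative:
  assumes "c \<in> A" "open W" "smooth_map_on A W f"
  shows "smooth_map_on A (fst c \<inter> W) (\<lambda>x. chart_derivative c f x \<xi>)"
  by (rule smooth_map_on_chart_compose[OF assms(1) open_Int[OF chart_open[OF assms(1)] assms(2)] Int_lower1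
        smooth_on_frechet_derivative[OF smooth_map_onD[OF assms(3,1)]]])

text \<open>\<open>conn_smooth\<close> admits vector fields on the whole manifold only, so the
  coordinate fields of \<open>c\<close> are cut off. Outside \<open>fst c\<close> the value of
  \<open>coord_vector\<close> does not matter because \<phi> vanishes there.\<close>

lemma smooth_vector_field_cutoff:
  assumes c: "c \<in> A" and \<phi>: "smooth_map_on A UNIV \<phi>" and K: "compact K" "K \<subseteq> fst c" "\<And>y. y \<notin> K \<Longrightarrow> \<phi> y = 0"
  shows "smooth_vector_field A (\<lambda>x. \<phi> x *\<^sub>R coord_vector A c x \<xi>)"
  unfolding smooth_vector_field_def
proof
  fix d assume d: "d \<in> A"
  have lin: "linear (components A d x)" if "x \<in> fst d" for x
    unfolding components_def[abs_def]
    using has_derivative_linear[OF smooth_map_on_chart_has_derivative[OF smooth_map_on_chart[OF d] chart_at that]] .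
  have 0: "components A d x (\<phi> x *\<^sub>R coord_vector A c x \<xi>) = (if x \<in> fst c then \<phi> x *\<^sub>R chart_derivative c (snd d) x \<xi> else 0)"
    if "x \<in> fst d" for x
    using that K c d lin[OF that] by (auto simp: linear_scale components_coord_vector linear_0)
  show "smooth_map_on A (fst d) (\<lambda>x. components A d x (\<phi> x *\<^sub>R coord_vector A c x \<xi>))"
  proof (rule smooth_map_on_local[OF chart_open[OF d]])
    fix x assume x: "x \<in> fst d"
    show "\<exists>U. open U \<and> x \<in> U \<and> smooth_map_on A (U \<inter> fst d) (\<lambda>x. components A d x (\<phi> x *\<^sub>R coord_vector A c x \<xi>))"
    proof (cases "x \<in> fst c")
      case True
      have op: "open (fst c \<inter> fst d)" using chart_open[OF c] chart_open[OF d] by (rule open_Int)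
      have "smooth_map_on A (fst c \<inter> fst d) (\<lambda>x. \<phi> x *\<^sub>R chart_derivative c (snd d) x \<xi>)"
        by (rule smooth_map_on_scaleR[OF op smooth_map_on_subset[OF \<phi>]
              smooth_map_on_chart_derivative[OF c chart_open[OF d] smooth_map_on_chart[OF d]]]) auto
      then have "smooth_map_on A (fst c \<inter> fst d) (\<lambda>x. components A d x (\<phi> x *\<^sub>R coord_vector A c x \<xi>))"
        by (rule smooth_map_on_cong[THEN iffD1, OF op, rotated]) (simp add: 0)
      then show ?thesis using True c chart_open by blast
    next
      case False
      have op: "open (- K)" using K compact_imp_closed by blast
      have "smooth_map_on A (- K \<inter> fst d) (\<lambda>x. components A d x (\<phi> x *\<^sub>R coord_vector A c x \<xi>))"
        by (rule smooth_map_on_cong[THEN iffD1, of _ "\<lambda>x. 0"]) (use op chart_open[OF d] K in \<open>auto simp: linear_0 lin\<close>)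
      then show ?thesis using False K op by (intro exI[of _ "- K"]) auto
    qed
  qed
qed

end

section \<open>Change of variables for an arbitrary finite index type\<close>

text \<open>The change of variables formula of the library requires the index type of the Euclidean
  space to be well-ordered, so an arbitrary finite index type is replaced by an ordered copy.\<close>

typedef ('a::finite) ordered_copy = "UNIV :: 'a set"
  morphisms of_copy to_copy ..

lemma bij_of_copy: "bij of_copy"
  by (metis bijI' of_copy_inject to_copy_inverse UNIV_I)

instance ordered_copy :: (finite) finite
proof
  show "finite (UNIV :: 'a ordered_copy set)"
    using bij_of_copy by (metis bij_betw_finite finite)
qed

instantiation ordered_copy :: (finite) wellorder
begin

definition "less_eq_ordered_copy (x :: 'a ordered_copy) (y :: 'a ordered_copy) \<longleftrightarrow> to_nat (of_copy x) \<le> to_nat (of_copy y)"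
definition "less_ordered_copy (x :: 'a ordered_copy) (y :: 'a ordered_copy) \<longleftrightarrow> to_nat (of_copy x) < to_nat (of_copy y)"

instance
proof
  fix P :: "'a ordered_copy \<Rightarrow> bool" and a
  assume step: "\<And>x. (\<And>y. y < x \<Longrightarrow> P y) \<Longrightarrow> P x"
  have "to_nat (of_copy b) = n \<Longrightarrow> P b" for n b
  proof (induction n arbitrary: b rule: less_induct)
    case (less n)
    show ?case by (rule step) (use less in \<open>auto simp: less_ordered_copy_def\<close>)
  qed
  then show "P a" by blast
qed (auto simp: less_eq_ordered_copy_def less_ordered_copy_def of_copy_inject)

end

text \<open>Conjugation by a bijection turns transpositions into transpositions, so a factorisation
  of \<open>p\<close> is carried over to the other index type with the same number of
  factors.\<close>

lemma sign_conjugate: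
  fixes p :: "'a::finite \<Rightarrow> 'a" and R :: "'b::finite \<Rightarrow> 'a"
  assumes R: "bij R" and p: "p permutes UNIV"
  shows "sign (inv R \<circ> p \<circ> R) = sign p"
proof -
  have "swapidseq n q \<Longrightarrow> swapidseq n (inv R \<circ> q \<circ> R)" for n and q :: "'a \<Rightarrow> 'a"
  proof (induction n q rule: swapidseq.induct)
    case id
    have "inv R \<circ> id \<circ> R = id"
      using inv_f_f[OF bij_is_inj[OF R]] by (simp add: fun_eq_iff)
    then show ?case by (simp only: swapidseq.id)
  next
    case (comp_Suc n q a b)
    have eq: "inv R \<circ> (Transposition.transpose a b \<circ> q) \<circ> R =
        Transposition.transpose (inv R a) (inv R b) \<circ> (inv R \<circ> q \<circ> R)"
      using R by (auto simp: fun_eq_iff Transposition.transpose_def bij_is_surj inj_eq[OF bij_is_inj[OF bij_imp_bij_inv[OF R]]])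
    have "inv R a \<noteq> inv R b"
      using comp_Suc.hyps R by (simp add: inj_eq[OF bij_is_inj[OF bij_imp_bij_inv[OF R]]])
    then show ?case unfolding eq using comp_Suc.IH by (rule swapidseq.comp_Suc[rotated])
  qed
  moreover obtain n where "swapidseq n p"
    using p permutation_permutes[of p] by (auto simp: permutation_def)
  ultimately have "evenperm (inv R \<circ> p \<circ> R) = evenperm p"
    by (metis evenperm_unique)
  then show ?thesis by (simp add: sign_def)
qed

text \<open>The permutations in the two Leibniz sums are matched by p \<mapsto> R^-1 p R, which
  preserves signs.\<close>

lemma det_reindex:
  fixes M :: "'c::comm_ring_1 ^ 'a ^ 'a" and R :: "'b::finite \<Rightarrow> 'a::finite"
  assumes R: "bij R"
  shows "det (\<chi> i j. M $ R i $ R j) = det M"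
proof -
  have S: "inj R" "surj R" "\<And>x. inv R (R x) = x" "\<And>y. R (inv R y) = y"
    using R by (auto simp: bij_def surj_f_inv_f)
  have perm: "(inv R \<circ> p \<circ> R) permutes UNIV" if "p permutes UNIV" for p
    using that R by (intro bij_imp_permutes bij_comp bij_imp_bij_inv) (auto simp: permutes_bij)
  have perm': "(R \<circ> p \<circ> inv R) permutes UNIV" if "p permutes UNIV" for p
    using that R by (intro bij_imp_permutes bij_comp bij_imp_bij_inv) (auto simp: permutes_bij)
  show ?thesis
    unfolding det_def
  proof (rule sum.reindex_bij_witness[of _ "\<lambda>p. inv R \<circ> p \<circ> R" "\<lambda>p. R \<circ> p \<circ> inv R"])
    fix p :: "'b \<Rightarrow> 'b" assume p: "p \<in> {p. p permutes UNIV}"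
    show "inv R \<circ> (R \<circ> p \<circ> inv R) \<circ> R = p" by (auto simp: S)
    show "R \<circ> p \<circ> inv R \<in> {p. p permutes UNIV}" using perm' p by simp
    have "sign (inv R \<circ> (R \<circ> p \<circ> inv R) \<circ> R) = sign (R \<circ> p \<circ> inv R)"
      using sign_conjugate[OF R perm'] p by simp
    moreover have "inv R \<circ> (R \<circ> p \<circ> inv R) \<circ> R = p" by (auto simp: S)
    ultimately have s: "sign (R \<circ> p \<circ> inv R) = sign p" by simp
    have "(\<Prod>i\<in>UNIV. M $ i $ (R \<circ> p \<circ> inv R) i) = (\<Prod>i\<in>UNIV. M $ R i $ R (p i))"
      using prod.reindex_bij_betw[OF R, of "\<lambda>i. M $ i $ (R \<circ> p \<circ> inv R) i"] by (simp add: S)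
    then show "of_int (sign (R \<circ> p \<circ> inv R)) * (\<Prod>i\<in>UNIV. M $ i $ (R \<circ> p \<circ> inv R) i) =
        of_int (sign p) * (\<Prod>i\<in>UNIV. (\<chi> i j. M $ R i $ R j) $ i $ p i)"
      by (simp add: s)
  next
    fix p :: "'a \<Rightarrow> 'a" assume p: "p \<in> {p. p permutes UNIV}"
    show "R \<circ> (inv R \<circ> p \<circ> R) \<circ> inv R = p" by (auto simp: S)
    show "inv R \<circ> p \<circ> R \<in> {p. p permutes UNIV}" using perm p by simp
  qed
qed

lemma prod_Basis_cart: "(\<Prod>b\<in>(Basis :: (real ^ 'n) set). f b) = (\<Prod>i\<in>UNIV. f (axis i 1))"
proof -
  have "Basis = range (\<lambda>i::'n. axis i (1::real))"
    by (auto simp: Basis_vec_def)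
  moreover have "inj (\<lambda>i::'n. axis i (1::real))"
    by (auto simp: inj_def axis_eq_axis)
  ultimately show ?thesis
    using prod.reindex[of "\<lambda>i::'n. axis i (1::real)" UNIV f] by (simp only: o_def)
qed

text \<open>Lebesgue measure is determined by its values on boxes, and the preimage of a box is the
  box with permuted sides.\<close>

lemma lborel_reindex:
  fixes R :: "'b::finite \<Rightarrow> 'a::finite"
  assumes R: "bij R"
  shows "distr lborel borel (\<lambda>x::real ^ 'a. \<chi> i. x $ R i) = (lborel :: (real ^ 'b) measure)"
proof (rule lborel_eqI[symmetric])
  define \<rho> where "\<rho> = (\<lambda>x::real ^ 'a. \<chi> i. x $ R i)"
  have S: "\<And>x. inv R (R x) = x" "\<And>y. R (inv R y) = y"
    using R by (auto simp: bij_def surj_f_inv_f)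
  have meas: "\<rho> \<in> borel_measurable borel"
    unfolding \<rho>_def by (intro borel_measurable_continuous_onI) (auto intro!: continuous_intros)
  fix l u :: "real ^ 'b"
  assume lu: "\<And>b. b \<in> Basis \<Longrightarrow> l \<bullet> b \<le> u \<bullet> b"
  then have lu: "l $ i \<le> u $ i" for i
  proof -
    have "l \<bullet> axis i 1 \<le> u \<bullet> axis i 1" by (rule lu) (simp add: axis_in_Basis_iff)
    then show ?thesis by (simp add: inner_axis)
  qed
  have "\<rho> -` box l u = box (\<chi> i. l $ inv R i) (\<chi> i. u $ inv R i)"
  proof -
    have "(\<forall>i. l $ i < x $ R i \<and> x $ R i < u $ i) \<longleftrightarrow> (\<forall>i. l $ inv R i < x $ i \<and> x $ i < u $ inv R i)" for x :: "real ^ 'a"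
      using S by metis
    then show ?thesis by (auto simp: \<rho>_def mem_box_cart)
  qed
  then have "emeasure (distr lborel borel \<rho>) (box l u) = emeasure lborel (box (\<chi> i. l $ inv R i) (\<chi> i. u $ inv R i) :: (real ^ 'a) set)"
    using meas by (simp add: emeasure_distr)
  also have "\<dots> = ennreal (\<Prod>i\<in>UNIV. (u $ inv R i - l $ inv R i))"
  proof -
    have "\<forall>b\<in>Basis. (\<chi> i. l $ inv R i) \<bullet> b \<le> (\<chi> i. u $ inv R i :: real ^ 'a) \<bullet> b"
      using lu by (auto simp: Basis_vec_def inner_axis)
    then show ?thesis by (simp add: emeasure_lborel_box_eq prod_Basis_cart inner_axis)
  qed
  also have "(\<Prod>i\<in>UNIV. (u $ inv R i - l $ inv R i)) = (\<Prod>i\<in>UNIV. u $ i - l $ i)"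
    using prod.reindex_bij_betw[OF bij_imp_bij_inv[OF R], of "\<lambda>i. u $ i - l $ i"] by simp
  also have "\<dots> = (\<Prod>b\<in>Basis. (u - l) \<bullet> b)"
    by (simp add: prod_Basis_cart inner_axis)
  finally show "emeasure (distr lborel borel (\<lambda>x::real ^ 'a. \<chi> i. x $ R i)) (box l u) = (\<Prod>b\<in>Basis. (u - l) \<bullet> b)"
    by (simp add: \<rho>_def)
qed simp

text \<open>An equality of extended reals, so images of infinite measure are included: if the
  integral were finite, the Jacobian would be integrable on \<open>B\<close>, which forces the image
  to have finite measure.\<close>

lemma emeasure_differentiable_image_wellorder:
  fixes f :: "real ^ 'n::{finite, wellorder} \<Rightarrow> real ^ 'n::_"
  assumes B: "B \<in> sets borel" "f ` B \<in> sets borel"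
    and f': "\<And>x. x \<in> B \<Longrightarrow> (f has_derivative f' x) (at x within B)" and inj: "inj_on f B"
    and meas: "(\<lambda>x. indicator B x * \<bar>det (matrix (f' x))\<bar>) \<in> borel_measurable borel"
  shows "emeasure lborel (f ` B) = (\<integral>\<^sup>+x. ennreal \<bar>det (matrix (f' x))\<bar> * indicator B x \<partial>lborel)"
proof (cases "f ` B \<in> lmeasurable")
  case True
  have "((\<lambda>x. \<bar>det (matrix (f' x))\<bar>) has_integral measure lebesgue (f ` B)) B"
    using has_measure_differentiable_image[OF _ f' inj] B True by auto
  then have "(\<integral>\<^sup>+x. ennreal \<bar>det (matrix (f' x))\<bar> * indicator B x \<partial>lborel) = ennreal (measure lebesgue (f ` B))"
    by (intro nn_integral_has_integral_lebesgue') auto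
  also have "\<dots> = emeasure lebesgue (f ` B)"
    using True by (simp add: emeasure_eq_measure2)
  also have "\<dots> = emeasure lborel (f ` B)"
    using B by simp
  finally show ?thesis by simp
next
  case False
  then have "emeasure lborel (f ` B) = \<infinity>"
    using B by (auto simp: fmeasurable_def not_less top_unique)
  moreover have "(\<integral>\<^sup>+x. ennreal \<bar>det (matrix (f' x))\<bar> * indicator B x \<partial>lborel) = \<infinity>"
  proof (rule ccontr)
    assume fin: "(\<integral>\<^sup>+x. ennreal \<bar>det (matrix (f' x))\<bar> * indicator B x \<partial>lborel) \<noteq> \<infinity>"
    have "(\<integral>\<^sup>+x. ennreal (indicator B x * \<bar>det (matrix (f' x))\<bar>) \<partial>lborel) =
        (\<integral>\<^sup>+x. ennreal \<bar>det (matrix (f' x))\<bar> * indicator B x \<partial>lborel)"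
      by (intro nn_integral_cong) (auto simp: indicator_def)
    then have "integrable lborel (\<lambda>x. indicator B x * \<bar>det (matrix (f' x))\<bar>)"
      using fin meas by (intro integrableI_nonneg) (auto simp: less_top)
    then have "(\<lambda>x. indicator B x * \<bar>det (matrix (f' x))\<bar>) integrable_on UNIV"
      by (rule integrable_on_lborel)
    moreover have "(\<lambda>x. indicator B x * \<bar>det (matrix (f' x))\<bar>) = (\<lambda>x. if x \<in> B then \<bar>det (matrix (f' x))\<bar> else 0)"
      by (auto simp: indicator_def fun_eq_iff)
    ultimately have "(\<lambda>x. \<bar>det (matrix (f' x))\<bar>) integrable_on B"
      by (simp only: integrable_restrict_UNIV)
    then have "f ` B \<in> lmeasurable"
      using measurable_differentiable_image_eq[OF _ f' inj] B by auto
    then show False using False by blast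
  qed
  ultimately show ?thesis by simp
qed

text \<open>Conjugating \<open>f\<close> by the coordinate permutation \<open>\<rho>\<close> moves
  the formula to the ordered index type: \<open>\<rho>\<close> preserves Lebesgue measure, and the
  Jacobian determinant is unchanged by \<open>det_reindex\<close>.\<close>

lemma emeasure_differentiable_image:
  fixes f :: "real ^ 'n \<Rightarrow> real ^ 'n"
  assumes B: "B \<in> sets borel" "f ` B \<in> sets borel"
    and f': "\<And>x. x \<in> B \<Longrightarrow> (f has_derivative f' x) (at x within B)" and inj: "inj_on f B"
    and meas: "(\<lambda>x. indicator B x * \<bar>det (matrix (f' x))\<bar>) \<in> borel_measurable borel"
  shows "emeasure lborel (f ` B) = (\<integral>\<^sup>+x. ennreal \<bar>det (matrix (f' x))\<bar> * indicator B x \<partial>lborel)"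
proof -
  define R :: "'n ordered_copy \<Rightarrow> 'n" where "R = of_copy"
  have R: "bij R" by (simp add: R_def bij_of_copy)
  define \<rho> where "\<rho> = (\<lambda>x::real ^ 'n. \<chi> i. x $ R i)"
  define \<rho>' where "\<rho>' = (\<lambda>x. \<chi> i. x $ inv R i :: real ^ 'n)"
  have S: "\<And>x. inv R (R x) = x" "\<And>y. R (inv R y) = y"
    using R by (auto simp: bij_def surj_f_inv_f)
  have \<rho>\<rho>': "\<rho> (\<rho>' x) = x" "\<rho>' (\<rho> y) = y" for x y
    by (simp_all add: \<rho>_def \<rho>'_def S)
  have cont: "continuous_on UNIV \<rho>" "continuous_on UNIV \<rho>'"
    unfolding \<rho>_def \<rho>'_def by (auto intro!: continuous_intros)
  then have [measurable]: "\<rho> \<in> borel_measurable borel" "\<rho>' \<in> borel_measurable borel"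
    by (auto intro: borel_measurable_continuous_onI)
  have lin: "linear \<rho>" "linear \<rho>'"
    by (auto intro!: linearI simp: \<rho>_def \<rho>'_def vec_eq_iff)
  have img: "\<rho> ` X = \<rho>' -` X" for X
    using \<rho>\<rho>' by (auto simp: image_iff) metis
  have img': "\<rho> -` (\<rho> ` X) = X" for X
    using \<rho>\<rho>' by (auto simp: image_iff) metis
  have \<rho>borel: "\<rho> ` X \<in> sets borel" if "X \<in> sets borel" for X
    unfolding img using measurable_sets[of \<rho>' borel borel X] that by simp
  have lb: "distr lborel borel \<rho> = lborel"
    unfolding \<rho>_def by (rule lborel_reindex[OF R])
  have em: "emeasure lborel (\<rho> ` X) = emeasure lborel X" if "X \<in> sets borel" for X
    by (subst lb[symmetric], subst emeasure_distr) (use \<rho>borel[OF that] in \<open>auto simp: img'\<close>)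
  define F where "F = (\<lambda>y. \<rho> (f (\<rho>' y)))"
  define F' where "F' = (\<lambda>y v. \<rho> (f' (\<rho>' y) (\<rho>' v)))"
  have FB: "F ` (\<rho> ` B) = \<rho> ` (f ` B)"
    by (auto simp: F_def \<rho>\<rho>' image_iff)
  have det: "det (matrix (F' (\<rho> x))) = det (matrix (f' x))" for x
  proof -
    have e: "\<rho>' (axis j 1) = axis (R j) 1" for j
      using S by (auto simp: \<rho>'_def axis_def vec_eq_iff)
    have "matrix (F' (\<rho> x)) = (\<chi> i j. matrix (f' x) $ R i $ R j)"
      unfolding F'_def matrix_def \<rho>\<rho>' e by (simp add: vec_eq_iff \<rho>_def)
    then show ?thesis using det_reindex[OF R, of "matrix (f' x)"] by simp
  qed
  have "emeasure lborel (f ` B) = emeasure lborel (F ` (\<rho> ` B))"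
    unfolding FB by (rule em[OF B(2), symmetric])
  also have "\<dots> = (\<integral>\<^sup>+y. ennreal \<bar>det (matrix (F' y))\<bar> * indicator (\<rho> ` B) y \<partial>lborel)"
  proof (rule emeasure_differentiable_image_wellorder)
    show "\<rho> ` B \<in> sets borel" "F ` \<rho> ` B \<in> sets borel"
      unfolding FB by (intro \<rho>borel B)+
    show "inj_on F (\<rho> ` B)"
      using inj by (auto simp: F_def inj_on_def \<rho>\<rho>') (metis \<rho>\<rho>'(2))
    show "(F has_derivative F' y) (at y within \<rho> ` B)" if "y \<in> \<rho> ` B" for y
    proof -
      have x: "\<rho>' y \<in> B" using that \<rho>\<rho>' by auto
      have d: "(\<rho>' has_derivative \<rho>') (at y within \<rho> ` B)" "(\<rho> has_derivative \<rho>) (at z)" for z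
        using lin by (auto intro!: linear_imp_has_derivative)
      have "((\<lambda>y. f (\<rho>' y)) has_derivative (\<lambda>v. f' (\<rho>' y) (\<rho>' v))) (at y within \<rho> ` B)"
      proof (rule has_derivative_in_compose[OF d(1)])
        show "(f has_derivative f' (\<rho>' y)) (at (\<rho>' y) within \<rho>' ` \<rho> ` B)"
          using f'[OF x] by (simp add: image_image \<rho>\<rho>')
      qed
      from has_derivative_compose[OF this d(2)] show ?thesis
        unfolding F_def F'_def .
    qed
    have "(\<lambda>y. indicator (\<rho> ` B) y * \<bar>det (matrix (F' y))\<bar>) =
        (\<lambda>y. (\<lambda>x. indicator B x * \<bar>det (matrix (f' x))\<bar>) (\<rho>' y))"
      using det[of "\<rho>' _"] by (auto simp: img \<rho>\<rho>' indicator_def fun_eq_iff)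
    then show "(\<lambda>y. indicator (\<rho> ` B) y * \<bar>det (matrix (F' y))\<bar>) \<in> borel_measurable borel"
      using measurable_compose[OF _ meas, of \<rho>' borel] by simp
  qed
  also have "\<dots> = (\<integral>\<^sup>+x. ennreal \<bar>det (matrix (F' (\<rho> x)))\<bar> * indicator (\<rho> ` B) (\<rho> x) \<partial>lborel)"
  proof -
    define u where "u y = ennreal \<bar>det (matrix (F' y))\<bar> * indicator (\<rho> ` B) y" for y
    have "u = (\<lambda>y. ennreal ((\<lambda>x. indicator B x * \<bar>det (matrix (f' x))\<bar>) (\<rho>' y)))"
      using det[of "\<rho>' _"] by (auto simp: u_def img \<rho>\<rho>' indicator_def fun_eq_iff)
    then have "u \<in> borel_measurable borel"
      using measurable_compose[OF _ meas, of \<rho>' borel] by simp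
    then have "(\<integral>\<^sup>+y. u y \<partial>distr lborel borel \<rho>) = (\<integral>\<^sup>+x. u (\<rho> x) \<partial>lborel)"
      by (intro nn_integral_distr) auto
    then show ?thesis by (simp only: lb u_def)
  qed
  also have "\<dots> = (\<integral>\<^sup>+x. ennreal \<bar>det (matrix (f' x))\<bar> * indicator B x \<partial>lborel)"
    unfolding det by (intro nn_integral_cong) (auto simp: img \<rho>\<rho>' indicator_def)
  finally show ?thesis .
qed

text \<open>The formula for sets, applied to B \<inter> f^-1 X, says that \<open>f\<close> pushes
  the measure with density |det f'| on \<open>B\<close> forward to Lebesgue measure on the image of
  \<open>B\<close>. Integrating \<open>u\<close> against these two equal measures gives the
  claim.\<close>

lemma nn_integral_diffeomorphism:
  fixes f :: "real ^ 'n \<Rightarrow> real ^ 'n"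
  assumes S: "open S" "open T" "f ` S = T" "\<And>x. x \<in> S \<Longrightarrow> k (f x) = x" "continuous_on T k"
    and f': "\<And>x. x \<in> S \<Longrightarrow> (f has_derivative f' x) (at x)" and cont: "continuous_on S (\<lambda>x. matrix (f' x))"
    and B: "B \<in> sets borel" "B \<subseteq> S" and u: "(\<lambda>y. u y * indicator T y) \<in> borel_measurable borel"
  shows "(\<integral>\<^sup>+y\<in>f ` B. u y \<partial>lborel) = (\<integral>\<^sup>+x\<in>B. u (f x) * ennreal \<bar>det (matrix (f' x))\<bar> \<partial>lborel)"
proof -
  \<comment> \<open>Cut off by the open set \<open>S\<close>, the map and its Jacobian are Borel
    functions on the whole space.\<close>
  define F where "F = (\<lambda>x. indicator S x *\<^sub>R f x)"
  define J where "J = (\<lambda>x. indicator S x *\<^sub>R \<bar>det (matrix (f' x))\<bar>)"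
  have contf: "continuous_on S f"
    using f' by (meson continuous_at_imp_continuous_on has_derivative_continuous)
  have F [measurable]: "F \<in> borel_measurable borel"
    unfolding F_def by (rule borel_measurable_continuous_on_indicator[OF _ contf]) (use S in auto)
  have "continuous_on S (\<lambda>x. \<bar>det (matrix (f' x))\<bar>)"
    unfolding det_def
    by (intro continuous_on_rabs continuous_on_sum continuous_on_mult continuous_on_const continuous_on_prod
        continuous_on_component[OF continuous_on_component[OF cont]])
  then have J [measurable]: "J \<in> borel_measurable borel"
    unfolding J_def by (intro borel_measurable_continuous_on_indicator) (use S in auto)
  \<comment> \<open>The image of a Borel set is Borel because it is a preimage under the continuous
    inverse \<open>k\<close>.\<close>
  have fB: "f ` X \<in> sets borel" if "X \<in> sets borel" "X \<subseteq> S" for X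
  proof -
    have "f ` X = T \<inter> k -` X" using that S by (auto simp: image_iff)
    also have "\<dots> \<in> sets borel"
      using borel_measurable_continuous_on_indicator[OF _ S(5)] S(2) that(1)
        measurable_sets[of "\<lambda>x. indicator T x *\<^sub>R k x" borel borel X]
      sets.Int[of T borel "(\<lambda>x. indicator T x *\<^sub>R k x) -` X"]
      by (auto simp: indicator_def vimage_def Collect_conj_eq[symmetric] Int_def cong: conj_cong)
    finally show ?thesis .
  qed
  define M where "M = distr (density lborel (\<lambda>x. ennreal (J x) * indicator B x)) borel F"
  have Meq: "M = density lborel (indicator (f ` B))"
  proof (rule measure_eqI)
    show "sets M = sets (density lborel (indicator (f ` B)))" by (simp add: M_def)
    fix X assume "X \<in> sets M"
    then have X: "X \<in> sets borel" by (simp add: M_def)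
    define C where "C = B \<inter> F -` X"
    have C: "C \<in> sets borel" "C \<subseteq> S"
      unfolding C_def using B(2) sets.Int[OF B(1) measurable_sets[OF F X]] by auto
    have fC: "f ` C = f ` B \<inter> X"
      using B(2) by (auto simp: C_def F_def image_iff subset_iff)
    have Jeq: "(\<lambda>x. indicator C x * \<bar>det (matrix (f' x))\<bar>) = (\<lambda>x. indicator C x * J x)"
      using C(2) by (auto simp: indicator_def J_def fun_eq_iff)
    have "emeasure lborel (f ` C) = (\<integral>\<^sup>+x. ennreal \<bar>det (matrix (f' x))\<bar> * indicator C x \<partial>lborel)"
    proof (rule emeasure_differentiable_image[OF C(1) fB[OF C]])
      show "(f has_derivative f' x) (at x within C)" if "x \<in> C" for x
        using f' C that has_derivative_at_withinI by blast
      show "inj_on f C" using S(4) C(2) by (metis inj_onI subsetD)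
      show "(\<lambda>x. indicator C x * \<bar>det (matrix (f' x))\<bar>) \<in> borel_measurable borel"
        unfolding Jeq using C by measurable
    qed
    also have "\<dots> = (\<integral>\<^sup>+x. ennreal (J x) * indicator B x * indicator (F -` X) x \<partial>lborel)"
      using C(2) by (intro nn_integral_cong) (auto simp: C_def J_def indicator_def)
    also have "\<dots> = emeasure M X"
      using B X measurable_sets[OF F X] unfolding M_def by (subst emeasure_distr) (auto simp: emeasure_density)
    finally show "emeasure M X = emeasure (density lborel (indicator (f ` B))) X"
      using X fB[OF B] by (simp add: fC emeasure_density indicator_inter_arith[symmetric] sets.Int)
  qed
  define v where "v = (\<lambda>y. u y * indicator T y)"
  have v [measurable]: "v \<in> borel_measurable borel" using u by (simp add: v_def)
  have "(\<integral>\<^sup>+y\<in>f ` B. u y \<partial>lborel) = (\<integral>\<^sup>+y. indicator (f ` B) y * v y \<partial>lborel)"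
    using B(2) S(3) by (intro nn_integral_cong) (auto simp: v_def indicator_def)
  also have "\<dots> = (\<integral>\<^sup>+y. v y \<partial>M)"
    unfolding Meq using fB[OF B] by (subst nn_integral_density) auto
  also have "\<dots> = (\<integral>\<^sup>+x. ennreal (J x) * indicator B x * v (F x) \<partial>lborel)"
    unfolding M_def using B by (simp add: nn_integral_distr nn_integral_density)
  also have "\<dots> = (\<integral>\<^sup>+x\<in>B. u (f x) * ennreal \<bar>det (matrix (f' x))\<bar> \<partial>lborel)"
    using B(2) S(3) by (intro nn_integral_cong) (auto simp: v_def F_def J_def indicator_def mult_ac)
  finally show ?thesis .
qed

section \<open>Metric traces\<close>

text \<open>The basis is chosen by the same expression as in \<open>nabla_norm_sq\<close>, which
  thereby becomes an instance by definition. It depends on \<open>b\<close> alone, so that the trace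
  is linear and monotone in \<open>B\<close> term by term.\<close>

definition metric_trace :: "(real ^ 'n \<Rightarrow> real ^ 'n \<Rightarrow> real) \<Rightarrow> (real ^ 'n::finite \<Rightarrow> real ^ 'n \<Rightarrow> real) \<Rightarrow> real" where
  "metric_trace b B = (let e = (SOME e. orthonormal_basis_for b e) in \<Sum>i\<in>UNIV. B (e i) (e i))"

lemma nabla_norm_sq_eq_trace:
  "nabla_norm_sq g h D \<sigma> x = metric_trace (g x) (\<lambda>v w. h x (D x v \<sigma>) (D x w \<sigma>))"
  by (simp add: nabla_norm_sq_def metric_trace_def)

lemma metric_trace_add: "metric_trace b (\<lambda>v w. B v w + C v w) = metric_trace b B + metric_trace b C"
  and metric_trace_scale: "metric_trace b (\<lambda>v w. r * B v w) = r * metric_trace b B"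
  by (simp_all add: metric_trace_def Let_def sum.distrib sum_distrib_left)

lemma metric_trace_mono: "(\<And>v. B v v \<le> C v v) \<Longrightarrow> metric_trace b B \<le> metric_trace b C"
  by (auto simp: metric_trace_def Let_def intro: sum_mono)

text \<open>Only the diagonal of a form matters; so the two cross terms of a square may be collected
  into a single unsymmetric one, as in \<open>cometric_combination\<close> and
  \<open>radial_energy\<close>.\<close>

lemma metric_trace_cong: "(\<And>v. B v v = C v v) \<Longrightarrow> metric_trace b B = metric_trace b C"
  by (auto simp: metric_trace_def Let_def)

lemma metric_trace_nonneg: "(\<And>v. 0 \<le> B v v) \<Longrightarrow> 0 \<le> metric_trace b B"
  by (auto simp: metric_trace_def Let_def intro: sum_nonneg)

lemma bilinear_mult_linear:
  fixes \<alpha> \<beta> :: "real ^ 'n \<Rightarrow> real"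
  assumes "linear \<alpha>" "linear \<beta>"
  shows "bilinear (\<lambda>v w. \<alpha> v * \<beta> w)"
  unfolding bilinear_def
  by (auto intro!: linearI simp: linear_add[OF assms(1)] linear_add[OF assms(2)]
      linear_scale[OF assms(1)] linear_scale[OF assms(2)] algebra_simps)

context oriented_manifold
begin

lemma smooth_map_on_det:
  fixes f :: "'m \<Rightarrow> real ^ 'k ^ 'k"
  assumes "open W" "\<And>i j. smooth_map_on A W (\<lambda>x. f x $ i $ j)"
  shows "smooth_map_on A W (\<lambda>x. det (f x))"
  unfolding smooth_map_on_def o_def
  by (intro ballI smooth_on_det chart_image_Int_open assms(1))
    (use assms(2) in \<open>simp_all add: smooth_map_on_def o_def\<close>)

lemma smooth_map_on_divide:
  fixes f k :: "'m \<Rightarrow> real"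
  assumes "open W" "smooth_map_on A W f" "smooth_map_on A W k" "\<And>x. x \<in> W \<Longrightarrow> k x \<noteq> 0"
  shows "smooth_map_on A W (\<lambda>x. f x / k x)"
  unfolding smooth_map_on_def o_def
proof (intro ballI smooth_on_divide chart_image_Int_open assms(1))
  fix c y assume "c \<in> A" "y \<in> snd c ` (fst c \<inter> W)"
  then show "k (chart_inv c y) \<noteq> 0" using assms(4) by (auto simp: chart_inv_left)
qed (use assms(2,3) in \<open>simp_all add: smooth_map_on_def o_def\<close>)

end

section \<open>Traces, gradients and the inverse metric in coordinates\<close>

context riemannian_manifold
begin

lemma metric_matrix_det_pos:
  assumes "c \<in> A" "x \<in> fst c"
  shows "det (metric_matrix A g c x) > 0"
  unfolding metric_matrix_def
  by (rule gram_matrix_det_pos[OF metric_inner_product linear_coord_vector[OF assms] surj_coord_vector[OF assms]])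

text \<open>Replaces the chosen orthonormal basis, which need not vary continuously with
  \<open>x\<close>, by the inverse metric in a chart, whose entries are smooth.\<close>

lemma metric_trace_coord:
  assumes "c \<in> A" "x \<in> fst c" "bilinear B"
  shows "metric_trace (g x) B = (\<Sum>a\<in>UNIV. \<Sum>b\<in>UNIV. matrix_inv (metric_matrix A g c x) $ a $ b *
    B (coord_vector A c x (axis a 1)) (coord_vector A c x (axis b 1)))"
  unfolding metric_trace_def Let_def metric_matrix_def
  by (rule orthonormal_trace[OF metric_inner_product linear_coord_vector[OF assms(1,2)] surj_coord_vector[OF assms(1,2)]
      orthonormal_basis_for_some[OF metric_inner_product] assms(3)])

lemma
  assumes "linear (differential A f x)"
  shows gradient_inner: "g x (gradient A g f x) v = differential A f x v"
    and gradient_norm_sq: "g x (gradient A g f x) (gradient A g f x) =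
      metric_trace (g x) (\<lambda>v w. differential A f x v * differential A f x w)"
  using riesz_orthonormal[OF metric_inner_product assms orthonormal_basis_for_some[OF metric_inner_product]]
  unfolding gradient_def metric_trace_def Let_def by auto

text \<open>Raising an index: pairing the gradient with the coordinate vectors gives the linear
  system G \<omega> = df, which the inverse matrix solves.\<close>

lemma components_gradient:
  assumes c: "c \<in> A" "x \<in> fst c" and lin: "linear (differential A f x)"
  shows "components A c x (gradient A g f x) $ a =
    (\<Sum>b\<in>UNIV. matrix_inv (metric_matrix A g c x) $ a $ b * differential A f x (coord_vector A c x (axis b 1)))"
proof -
  define G where "G = metric_matrix A g c x"
  define \<omega> where "\<omega> = components A c x (gradient A g f x)"
  have w: "coord_vector A c x \<omega> = gradient A g f x"
    unfolding \<omega>_def by (rule coord_vector_components[OF c])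
  have "differential A f x (coord_vector A c x (axis b 1)) = (G *v \<omega>) $ b" for b
  proof -
    have "differential A f x (coord_vector A c x (axis b 1)) =
        g x (coord_vector A c x (axis b 1)) (coord_vector A c x \<omega>)"
      unfolding w using gradient_inner[OF lin] inner_product_on_UNIV_simps(1)[OF metric_inner_product] by metis
    also have "\<dots> = (\<Sum>a\<in>UNIV. \<Sum>i\<in>UNIV. axis b 1 $ a * \<omega> $ i * G $ a $ i)"
      by (subst bilinear_expand[OF inner_product_on_UNIV_bilinear[OF metric_inner_product]
            linear_coord_vector[OF c] linear_coord_vector[OF c]]) (simp add: G_def metric_matrix_def)
    also have "\<dots> = (\<Sum>a\<in>UNIV. if a = b then \<Sum>i\<in>UNIV. \<omega> $ i * G $ a $ i else 0)"
      by (intro sum.cong refl) (auto simp: axis_def)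
    also have "\<dots> = (G *v \<omega>) $ b"
      by (simp add: matrix_vector_mult_def mult_ac)
    finally show ?thesis .
  qed
  then have 1: "G *v \<omega> = (\<chi> b. differential A f x (coord_vector A c x (axis b 1)))"
    by (simp add: vec_eq_iff)
  have "det G \<noteq> 0" using metric_matrix_det_pos[OF c] by (simp add: G_def)
  then obtain H where H: "G ** H = mat 1" "H ** G = mat 1"
    using invertible_det_nz[of G] unfolding invertible_def by blast
  then have "matrix_inv G ** G = mat 1" using matrix_inv_eqI[OF H(1)] by simp
  then have "\<omega> = matrix_inv G *v (G *v \<omega>)" by (simp add: matrix_vector_mul_assoc)
  then show ?thesis unfolding 1 by (simp add: \<omega>_def[symmetric] G_def[symmetric] matrix_vector_mult_def)
qed

lemma smooth_metric_matrix_nth: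
  "c \<in> A \<Longrightarrow> smooth_map_on A (fst c) (\<lambda>x. metric_matrix A g c x $ i $ j)"
  by (intro smooth_map_on_vec_nth chart_open metric_smooth)

lemma smooth_det_metric_matrix: "c \<in> A \<Longrightarrow> smooth_map_on A (fst c) (\<lambda>x. det (metric_matrix A g c x))"
  by (intro smooth_map_on_det chart_open smooth_metric_matrix_nth)

lemma smooth_sqrt_det_metric_matrix:
  assumes "c \<in> A"
  shows "smooth_map_on A (fst c) (\<lambda>x. sqrt (det (metric_matrix A g c x)))"
proof -
  have "smooth_map_on A (fst c) (\<lambda>x. det (metric_matrix A g c x) powr (1/2))"
    by (rule smooth_map_on_powr[OF chart_open[OF assms] smooth_det_metric_matrix[OF assms] metric_matrix_det_pos[OF assms]])
  then show ?thesis
    by (rule smooth_map_on_cong[OF chart_open[OF assms], THEN iffD1, rotated])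
      (use metric_matrix_det_pos[OF assms] in \<open>auto simp: powr_half_sqrt less_imp_le\<close>)
qed

lemma smooth_matrix_inv_metric_matrix:
  assumes "c \<in> A"
  shows "smooth_map_on A (fst c) (\<lambda>x. matrix_inv (metric_matrix A g c x) $ a $ b)"
proof -
  have "smooth_map_on A (fst c) (\<lambda>x. (\<chi> i j. if j = a then axis b 1 $ i else metric_matrix A g c x $ i $ j) $ i $ j)" for i j
    using smooth_metric_matrix_nth[OF assms] by (cases "j = a") auto
  then have "smooth_map_on A (fst c) (\<lambda>x. det (\<chi> i j. if j = a then axis b 1 $ i else metric_matrix A g c x $ i $ j) /
      det (metric_matrix A g c x))"
    by (intro smooth_map_on_divide smooth_map_on_det smooth_det_metric_matrix chart_open assms)
      (use metric_matrix_det_pos[OF assms] in fastforce)+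
  then show ?thesis
  proof (rule smooth_map_on_cong[OF chart_open[OF assms], THEN iffD1, rotated])
    fix x assume "x \<in> fst c"
    then show "det (\<chi> i j. if j = a then axis b 1 $ i else metric_matrix A g c x $ i $ j) /
      det (metric_matrix A g c x) = matrix_inv (metric_matrix A g c x) $ a $ b"
      using metric_matrix_det_pos[OF assms, of x] by (subst matrix_inv_cramer) auto
  qed
qed

text \<open>The inner product of the gradients of \<open>f\<close> and \<open>k\<close>, expressed
  through differentials; this makes it additive in each argument at sight and avoids the definite
  description in \<open>gradient\<close>.\<close>

definition cometric :: "('m \<Rightarrow> real) \<Rightarrow> ('m \<Rightarrow> real) \<Rightarrow> 'm \<Rightarrow> real" where
  "cometric f k x = metric_trace (g x) (\<lambda>v w. differential A f x v * differential A k x w)"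

lemma cometric_coord:
  assumes "c \<in> A" "x \<in> fst c" "smooth_map_on A W f" "smooth_map_on A W k" "x \<in> W"
  shows "cometric f k x = (\<Sum>a\<in>UNIV. \<Sum>b\<in>UNIV. matrix_inv (metric_matrix A g c x) $ a $ b *
    (chart_derivative c f x (axis a 1) * chart_derivative c k x (axis b 1)))"
  unfolding cometric_def
  using metric_trace_coord[OF assms(1,2) bilinear_mult_linear[OF linear_differential[OF assms(3,5)] linear_differential[OF assms(4,5)]]]
  by (simp add: differential_coord_vector[OF assms(1,2,3,5)] differential_coord_vector[OF assms(1,2,4,5)])

lemma smooth_cometric:
  assumes W: "open W" "smooth_map_on A W f" "smooth_map_on A W k"
  shows "smooth_map_on A W (cometric f k)"
proof (rule smooth_map_on_local[OF W(1)])
  fix x assume x: "x \<in> W"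
  obtain c where c: "c \<in> A" "x \<in> fst c" by (rule chart_exists)
  have op: "open (fst c \<inter> W)" using chart_open[OF c(1)] W(1) by (rule open_Int)
  have "smooth_map_on A (fst c \<inter> W) (\<lambda>x. \<Sum>a\<in>UNIV. \<Sum>b\<in>UNIV. matrix_inv (metric_matrix A g c x) $ a $ b *
    (chart_derivative c f x (axis a 1) * chart_derivative c k x (axis b 1)))"
    by (intro smooth_map_on_sum smooth_map_on_mult op smooth_map_on_chart_derivative c W
        smooth_map_on_subset[OF smooth_matrix_inv_metric_matrix[OF c(1)] Int_lower1])
  then have "smooth_map_on A (fst c \<inter> W) (cometric f k)"
    by (rule smooth_map_on_cong[OF op, THEN iffD1, rotated]) (use cometric_coord[OF c(1) _ W(2,3)] in simp)
  then show "\<exists>U. open U \<and> x \<in> U \<and> smooth_map_on A (U \<inter> W) (cometric f k)"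
    using c chart_open by blast
qed

lemma cometric_nonneg: "0 \<le> cometric f f x"
  unfolding cometric_def by (intro metric_trace_nonneg) simp

end

section \<open>Smooth sections\<close>

context oriented_vector_bundle
begin

lemma triv_exists: obtains V \<Psi> where "(V, \<Psi>) \<in> T" "x \<in> V"
proof -
  have "x \<in> (\<Union>(V, \<Psi>)\<in>T. V)" by (simp only: triv_cover UNIV_I)
  then show thesis using that by auto
qed

lemma
  assumes "(V, \<Psi>) \<in> T" "x \<in> V"
  shows triv_linear: "linear (\<Psi> x)" and triv_range: "range (\<Psi> x) = E x"
    and triv_inv_left: "inv (\<Psi> x) (\<Psi> x u) = u" and triv_inv_right: "e \<in> E x \<Longrightarrow> \<Psi> x (inv (\<Psi> x) e) = e"
    and triv_mem: "\<Psi> x u \<in> E x"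
  using triv_iso[OF assms] by (auto simp: f_inv_into_f)

lemma subspace_fibre: "subspace (E x)"
proof -
  obtain V \<Psi> where t: "(V, \<Psi>) \<in> T" "x \<in> V" by (rule triv_exists)
  then show ?thesis
    using linear_subspace_image[OF triv_linear[OF t] subspace_UNIV] triv_range[OF t] by simp
qed

lemma linear_inv_triv:
  assumes "(V, \<Psi>) \<in> T" "x \<in> V" "u \<in> E x"
  shows "v \<in> E x \<Longrightarrow> inv (\<Psi> x) (u + v) = inv (\<Psi> x) u + inv (\<Psi> x) v"
    and "inv (\<Psi> x) (r *\<^sub>R u) = r *\<^sub>R inv (\<Psi> x) u"
proof -
  note t = assms(1,2)
  have "\<Psi> x (inv (\<Psi> x) u + inv (\<Psi> x) v) = u + v" if "v \<in> E x"
    using assms that by (simp add: linear_add[OF triv_linear[OF t]] triv_inv_right[OF t])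
  then show "v \<in> E x \<Longrightarrow> inv (\<Psi> x) (u + v) = inv (\<Psi> x) u + inv (\<Psi> x) v"
    by (metis triv_inv_left[OF t])
  have "\<Psi> x (r *\<^sub>R inv (\<Psi> x) u) = r *\<^sub>R u"
    using assms by (simp add: linear_scale[OF triv_linear[OF t]] triv_inv_right[OF t])
  then show "inv (\<Psi> x) (r *\<^sub>R u) = r *\<^sub>R inv (\<Psi> x) u"
    by (metis triv_inv_left[OF t])
qed

lemma smooth_section_fibre: "smooth_section A E T \<sigma> \<Longrightarrow> \<sigma> x \<in> E x"
  by (simp add: smooth_section_def)

lemma smooth_sectionD:
  "smooth_section A E T \<sigma> \<Longrightarrow> (V, \<Psi>) \<in> T \<Longrightarrow> smooth_map_on A V (\<lambda>x. inv (\<Psi> x) (\<sigma> x))"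
  by (auto simp: smooth_section_def)

text \<open>A change of trivialisation acts on coordinates by a smooth matrix, so smoothness may be
  tested in one trivialisation near each point.\<close>

lemma smooth_sectionI:
  assumes "\<And>x. \<sigma> x \<in> E x"
    and loc: "\<And>x. \<exists>(V, \<Psi>)\<in>T. \<exists>U. open U \<and> x \<in> U \<and> U \<subseteq> V \<and> smooth_map_on A U (\<lambda>x. inv (\<Psi> x) (\<sigma> x))"
  shows "smooth_section A E T \<sigma>"
  unfolding smooth_section_def
proof (intro conjI allI ballI assms(1), clarify)
  fix W \<Theta> assume W: "(W, \<Theta>) \<in> T"
  show "smooth_map_on A W (\<lambda>x. inv (\<Theta> x) (\<sigma> x))"
  proof (rule smooth_map_on_local[OF triv_open[OF W]])
    fix x assume x: "x \<in> W"
    obtain V \<Psi> U where V: "(V, \<Psi>) \<in> T" and U: "open U" "x \<in> U" "U \<subseteq> V"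
      and sm: "smooth_map_on A U (\<lambda>x. inv (\<Psi> x) (\<sigma> x))" using loc[of x] by blast
    have op: "open (U \<inter> W)" using U(1) triv_open[OF W] by (rule open_Int)
    define M where "M = (\<lambda>x. matrix (inv (\<Theta> x) \<circ> \<Psi> x))"
    have M: "smooth_map_on A (U \<inter> W) M"
      unfolding M_def by (rule smooth_map_on_subset[OF triv_compatible[OF V W]]) (use U in auto)
    have Mmul: "inv (\<Theta> y) (\<sigma> y) = M y *v inv (\<Psi> y) (\<sigma> y)" if "y \<in> U \<inter> W" for y
    proof -
      have y: "y \<in> V" "y \<in> W" using that U by auto
      have "linear (inv (\<Theta> y) \<circ> \<Psi> y)"
        by (intro linearI) (simp_all add: linear_add[OF triv_linear[OF V y(1)]] linear_scale[OF triv_linear[OF V y(1)]]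
            linear_inv_triv[OF W y(2)] triv_mem[OF V y(1)])
      then have "M y *v inv (\<Psi> y) (\<sigma> y) = (inv (\<Theta> y) \<circ> \<Psi> y) (inv (\<Psi> y) (\<sigma> y))"
        unfolding M_def by (rule fun_cong[OF matrix_vector_mul(2)])
      then show ?thesis by (simp add: triv_inv_right[OF V y(1)] assms(1))
    qed
    have "smooth_map_on A (U \<inter> W) (\<lambda>y. M y *v inv (\<Psi> y) (\<sigma> y))"
    proof (rule smooth_map_on_vec[OF op])
      fix i
      show "smooth_map_on A (U \<inter> W) (\<lambda>y. (M y *v inv (\<Psi> y) (\<sigma> y)) $ i)"
        unfolding matrix_vector_mult_def vec_lambda_beta
        by (intro smooth_map_on_sum smooth_map_on_mult op smooth_map_on_vec_nth[OF op] M
            smooth_map_on_subset[OF sm]) auto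
    qed
    then have "smooth_map_on A (U \<inter> W) (\<lambda>y. inv (\<Theta> y) (\<sigma> y))"
      by (rule smooth_map_on_cong[OF op, THEN iffD1, rotated]) (simp add: Mmul)
    then show "\<exists>U. open U \<and> x \<in> U \<and> smooth_map_on A (U \<inter> W) (\<lambda>x. inv (\<Theta> x) (\<sigma> x))"
      using U by blast
  qed
qed

lemma smooth_section_scale:
  assumes "smooth_map_on A UNIV f" "smooth_section A E T \<sigma>"
  shows "smooth_section A E T (\<lambda>x. f x *\<^sub>R \<sigma> x)"
  unfolding smooth_section_def
proof (intro conjI allI ballI, goal_cases)
  case (1 x)
  then show ?case using smooth_section_fibre[OF assms(2)] subspace_fibre by (auto intro: subspace_scale)
next
  case (2 t)
  obtain V \<Psi> where t: "t = (V, \<Psi>)" by fastforce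
  with 2 have T: "(V, \<Psi>) \<in> T" by simp
  have "smooth_map_on A V (\<lambda>x. f x *\<^sub>R inv (\<Psi> x) (\<sigma> x))"
    by (intro smooth_map_on_scaleR triv_open[OF T] smooth_sectionD[OF assms(2) T] smooth_map_on_subset[OF assms(1)]) auto
  then have "smooth_map_on A V (\<lambda>x. inv (\<Psi> x) (f x *\<^sub>R \<sigma> x))"
    by (rule smooth_map_on_cong[OF triv_open[OF T], THEN iffD1, rotated])
      (simp add: linear_inv_triv[OF T _ smooth_section_fibre[OF assms(2)]])
  then show ?case by (simp add: t)
qed

lemma smooth_section_add:
  assumes "smooth_section A E T \<sigma>" "smooth_section A E T \<tau>"
  shows "smooth_section A E T (\<lambda>x. \<sigma> x + \<tau> x)"
  unfolding smooth_section_def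
proof (intro conjI allI ballI, goal_cases)
  case (1 x)
  then show ?case using smooth_section_fibre[OF assms(1)] smooth_section_fibre[OF assms(2)] subspace_fibre
    by (auto intro: subspace_add)
next
  case (2 t)
  obtain V \<Psi> where t: "t = (V, \<Psi>)" by fastforce
  with 2 have T: "(V, \<Psi>) \<in> T" by simp
  have "smooth_map_on A V (\<lambda>x. inv (\<Psi> x) (\<sigma> x) + inv (\<Psi> x) (\<tau> x))"
    by (intro smooth_map_on_add triv_open[OF T] smooth_sectionD[OF assms(1) T] smooth_sectionD[OF assms(2) T])
  then have "smooth_map_on A V (\<lambda>x. inv (\<Psi> x) (\<sigma> x + \<tau> x))"
    by (rule smooth_map_on_cong[OF triv_open[OF T], THEN iffD1, rotated])
      (simp add: linear_inv_triv(1)[OF T _ smooth_section_fibre[OF assms(1)] smooth_section_fibre[OF assms(2)]])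
  then show ?case by (simp add: t)
qed

end

section \<open>The fibre metric and the squared norm of the covariant derivative\<close>

context riemannian_vector_bundle
begin

lemma
  assumes "u \<in> E x" "v \<in> E x"
  shows fibre_sym: "h x u v = h x v u"
    and fibre_add_left: "w \<in> E x \<Longrightarrow> h x (u + v) w = h x u w + h x v w"
    and fibre_add_right: "w \<in> E x \<Longrightarrow> h x w (u + v) = h x w u + h x w v"
    and fibre_scale_left: "h x (r *\<^sub>R u) v = r * h x u v"
    and fibre_scale_right: "h x u (r *\<^sub>R v) = r * h x u v"
    and fibre_pos: "u \<noteq> 0 \<Longrightarrow> h x u u > 0"
  using fibre_inner_product[of x] assms subspace_add[OF subspace_fibre] subspace_scale[OF subspace_fibre]
  unfolding inner_product_on_def by (simp_all, (metis (no_types, lifting))+)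

lemma fibre_zero: "h x 0 0 = 0"
  using fibre_scale_left[of 0 x 0 0] subspace_0[OF subspace_fibre] by simp

lemma fibre_nonneg: "u \<in> E x \<Longrightarrow> h x u u \<ge> 0"
  using fibre_pos[of u x u] fibre_zero[of x] by (cases "u = 0") auto

text \<open>With a = |v|^2 and b = \<langle>u, v\<rangle>, the squared length of a u - b v is a (a
  |u|^2 - b^2), and it is nonnegative.\<close>

lemma fibre_Cauchy_Schwarz:
  assumes "u \<in> E x" "v \<in> E x"
  shows "(h x u v)\<^sup>2 \<le> h x u u * h x v v"
proof (cases "v = 0")
  case True
  then show ?thesis
    using fibre_scale_right[OF assms(1) assms(1), of 0] by (simp add: fibre_zero)
next
  case False
  define a where "a = h x v v"
  define b where "b = h x u v"
  have a: "a > 0" using fibre_pos[OF assms(2,2)] False by (simp add: a_def)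
  define u' where "u' = a *\<^sub>R u"
  define v' where "v' = (- b) *\<^sub>R v"
  have mem: "u' \<in> E x" "v' \<in> E x"
    unfolding u'_def v'_def by (intro subspace_scale[OF subspace_fibre] assms)+
  have mem': "u' + v' \<in> E x" by (rule subspace_add[OF subspace_fibre mem])
  have "h x (u' + v') (u' + v') = h x u' u' + 2 * h x u' v' + h x v' v'"
    using mem mem' by (simp add: fibre_add_left fibre_add_right fibre_sym[OF mem(2,1)])
  moreover have "h x u' u' = a * (a * h x u u)" "h x u' v' = a * (- b * b)" "h x v' v' = b * (b * a)"
    using fibre_scale_left[OF assms(1) mem(1)] fibre_scale_left[OF assms(1) mem(2)] fibre_scale_left[OF assms(2) mem(2)]
      fibre_scale_right[OF assms(1,1)] fibre_scale_right[OF assms(1,2)] fibre_scale_right[OF assms(2,2)]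
    by (simp_all add: u'_def v'_def a_def b_def del: scaleR_minus_left)
  ultimately have "h x (u' + v') (u' + v') = a * (a * h x u u - b\<^sup>2)"
    by (simp add: power2_eq_square algebra_simps)
  then have "0 \<le> a * (a * h x u u - b\<^sup>2)" using fibre_nonneg[OF mem'] by simp
  then have "0 \<le> a * h x u u - b\<^sup>2" using a by (simp add: zero_le_mult_iff)
  then show ?thesis by (simp add: a_def b_def mult.commute)
qed

lemma smooth_fibre_inner:
  assumes "smooth_section A E T \<sigma>" "smooth_section A E T \<tau>"
  shows "smooth_map_on A UNIV (\<lambda>x. h x (\<sigma> x) (\<tau> x))"
proof (rule smooth_map_on_local[OF open_UNIV])
  fix x
  obtain V \<Psi> where t: "(V, \<Psi>) \<in> T" "x \<in> V" by (rule triv_exists)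
  note V = triv_open[OF t(1)]
  define s where "s = (\<lambda>y. inv (\<Psi> y) (\<sigma> y))"
  define r where "r = (\<lambda>y. inv (\<Psi> y) (\<tau> y))"
  define H where "H = (\<lambda>y. \<chi> i j. h y (\<Psi> y (axis i 1)) (\<Psi> y (axis j 1)))"
  have sm: "smooth_map_on A V s" "smooth_map_on A V r" "smooth_map_on A V H"
    unfolding s_def r_def H_def by (intro smooth_sectionD assms t fibre_metric_smooth)+
  have "smooth_map_on A V (\<lambda>y. \<Sum>a\<in>UNIV. \<Sum>b\<in>UNIV. s y $ a * r y $ b * H y $ a $ b)"
    by (intro smooth_map_on_sum smooth_map_on_mult V smooth_map_on_vec_nth[OF V] sm)
  moreover have "(\<Sum>a\<in>UNIV. \<Sum>b\<in>UNIV. s y $ a * r y $ b * H y $ a $ b) = h y (\<sigma> y) (\<tau> y)" if y: "y \<in> V" for y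
  proof -
    note lin = triv_linear[OF t(1) y] and mem = triv_mem[OF t(1) y]
    have "bilinear (\<lambda>u w. h y (\<Psi> y u) (\<Psi> y w))"
      unfolding bilinear_def
      by (auto intro!: linearI simp: linear_add[OF lin] linear_scale[OF lin] fibre_add_left fibre_add_right
          fibre_scale_left fibre_scale_right mem)
    from bilinear_expand[OF this linear_id linear_id, of "s y" "r y"]
    show ?thesis
      by (simp add: s_def r_def H_def triv_inv_right[OF t(1) y] smooth_section_fibre[OF assms(1)] smooth_section_fibre[OF assms(2)])
  qed
  ultimately have "smooth_map_on A V (\<lambda>y. h y (\<sigma> y) (\<tau> y))"
    by (rule smooth_map_on_cong[OF V, THEN iffD1, rotated])
  then show "\<exists>U. open U \<and> x \<in> U \<and> smooth_map_on A (U \<inter> UNIV) (\<lambda>x. h x (\<sigma> x) (\<tau> x))"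
    using t V by auto
qed

lemma smooth_norm_sq: "smooth_section A E T \<sigma> \<Longrightarrow> smooth_map_on A UNIV (norm_sq h \<sigma>)"
  using smooth_fibre_inner[of \<sigma> \<sigma>] by (simp add: norm_sq_def[abs_def])

lemma norm_sq_nonneg: "smooth_section A E T \<sigma> \<Longrightarrow> norm_sq h \<sigma> x \<ge> 0"
  unfolding norm_sq_def by (intro fibre_nonneg smooth_section_fibre)

lemma differential_norm_sq:
  assumes "smooth_section A E T \<sigma>"
  shows "differential A (norm_sq h \<sigma>) x v = 2 * h x (D x v \<sigma>) (\<sigma> x)"
  using conn_metric[OF assms assms, of x v] fibre_sym[OF smooth_section_fibre[OF assms] conn_fibre[OF assms]]
  by (simp add: norm_sq_def[abs_def])

lemma bilinear_connection:
  assumes "smooth_section A E T \<sigma>" "smooth_section A E T \<tau>"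
  shows "bilinear (\<lambda>v w. h x (D x v \<sigma>) (D x w \<tau>))"
  unfolding bilinear_def
  by (auto intro!: linearI simp: linear_add[OF conn_linear[OF assms(1)]] linear_scale[OF conn_linear[OF assms(1)]]
      linear_add[OF conn_linear[OF assms(2)]] linear_scale[OF conn_linear[OF assms(2)]]
      fibre_add_left fibre_add_right fibre_scale_left fibre_scale_right conn_fibre assms)

text \<open>In a chart the trace combines the inverse metric with derivatives of \<sigma> along
  coordinate fields. The cut-off fields \<open>X\<close> turn these derivatives into smooth
  sections, and nothing is lost near \<open>x\<close>: there they agree with the coordinate fields,
  and \<open>D y v \<sigma>\<close> sees a vector field through its value at \<open>y\<close>
  only.\<close>

lemma smooth_nabla_norm_sq:
  assumes \<sigma>: "smooth_section A E T \<sigma>"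
  shows "smooth_map_on A UNIV (nabla_norm_sq g h D \<sigma>)"
proof (rule smooth_map_on_local[OF open_UNIV])
  fix x
  obtain c where c: "c \<in> A" "x \<in> fst c" by (rule chart_exists)
  obtain \<phi> :: "'m \<Rightarrow> real" and U K \<Omega> where \<phi>: "smooth_map_on A UNIV \<phi>" "\<And>y. 0 \<le> \<phi> y" "open U" "x \<in> U" "\<And>y. y \<in> U \<Longrightarrow> \<phi> y = 1"
    "compact K" "U \<subseteq> K" "K \<subseteq> \<Omega>" "\<And>y. y \<notin> K \<Longrightarrow> \<phi> y = 0"
    "open \<Omega>" "connected \<Omega>" "compact (closure \<Omega>)" "closure \<Omega> \<subseteq> fst c"
    by (rule bump_exists[OF c(1) chart_open[OF c(1)] c(2) order_refl]) (rule that)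
  have K: "K \<subseteq> fst c" using \<phi>(8,13) closure_subset by blast
  define X where "X = (\<lambda>\<xi> y. \<phi> y *\<^sub>R coord_vector A c y \<xi>)"
  have X: "smooth_vector_field A (X \<xi>)" for \<xi>
    unfolding X_def by (rule smooth_vector_field_cutoff[OF c(1) \<phi>(1,6) K \<phi>(9)])
  have sec: "smooth_section A E T (\<lambda>y. D y (X \<xi> y) \<sigma>)" for \<xi>
    by (rule conn_smooth[OF X \<sigma>])
  have U: "open U" "U \<subseteq> fst c" using \<phi> K by auto
  have "smooth_map_on A U (\<lambda>y. \<Sum>a\<in>UNIV. \<Sum>b\<in>UNIV. matrix_inv (metric_matrix A g c y) $ a $ b *
      h y (D y (X (axis a 1) y) \<sigma>) (D y (X (axis b 1) y) \<sigma>))"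
    by (intro smooth_map_on_sum smooth_map_on_mult U smooth_map_on_subset[OF smooth_matrix_inv_metric_matrix[OF c(1)]]
        smooth_map_on_subset[OF smooth_fibre_inner[OF sec sec] subset_UNIV])
  then have "smooth_map_on A U (nabla_norm_sq g h D \<sigma>)"
  proof (rule smooth_map_on_cong[OF U(1), THEN iffD1, rotated])
    fix y assume y: "y \<in> U"
    then have "X \<xi> y = coord_vector A c y \<xi>" for \<xi> by (simp add: X_def \<phi>(5))
    then show "(\<Sum>a\<in>UNIV. \<Sum>b\<in>UNIV. matrix_inv (metric_matrix A g c y) $ a $ b *
      h y (D y (X (axis a 1) y) \<sigma>) (D y (X (axis b 1) y) \<sigma>)) = nabla_norm_sq g h D \<sigma> y"
      unfolding nabla_norm_sq_eq_trace
      using metric_trace_coord[OF c(1) _ bilinear_connection[OF \<sigma> \<sigma>], of y] y U by auto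
  qed
  then show "\<exists>U. open U \<and> x \<in> U \<and> smooth_map_on A (U \<inter> UNIV) (nabla_norm_sq g h D \<sigma>)"
    using \<phi> by auto
qed

lemma nabla_norm_sq_nonneg: "smooth_section A E T \<sigma> \<Longrightarrow> 0 \<le> nabla_norm_sq g h D \<sigma> x"
  unfolding nabla_norm_sq_eq_trace by (intro metric_trace_nonneg fibre_nonneg conn_fibre)

lemma nabla_norm_sq_eq_0_iff:
  assumes \<sigma>: "smooth_section A E T \<sigma>"
  shows "nabla_norm_sq g h D \<sigma> x = 0 \<longleftrightarrow> (\<forall>v. D x v \<sigma> = 0)"
proof
  assume 0: "nabla_norm_sq g h D \<sigma> x = 0"
  define e where "e = (SOME e. orthonormal_basis_for (g x) e)"
  have e: "orthonormal_basis_for (g x) e"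
    unfolding e_def by (rule orthonormal_basis_for_some[OF metric_inner_product])
  have "(\<Sum>i\<in>UNIV. h x (D x (e i) \<sigma>) (D x (e i) \<sigma>)) = 0"
    using 0 unfolding nabla_norm_sq_def Let_def e_def .
  then have "h x (D x (e i) \<sigma>) (D x (e i) \<sigma>) = 0" for i
    by (subst (asm) sum_nonneg_eq_0_iff) (auto intro: fibre_nonneg conn_fibre \<sigma>)
  then have De: "D x (e i) \<sigma> = 0" for i
    using fibre_pos[OF conn_fibre[OF \<sigma>] conn_fibre[OF \<sigma>], of x "e i"] by force
  have "D x v \<sigma> = 0" for v
  proof -
    have "D x v \<sigma> = D x (\<Sum>i\<in>UNIV. g x v (e i) *\<^sub>R e i) \<sigma>"
      by (rule arg_cong[OF orthonormal_expand[OF metric_inner_product e]])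
    also have "\<dots> = (\<Sum>i\<in>UNIV. g x v (e i) *\<^sub>R D x (e i) \<sigma>)"
      by (simp add: linear_sum[OF conn_linear[OF \<sigma>]] linear_scale[OF conn_linear[OF \<sigma>]])
    finally have "D x v \<sigma> = (\<Sum>i\<in>UNIV. g x v (e i) *\<^sub>R D x (e i) \<sigma>)" .
    then show ?thesis by (simp add: De)
  qed
  then show "\<forall>v. D x v \<sigma> = 0" by blast
qed (simp add: nabla_norm_sq_def fibre_zero)

end

section \<open>The Riemannian volume\<close>

context riemannian_manifold
begin

definition chart_density :: "('m, 'n) chart \<Rightarrow> real ^ 'n \<Rightarrow> real" where
  "chart_density c y = indicator (snd c ` fst c) y * sqrt (det (metric_matrix A g c (chart_inv c y)))"

text \<open>Constant outside the chart range, so that Borel measurability on the whole space follows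
  from the continuity of \<open>chart_inv\<close> on the open range.\<close>

definition chart_inv_total :: "('m, 'n) chart \<Rightarrow> real ^ 'n \<Rightarrow> 'm" where
  "chart_inv_total c y = (if y \<in> snd c ` fst c then chart_inv c y else undefined)"

text \<open>The Riemannian volume of one chart as a measure on the whole manifold, concentrated on
  \<open>fst c\<close>; the global volume is assembled from such measures.\<close>

definition chart_vol :: "('m, 'n) chart \<Rightarrow> 'm measure" where
  "chart_vol c = distr (density lborel (\<lambda>y. ennreal (chart_density c y))) borel (chart_inv_total c)"

lemma chart_range_open: "c \<in> A \<Longrightarrow> open (snd c ` fst c)"
  by (intro chart_image_open chart_open order_refl)

lemma smooth_chart_sqrt_det:
  assumes "c \<in> A"
  shows "smooth_on (snd c ` fst c) (\<lambda>y. sqrt (det (metric_matrix A g c (chart_inv c y))))"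
  using smooth_map_onD[OF smooth_sqrt_det_metric_matrix[OF assms] assms] by (simp add: o_def)

lemma chart_density_measurable [measurable]:
  assumes "c \<in> A"
  shows "chart_density c \<in> borel_measurable borel"
  using borel_measurable_continuous_on_indicator[OF _ smooth_on_imp_continuous_on[OF smooth_chart_sqrt_det[OF assms]]]
    chart_range_open[OF assms] by (simp add: chart_density_def[abs_def] borel_open)

lemma chart_density_nonneg: "c \<in> A \<Longrightarrow> 0 \<le> chart_density c y"
  using metric_matrix_det_pos[of c "chart_inv c y"] chart_inv_mem[of c y]
  by (auto simp: chart_density_def indicator_def less_imp_le)

lemma chart_density_pos: "c \<in> A \<Longrightarrow> y \<in> snd c ` fst c \<Longrightarrow> 0 < chart_density c y"
  using metric_matrix_det_pos[of c "chart_inv c y"] chart_inv_mem[of c y]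
  by (auto simp: chart_density_def)

lemma chart_inv_total_measurable [measurable]:
  assumes "c \<in> A"
  shows "chart_inv_total c \<in> borel_measurable borel"
  unfolding chart_inv_total_def
  by (rule borel_measurable_continuous_on_if[OF _ chart_inv_continuous[OF assms]])
    (use chart_range_open[OF assms] in auto)

lemma chart_image_borel:
  assumes "c \<in> A" "X \<in> sets borel"
  shows "snd c ` (fst c \<inter> X) \<in> sets borel"
proof -
  have "snd c ` (fst c \<inter> X) = snd c ` fst c \<inter> chart_inv_total c -` X"
    unfolding chart_image_eq[OF assms(1), of "fst c \<inter> X", OF Int_lower1]
    using chart_inv_mem[OF assms(1)] by (auto simp: chart_inv_total_def)
  then show ?thesis
    using chart_range_open[OF assms(1)] measurable_sets[OF chart_inv_total_measurable[OF assms(1)] assms(2)]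
    by auto
qed

lemma sets_chart_vol [simp]: "sets (chart_vol c) = sets borel"
  by (simp add: chart_vol_def)

lemma emeasure_chart_vol:
  assumes c: "c \<in> A" and X: "X \<in> sets borel"
  shows "emeasure (chart_vol c) X =
    (\<integral>\<^sup>+y\<in>snd c ` (fst c \<inter> X). ennreal (sqrt (det (metric_matrix A g c (chart_inv c y)))) \<partial>lborel)"
proof -
  have "emeasure (chart_vol c) X = (\<integral>\<^sup>+y. ennreal (chart_density c y) * indicator (chart_inv_total c -` X) y \<partial>lborel)"
    using measurable_sets[OF chart_inv_total_measurable[OF c] X] chart_density_measurable[OF c]
      chart_inv_total_measurable[OF c] X
    by (simp add: chart_vol_def emeasure_distr emeasure_density)
  also have "\<dots> = (\<integral>\<^sup>+y\<in>snd c ` (fst c \<inter> X). ennreal (sqrt (det (metric_matrix A g c (chart_inv c y)))) \<partial>lborel)"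
    unfolding chart_image_eq[OF c, of "fst c \<inter> X", OF Int_lower1]
    using chart_inv_mem[OF c]
    by (intro nn_integral_cong) (auto simp: chart_density_def chart_inv_total_def indicator_def)
  finally show ?thesis .
qed

lemma metric_matrix_transition:
  assumes "c \<in> A" "d \<in> A" "x \<in> fst c" "x \<in> fst d"
  defines "J \<equiv> matrix (chart_derivative c (snd d) x)"
  shows "metric_matrix A g c x = transpose J ** metric_matrix A g d x ** J"
proof -
  have lin: "linear (chart_derivative c (snd d) x)"
    using has_derivative_linear[OF smooth_map_on_chart_has_derivative[OF smooth_map_on_chart[OF assms(2)] assms(1,3,4)]] .
  have cv: "coord_vector A c x \<xi> = coord_vector A d x (J *v \<xi>)" for \<xi>
    using coord_vector_components[OF assms(2,4), of "coord_vector A c x \<xi>"]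
      components_coord_vector[OF assms(1-4), of \<xi>] fun_cong[OF matrix_vector_mul(2)[OF lin], of \<xi>]
    by (simp add: J_def)
  have "metric_matrix A g c x $ i $ j = (transpose J ** metric_matrix A g d x ** J) $ i $ j" for i j
  proof -
    have "metric_matrix A g c x $ i $ j = (\<Sum>a\<in>UNIV. \<Sum>b\<in>UNIV. (J *v axis i 1) $ a * (J *v axis j 1) $ b *
        metric_matrix A g d x $ a $ b)"
      using bilinear_expand[OF inner_product_on_UNIV_bilinear[OF metric_inner_product[of x]]
          linear_coord_vector[OF assms(2,4)] linear_coord_vector[OF assms(2,4)], of "J *v axis i 1" "J *v axis j 1"]
      by (simp add: metric_matrix_def cv)
    also have "\<dots> = (transpose J ** metric_matrix A g d x ** J) $ i $ j"
      by (subst sum.swap)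
        (simp add: matrix_vector_mult_basis column_def matrix_matrix_mult_def transpose_def sum_distrib_left sum_distrib_right mult_ac)
    finally show ?thesis .
  qed
  then show ?thesis by (simp add: vec_eq_iff)
qed

text \<open>Taking determinants in G_c = J^T G_d J shows that the densities of the two charts differ
  by |det J|, which is precisely the Jacobian factor in the change of variables.\<close>

lemma chart_vol_transition:
  assumes c: "c \<in> A" and d: "d \<in> A" and X: "X \<in> sets borel" "X \<subseteq> fst c \<inter> fst d"
  shows "emeasure (chart_vol c) X = emeasure (chart_vol d) X"
proof -
  define f where "f = snd d \<circ> chart_inv c"
  define S where "S = snd c ` (fst c \<inter> fst d)"
  define R where "R = snd d ` (fst c \<inter> fst d)"
  define u where "u y = ennreal (sqrt (det (metric_matrix A g d (chart_inv d y))))" for y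
  have Rd: "R \<subseteq> snd d ` fst d" by (auto simp: R_def)
  have op: "open S" "open R"
    unfolding S_def R_def by (intro chart_image_open c d open_Int chart_open Int_lower1 Int_lower2)+
  have sm: "smooth_on S f" unfolding S_def f_def by (rule charts_compatible[OF c d])
  have fS: "f ` S = R" by (force simp: f_def S_def R_def chart_inv_left[OF c])
  have fX: "f ` snd c ` X = snd d ` X"
    using X(2) chart_inv_left[OF c] by (force simp: f_def image_image)
  have "emeasure (chart_vol d) X = (\<integral>\<^sup>+y\<in>f ` snd c ` X. u y \<partial>lborel)"
    using X(2) by (simp add: emeasure_chart_vol[OF d X(1)] fX u_def Int_absorb1)
  also have "\<dots> = (\<integral>\<^sup>+y\<in>snd c ` X. u (f y) * ennreal \<bar>det (matrix (frechet_derivative f (at y)))\<bar> \<partial>lborel)"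
  proof (rule nn_integral_diffeomorphism[OF op fS])
    show "(snd c \<circ> chart_inv d) (f y) = y" if "y \<in> S" for y
      using that by (auto simp: f_def S_def chart_inv_left[OF c] chart_inv_left[OF d])
    show "continuous_on R (snd c \<circ> chart_inv d)"
      using smooth_on_imp_continuous_on[OF charts_compatible[OF d c]] by (simp add: R_def Int_commute)
    show "(f has_derivative frechet_derivative f (at y)) (at y)" if "y \<in> S" for y
      by (rule smooth_on_has_derivative[OF sm that])
    show "continuous_on S (\<lambda>y. matrix (frechet_derivative f (at y)))"
      by (intro smooth_on_imp_continuous_on smooth_on_matrix op)
        (simp add: matrix_def smooth_on_vec_nth[OF op(1) smooth_on_frechet_derivative[OF sm]])
    show "snd c ` X \<in> sets borel"
      using chart_image_borel[OF c X(1)] X(2) by (simp add: Int_absorb1)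
    show "snd c ` X \<subseteq> S" using X(2) by (auto simp: S_def)
    have "(\<lambda>y. u y * indicator R y) = (\<lambda>y. ennreal (chart_density d y) * indicator R y)"
      using Rd by (auto simp: u_def chart_density_def indicator_def fun_eq_iff)
    then show "(\<lambda>y. u y * indicator R y) \<in> borel_measurable borel"
      using chart_density_measurable[OF d] op(2) by simp
  qed
  also have "\<dots> = (\<integral>\<^sup>+y\<in>snd c ` (fst c \<inter> X). ennreal (sqrt (det (metric_matrix A g c (chart_inv c y)))) \<partial>lborel)"
  proof (intro nn_integral_cong)
    fix y
    have "u (f y) * ennreal \<bar>det (matrix (frechet_derivative f (at y)))\<bar> =
        ennreal (sqrt (det (metric_matrix A g c (chart_inv c y))))" if "y \<in> snd c ` X"
    proof -
      obtain x where x: "x \<in> X" "y = snd c x" using \<open>y \<in> snd c ` X\<close> by blast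
      then have xcd: "x \<in> fst c" "x \<in> fst d" using X by auto
      define J where "J = matrix (chart_derivative c (snd d) x)"
      have "det (metric_matrix A g c x) = (det J)\<^sup>2 * det (metric_matrix A g d x)"
        unfolding metric_matrix_transition[OF c d xcd] J_def by (simp add: det_mul det_transpose power2_eq_square)
      then have "sqrt (det (metric_matrix A g c x)) = \<bar>det J\<bar> * sqrt (det (metric_matrix A g d x))"
        by (simp add: real_sqrt_mult)
      then show ?thesis
        using metric_matrix_det_pos[OF d xcd(2)]
        by (simp add: u_def f_def x chart_inv_left[OF c xcd(1)] chart_inv_left[OF d xcd(2)] J_def ennreal_mult mult.commute)
    qed
    moreover have "fst c \<inter> X = X" using X(2) by blast
    ultimately show "u (f y) * ennreal \<bar>det (matrix (frechet_derivative f (at y)))\<bar> * indicator (snd c ` X) y =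
        ennreal (sqrt (det (metric_matrix A g c (chart_inv c y)))) * indicator (snd c ` (fst c \<inter> X)) y"
      by (simp add: indicator_def)
  qed
  also have "\<dots> = emeasure (chart_vol c) X"
    by (rule emeasure_chart_vol[OF c X(1), symmetric])
  finally show ?thesis by simp
qed

text \<open>Since \<open>vol\<close> is a choice, its characterisation rests on existence. Second
  countability gives a countable cover by chart domains, which is refined to disjoint Borel pieces;
  each piece is measured by a chart of its own, and by \<open>chart_vol_transition\<close> any other
  chart gives the same value.\<close>

lemma riemannian_volume_exists: "\<exists>\<mu>. is_riemannian_volume A g \<mu>"
proof -
  obtain F where F: "F \<subseteq> fst ` A" "countable F" "\<Union>F = \<Union>(fst ` A)"
    using Lindelof[of "fst ` A"] chart_open by blast
  have "F \<noteq> {}" using F(3) charts_cover by auto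
  then obtain k :: "nat \<Rightarrow> 'm set" where k: "range k = F"
    using F(2) by (metis range_from_nat_into)
  have "\<forall>n. \<exists>c. c \<in> A \<and> fst c = k n" using k F(1) by blast
  then obtain c where c: "\<And>n. c n \<in> A" "\<And>n. fst (c n) = k n" by metis
  define B where "B n = disjointed k n" for n
  have kb: "k n \<in> sets borel" for n using chart_open[OF c(1)] c(2) by (metis borel_open)
  have B: "B n \<in> sets borel" "B n \<subseteq> fst (c n)" for n
    unfolding B_def using kb disjointed_subset[of k n] c(2) sets.range_disjointed_sets[of k borel] by auto
  have BU: "(\<Union>n. B n) = UNIV"
    unfolding B_def UN_disjointed_eq using k F(3) charts_cover by simp
  have disj: "disjoint_family B" unfolding B_def by (rule disjoint_family_disjointed)
  define \<mu> where "\<mu> = measure_of UNIV (sets borel) (\<lambda>X. \<Sum>n. emeasure (chart_vol (c n)) (X \<inter> B n))"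
  have sets: "sets \<mu> = sets borel"
    unfolding \<mu>_def using sets.sigma_sets_eq[of "borel :: 'm measure"] by (simp add: sets_measure_of)
  have em: "emeasure \<mu> X = (\<Sum>n. emeasure (chart_vol (c n)) (X \<inter> B n))" if X: "X \<in> sets borel" for X
  proof (rule emeasure_measure_of[OF \<mu>_def])
    show "positive (sets \<mu>) (\<lambda>X. \<Sum>n. emeasure (chart_vol (c n)) (X \<inter> B n))"
      by (simp add: positive_def)
    show "countably_additive (sets \<mu>) (\<lambda>X. \<Sum>n. emeasure (chart_vol (c n)) (X \<inter> B n))"
      unfolding countably_additive_def sets
    proof (intro allI impI)
      fix Y :: "nat \<Rightarrow> 'm set"
      assume Y: "range Y \<subseteq> sets borel" "disjoint_family Y" "\<Union> (range Y) \<in> sets borel"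
      \<comment> \<open>One series is written as an integral over counting measure, so that the
        order of summation can be exchanged by \<open>nn_integral_suminf\<close>.\<close>
      have "(\<Sum>i. \<Sum>n. emeasure (chart_vol (c n)) (Y i \<inter> B n)) =
          (\<Sum>i. \<integral>\<^sup>+n. emeasure (chart_vol (c n)) (Y i \<inter> B n) \<partial>count_space UNIV)"
        by (simp add: nn_integral_count_space_nat)
      also have "\<dots> = (\<integral>\<^sup>+n. (\<Sum>i. emeasure (chart_vol (c n)) (Y i \<inter> B n)) \<partial>count_space UNIV)"
        by (rule nn_integral_suminf[symmetric]) simp
      also have "\<dots> = (\<integral>\<^sup>+n. emeasure (chart_vol (c n)) (\<Union> (range Y) \<inter> B n) \<partial>count_space UNIV)"
      proof (intro nn_integral_cong)
        fix n
        have "(\<Sum>i. emeasure (chart_vol (c n)) (Y i \<inter> B n)) = emeasure (chart_vol (c n)) (\<Union>i. Y i \<inter> B n)"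
          using Y B by (intro suminf_emeasure) (auto simp: disjoint_family_on_def)
        also have "(\<Union>i. Y i \<inter> B n) = \<Union> (range Y) \<inter> B n" by blast
        finally show "(\<Sum>i. emeasure (chart_vol (c n)) (Y i \<inter> B n)) = emeasure (chart_vol (c n)) (\<Union> (range Y) \<inter> B n)" .
      qed
      finally show "(\<Sum>i. \<Sum>n. emeasure (chart_vol (c n)) (Y i \<inter> B n)) =
          (\<Sum>n. emeasure (chart_vol (c n)) (\<Union> (range Y) \<inter> B n))"
        by (simp add: nn_integral_count_space_nat)
    qed
  qed (use X sets in auto)
  have "is_riemannian_volume A g \<mu>"
    unfolding is_riemannian_volume_def
  proof (intro conjI sets ballI impI)
    fix d X assume d: "d \<in> A" and X: "X \<in> sets borel" "X \<subseteq> fst d"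
    have "emeasure \<mu> X = (\<Sum>n. emeasure (chart_vol d) (X \<inter> B n))"
      unfolding em[OF X(1)]
      by (intro suminf_cong chart_vol_transition c(1) d sets.Int X B(1)) (use X(2) B(2) in blast)
    also have "\<dots> = emeasure (chart_vol d) (\<Union>n. X \<inter> B n)"
    proof (rule suminf_emeasure)
      show "disjoint_family (\<lambda>n. X \<inter> B n)" using disj unfolding disjoint_family_on_def by blast
    qed (use X B in auto)
    also have "(\<Union>n. X \<inter> B n) = X" using BU by auto
    finally show "emeasure \<mu> X = (\<integral>\<^sup>+y\<in>snd d ` X. ennreal (sqrt (det (metric_matrix A g d (chart_inv d y)))) \<partial>lborel)"
      using X(2) by (simp add: emeasure_chart_vol[OF d X(1)] Int_absorb1)
  qed
  then show ?thesis by blast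
qed

lemma vol_is_riemannian_volume: "is_riemannian_volume A g (vol A g)"
  unfolding vol_def by (rule someI_ex[OF riemannian_volume_exists])

lemma sets_vol [simp, measurable_cong]: "sets (vol A g) = sets borel"
  using vol_is_riemannian_volume by (simp add: is_riemannian_volume_def)

lemma space_vol [simp]: "space (vol A g) = UNIV"
  using sets_eq_imp_space_eq[OF sets_vol] by simp

lemma emeasure_vol_chart:
  assumes "c \<in> A" "X \<in> sets borel"
  shows "emeasure (vol A g) (fst c \<inter> X) = emeasure (chart_vol c) X"
  using vol_is_riemannian_volume assms chart_open[OF assms(1)]
  by (simp add: is_riemannian_volume_def emeasure_chart_vol borel_open sets.Int)

lemma density_vol_chart:
  assumes "c \<in> A"
  shows "density (vol A g) (indicator (fst c)) = chart_vol c"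
proof (rule measure_eqI)
  fix X assume "X \<in> sets (density (vol A g) (indicator (fst c)))"
  then have X: "X \<in> sets borel" by simp
  have c: "fst c \<in> sets borel" using chart_open[OF assms] by (rule borel_open)
  have "(indicator (fst c) :: 'm \<Rightarrow> ennreal) \<in> borel_measurable (vol A g)"
    using c by (intro borel_measurable_indicator) simp
  then show "emeasure (density (vol A g) (indicator (fst c))) X = emeasure (chart_vol c) X"
    using emeasure_vol_chart[OF assms X] c X
    by (simp add: emeasure_density indicator_inter_arith[symmetric] sets.Int)
qed simp

lemma integral_vol_chart:
  fixes f :: "'m \<Rightarrow> real"
  assumes c: "c \<in> A" and f: "f \<in> borel_measurable borel" "\<And>x. x \<notin> fst c \<Longrightarrow> f x = 0"
  shows "(LINT x|vol A g. f x) = (LINT y|lborel. chart_density c y * f (chart_inv_total c y))"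
proof -
  have "(LINT x|vol A g. f x) = (LINT x|vol A g. indicator (fst c) x *\<^sub>R f x)"
    by (intro Bochner_Integration.integral_cong) (auto simp: indicator_def f(2))
  also have "\<dots> = integral\<^sup>L (density (vol A g) (\<lambda>x. ennreal (indicator (fst c) x))) f"
    using f borel_open[OF chart_open[OF c]] by (intro integral_density[symmetric] borel_measurable_indicator) auto
  also have "(\<lambda>x. ennreal (indicator (fst c) x)) = indicator (fst c)"
    by (auto simp: indicator_def)
  also have "integral\<^sup>L (density (vol A g) (indicator (fst c))) f = integral\<^sup>L (chart_vol c) f"
    by (simp add: density_vol_chart[OF c])
  also have "\<dots> = (LINT y|density lborel (\<lambda>y. ennreal (chart_density c y)). f (chart_inv_total c y))"
    unfolding chart_vol_def using f chart_inv_total_measurable[OF c] by (intro integral_distr) auto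
  also have "\<dots> = (LINT y|lborel. chart_density c y *\<^sub>R f (chart_inv_total c y))"
    using measurable_compose[OF chart_inv_total_measurable[OF c] f(1)] chart_density_measurable[OF c]
    by (intro integral_density) (auto simp: chart_density_nonneg[OF c])
  finally show ?thesis by simp
qed

text \<open>Around each point the density is continuous on a compact subset of a chart and hence
  bounded; finitely many such neighbourhoods cover \<open>K\<close>.\<close>

lemma emeasure_vol_compact_finite:
  assumes "compact K"
  shows "emeasure (vol A g) K < \<infinity>"
proof -
  have "\<exists>U. open U \<and> x \<in> U \<and> emeasure (vol A g) U < \<infinity>" for x
  proof -
    obtain c where c: "c \<in> A" "x \<in> fst c" by (rule chart_exists)
    obtain \<phi> :: "'m \<Rightarrow> real" and U K \<Omega> where "smooth_map_on A UNIV \<phi>" "\<And>y. 0 \<le> \<phi> y" "open U" "x \<in> U" "\<And>y. y \<in> U \<Longrightarrow> \<phi> y = 1"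
      "compact K" "U \<subseteq> K" "K \<subseteq> \<Omega>" "\<And>y. y \<notin> K \<Longrightarrow> \<phi> y = 0"
      and \<Omega>: "open \<Omega>" "connected \<Omega>" "compact (closure \<Omega>)" "closure \<Omega> \<subseteq> fst c"
      by (rule bump_exists[OF c(1) chart_open[OF c(1)] c(2) order_refl]) (rule that)
    define C where "C = snd c ` closure \<Omega>"
    have C: "compact C"
      unfolding C_def by (intro compact_continuous_image continuous_on_subset[OF chart_continuous[OF c(1)]] \<Omega>)
    have Csub: "C \<subseteq> snd c ` fst c" using \<Omega>(4) by (auto simp: C_def)
    have "continuous_on C (\<lambda>y. sqrt (det (metric_matrix A g c (chart_inv c y))))"
      by (rule continuous_on_subset[OF smooth_on_imp_continuous_on[OF smooth_chart_sqrt_det[OF c(1)]] Csub])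
    then have "bounded ((\<lambda>y. sqrt (det (metric_matrix A g c (chart_inv c y)))) ` C)"
      by (intro compact_imp_bounded compact_continuous_image C)
    then obtain M where M: "\<And>y. y \<in> C \<Longrightarrow> \<bar>sqrt (det (metric_matrix A g c (chart_inv c y)))\<bar> \<le> M"
      by (auto simp: bounded_iff)
    have "emeasure (vol A g) \<Omega> \<le> emeasure (vol A g) (fst c \<inter> closure \<Omega>)"
      using \<Omega>(4) closure_subset[of \<Omega>] c chart_open[OF c(1)] by (intro emeasure_mono) (auto intro: borel_closed borel_open sets.Int)
    also have "\<dots> = (\<integral>\<^sup>+y\<in>C. ennreal (sqrt (det (metric_matrix A g c (chart_inv c y)))) \<partial>lborel)"
      using \<Omega>(4) by (subst emeasure_vol_chart[OF c(1)]) (auto simp: emeasure_chart_vol[OF c(1)] borel_closed C_def Int_absorb1)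
    also have "\<dots> \<le> (\<integral>\<^sup>+y. ennreal M * indicator C y \<partial>lborel)"
    proof (intro nn_integral_mono)
      fix y
      show "ennreal (sqrt (det (metric_matrix A g c (chart_inv c y)))) * indicator C y \<le> ennreal M * indicator C y"
        using M[of y] by (cases "y \<in> C") (auto intro!: ennreal_leI)
    qed
    also have "\<dots> = ennreal M * emeasure lborel C"
      using C by (intro nn_integral_cmult_indicator) (auto intro: borel_compact)
    also have "\<dots> < \<infinity>"
      using emeasure_compact_finite[OF C] by (simp add: ennreal_mult_less_top)
    finally have "emeasure (vol A g) \<Omega> < \<infinity>" .
    then show ?thesis using \<Omega>(1) \<open>x \<in> U\<close> \<open>U \<subseteq> K\<close> \<open>K \<subseteq> \<Omega>\<close> by blast
  qed
  then obtain U where U: "\<And>x. open (U x)" "\<And>x. x \<in> U x" "\<And>x. emeasure (vol A g) (U x) < \<infinity>" by metis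
  have "K \<subseteq> (\<Union>x\<in>UNIV. U x)" using U(2) by blast
  then obtain I where I: "finite I" "K \<subseteq> (\<Union>x\<in>I. U x)"
    by (rule compactE_image[OF assms U(1)])
  have "emeasure (vol A g) K \<le> emeasure (vol A g) (\<Union>x\<in>I. U x)"
    using I U by (intro emeasure_mono) (auto intro: borel_open)
  also have "\<dots> \<le> (\<Sum>x\<in>I. emeasure (vol A g) (U x))"
    using I U by (intro emeasure_subadditive_finite) (auto intro: borel_open)
  also have "\<dots> < \<infinity>" using I U by (simp add: less_top)
  finally show ?thesis .
qed

text \<open>The density is positive in a chart, and a nonempty open set is not negligible. This is
  what later turns a vanishing integral into pointwise vanishing.\<close>

lemma emeasure_vol_open_pos:
  assumes "open U" "x \<in> U"
  shows "emeasure (vol A g) U \<noteq> 0"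
proof
  assume 0: "emeasure (vol A g) U = 0"
  obtain c where c: "c \<in> A" "x \<in> fst c" by (rule chart_exists)
  define V where "V = snd c ` (fst c \<inter> U)"
  have V: "open V" "snd c x \<in> V" unfolding V_def using chart_image_Int_open[OF c(1) assms(1)] c assms by auto
  have "emeasure (vol A g) (fst c \<inter> U) = 0"
    using emeasure_mono[of "fst c \<inter> U" U "vol A g"] 0 assms by (simp add: borel_open)
  then have "0 = (\<integral>\<^sup>+y\<in>V. ennreal (sqrt (det (metric_matrix A g c (chart_inv c y)))) \<partial>lborel)"
    using assms by (simp add: emeasure_vol_chart[OF c(1)] emeasure_chart_vol[OF c(1)] borel_open V_def)
  also have "\<dots> = (\<integral>\<^sup>+y. ennreal (chart_density c y) * indicator V y \<partial>lborel)"
    by (intro nn_integral_cong) (auto simp: chart_density_def indicator_def V_def)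
  finally have "(\<integral>\<^sup>+y. ennreal (chart_density c y) * indicator V y \<partial>lborel) = 0" by simp
  then have "AE y in lborel. ennreal (chart_density c y) * indicator V y = 0"
    using chart_density_measurable[OF c(1)] borel_open[OF V(1)] by (subst (asm) nn_integral_0_iff_AE) simp_all
  then have "AE y in lborel. y \<notin> V"
  proof (rule eventually_mono)
    fix y assume "ennreal (chart_density c y) * indicator V y = 0"
    then show "y \<notin> V"
      using chart_density_pos[OF c(1), of y] by (auto simp: V_def indicator_def split: if_splits)
  qed
  then have "V \<in> null_sets lborel" using V(1) by (subst (asm) AE_iff_null_sets[symmetric]) auto
  then have "negligible V" using negligible_iff_null_sets null_sets_completionI by blast
  then show False using open_not_negligible[OF V(1)] V(2) by blast
qed

end

section \<open>Compactly supported smooth functions on Euclidean space\<close>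

lemma smooth_on_zero_extension:
  assumes "open S" "closed C" "C \<subseteq> S" "smooth_on S f" "\<And>x. x \<notin> C \<Longrightarrow> f x = 0"
  shows "smooth_on UNIV f"
proof (rule smooth_on_local[OF open_UNIV])
  fix x
  show "\<exists>U. open U \<and> x \<in> U \<and> smooth_on (U \<inter> UNIV) f"
  proof (cases "x \<in> S")
    case True
    then show ?thesis using assms by auto
  next
    case False
    have "smooth_on (- C) f"
      using smooth_on_cong[of "- C" f "\<lambda>x. 0"] assms by (auto simp: open_Compl)
    then show ?thesis using False assms by (intro exI[of _ "- C"]) (auto simp: open_Compl)
  qed
qed

lemma compact_support_derivative:
  fixes f :: "'a::euclidean_space \<Rightarrow> real"
  assumes f: "smooth_on UNIV f" and K: "compact K" "\<And>x. x \<notin> K \<Longrightarrow> f x = 0"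
  shows "integrable lborel (\<lambda>x. frechet_derivative f (at x) v)"
    and "(\<integral>x. frechet_derivative f (at x) v \<partial>lborel) = 0"
    and "x \<notin> K \<Longrightarrow> frechet_derivative f (at x) v = 0"
proof -
  have cont: "continuous_on UNIV (\<lambda>x. frechet_derivative f (at x) v)"
    by (rule smooth_on_imp_continuous_on[OF smooth_on_frechet_derivative[OF f]])
  have 0: "frechet_derivative f (at x) v = 0" if "x \<notin> K" for x
  proof -
    have "frechet_derivative f (at x) = frechet_derivative (\<lambda>_. 0) (at x)"
      by (rule frechet_derivative_cong_open[of "- K"]) (use that K in \<open>auto simp: compact_imp_closed open_Compl\<close>)
    then show ?thesis by simp
  qed
  then show "x \<notin> K \<Longrightarrow> frechet_derivative f (at x) v = 0" .
  have "integrable lborel (\<lambda>x. indicator K x *\<^sub>R frechet_derivative f (at x) v)"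
    by (intro borel_integrable_compact K continuous_on_subset[OF cont]) auto
  moreover have "(\<lambda>x. indicator K x *\<^sub>R frechet_derivative f (at x) v) = (\<lambda>x. frechet_derivative f (at x) v)"
    using 0 by (auto simp: indicator_def fun_eq_iff)
  ultimately show "integrable lborel (\<lambda>x. frechet_derivative f (at x) v)" by simp
  show "(\<integral>x. frechet_derivative f (at x) v \<partial>lborel) = 0"
    by (rule integral_directional_derivative_eq_0[OF smooth_on_has_derivative[OF f] cont K]) auto
qed

context riemannian_manifold
begin

section \<open>Integrals over relatively compact domains\<close>

lemma set_integrable_bounded:
  fixes f :: "'m \<Rightarrow> real"
  assumes f: "f \<in> borel_measurable borel" and "compact C" "\<Omega> \<in> sets borel" "\<Omega> \<subseteq> C" "\<And>x. x \<in> \<Omega> \<Longrightarrow> \<bar>f x\<bar> \<le> B"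
  shows "set_integrable (vol A g) \<Omega> f"
  unfolding set_integrable_def
proof (rule integrableI_bounded_set[where A=\<Omega> and B=B])
  show "\<Omega> \<in> sets (vol A g)" using assms by simp
  show "(\<lambda>x. indicator \<Omega> x *\<^sub>R f x) \<in> borel_measurable (vol A g)"
    using f assms(3) by (simp add: measurable_cong_sets[OF sets_vol refl])
  have "emeasure (vol A g) \<Omega> \<le> emeasure (vol A g) C"
    using assms by (intro emeasure_mono) (auto intro: borel_compact)
  then show "emeasure (vol A g) \<Omega> < \<infinity>"
    using emeasure_vol_compact_finite[OF \<open>compact C\<close>] by (rule le_less_trans)
qed (use assms(5) in auto)

lemma compact_continuous_bound:
  fixes f :: "'a::topological_space \<Rightarrow> real"
  assumes "compact C" "continuous_on C f"
  obtains B where "\<And>x. x \<in> C \<Longrightarrow> \<bar>f x\<bar> \<le> B"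
proof -
  have "bounded (f ` C)" using assms by (intro compact_imp_bounded compact_continuous_image)
  then show thesis using that by (auto simp: bounded_iff)
qed

text \<open>Differentiation under the integral sign. Joint continuity bounds \<open>f'\<close> on
  the compact set of all (t, x) with |t| \<le> \<delta> and x in the closure of \<Omega>; the mean
  value inequality makes this a constant bound for the difference quotients, and \<Omega> has finite
  volume.\<close>

lemma has_derivative_set_integral:
  fixes f f' :: "real \<Rightarrow> 'm \<Rightarrow> real"
  assumes \<Omega>: "open \<Omega>" "compact (closure \<Omega>)" and \<delta>: "\<delta> > 0"
    and cont: "\<And>t. continuous_on UNIV (f t)"
    and f': "\<And>t x. ((\<lambda>t. f t x) has_real_derivative f' t x) (at t)"
    and cont': "continuous_on ({-\<delta>..\<delta>} \<times> closure \<Omega>) (\<lambda>(t, x). f' t x)" "continuous_on UNIV (f' 0)"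
  shows "((\<lambda>t. LINT x:\<Omega>|vol A g. f t x) has_real_derivative (LINT x:\<Omega>|vol A g. f' 0 x)) (at 0)"
proof -
  have bor: "\<Omega> \<in> sets borel" using \<Omega>(1) by (rule borel_open)
  have fmeas: "f t \<in> borel_measurable borel" "f' 0 \<in> borel_measurable borel" for t
    using borel_measurable_continuous_onI cont cont'(2) by blast+
  obtain B where B: "\<And>z. z \<in> {-\<delta>..\<delta>} \<times> closure \<Omega> \<Longrightarrow> \<bar>(\<lambda>(t, x). f' t x) z\<bar> \<le> B"
    by (rule compact_continuous_bound[OF compact_Times[OF compact_Icc \<Omega>(2)] cont'(1)]) (rule that)
  then have B: "\<bar>f' t x\<bar> \<le> B" if "t \<in> {-\<delta>..\<delta>}" "x \<in> \<Omega>" for t x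
    using that closure_subset[of \<Omega>] B[of "(t, x)"] by auto
  have int: "set_integrable (vol A g) \<Omega> (f t)" for t
  proof -
    obtain M where "\<And>x. x \<in> closure \<Omega> \<Longrightarrow> \<bar>f t x\<bar> \<le> M"
      by (rule compact_continuous_bound[OF \<Omega>(2) continuous_on_subset[OF cont subset_UNIV]]) (rule that)
    then show ?thesis
      using closure_subset[of \<Omega>] by (intro set_integrable_bounded[OF fmeas(1) \<Omega>(2) bor]) auto
  qed
  have bound: "\<bar>(f t x - f 0 x) / t\<bar> \<le> B" if t: "t \<noteq> 0" "\<bar>t\<bar> \<le> \<delta>" and x: "x \<in> \<Omega>" for t x
  proof -
    have "norm (f t x - f 0 x) \<le> B * norm (t - 0)"
    proof (rule field_differentiable_bound[of "{-\<delta>..\<delta>}" "\<lambda>t. f t x" "\<lambda>t. f' t x"])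
      show "((\<lambda>t. f t x) has_field_derivative f' s x) (at s within {- \<delta>..\<delta>})" for s
        by (rule has_field_derivative_at_within[OF f'])
      show "norm (f' s x) \<le> B" if "s \<in> {-\<delta>..\<delta>}" for s using B[OF that x] by simp
    qed (use t \<delta> in auto)
    then show ?thesis using t by (simp add: field_simps abs_mult)
  qed
  have "((\<lambda>t. ((LINT x:\<Omega>|vol A g. f t x) - (LINT x:\<Omega>|vol A g. f 0 x)) / (t - 0)) \<longlongrightarrow> (LINT x:\<Omega>|vol A g. f' 0 x)) (at 0)"
    unfolding tendsto_at_iff_sequentially comp_def
  proof (intro allI impI)
    fix X :: "nat \<Rightarrow> real"
    assume X: "\<forall>i. X i \<in> UNIV - {0}" "X \<longlonglongrightarrow> 0"
    then have "\<forall>\<^sub>F i in sequentially. dist (X i) 0 < \<delta>" using \<delta> by (intro tendstoD)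
    then obtain N where N: "\<And>i. \<bar>X (i + N)\<bar> \<le> \<delta>"
      unfolding eventually_sequentially by (auto simp: dist_real_def) (metis le_add2 less_imp_le)
    \<comment> \<open>The bound on the quotients holds for |t| \<le> \<delta> only, so a tail of the
      sequence is considered; \<open>LIMSEQ_offset\<close> undoes the shift.\<close>
    define Y where "Y i = X (i + N)" for i
    have Y: "Y i \<noteq> 0" "\<bar>Y i\<bar> \<le> \<delta>" for i using X(1) N by (auto simp: Y_def)
    have Y0: "Y \<longlonglongrightarrow> 0" unfolding Y_def by (rule LIMSEQ_ignore_initial_segment[OF X(2)])
    have "(\<lambda>i. LINT x:\<Omega>|vol A g. (f (Y i) x - f 0 x) / Y i) \<longlonglongrightarrow> (LINT x:\<Omega>|vol A g. f' 0 x)"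
      unfolding set_lebesgue_integral_def
    proof (rule integral_dominated_convergence[where w="\<lambda>x. indicator \<Omega> x *\<^sub>R B"])
      show "(\<lambda>x. indicator \<Omega> x *\<^sub>R f' 0 x) \<in> borel_measurable (vol A g)"
        using fmeas bor by (simp add: measurable_cong_sets[OF sets_vol refl])
      show "(\<lambda>x. indicator \<Omega> x *\<^sub>R ((f (Y i) x - f 0 x) / Y i)) \<in> borel_measurable (vol A g)" for i
        using fmeas bor by (simp add: measurable_cong_sets[OF sets_vol refl])
      show "integrable (vol A g) (\<lambda>x. indicator \<Omega> x *\<^sub>R B)"
        using set_integrable_bounded[of "\<lambda>x. B", OF _ \<Omega>(2) bor closure_subset, of "\<bar>B\<bar>"]
        by (simp add: set_integrable_def)
      show "AE x in vol A g. (\<lambda>i. indicator \<Omega> x *\<^sub>R ((f (Y i) x - f 0 x) / Y i)) \<longlonglongrightarrow> indicator \<Omega> x *\<^sub>R f' 0 x"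
      proof (rule AE_I2)
        fix x
        have "((\<lambda>t. f t x) has_real_derivative f' 0 x) (at 0)" by (rule f')
        then have "((\<lambda>t. (f t x - f 0 x) / t) \<longlongrightarrow> f' 0 x) (at 0)"
          by (simp add: DERIV_def)
        then have "(\<lambda>i. (f (Y i) x - f 0 x) / Y i) \<longlonglongrightarrow> f' 0 x"
          using Y0 Y(1) by (auto simp: tendsto_at_iff_sequentially comp_def)
        then show "(\<lambda>i. indicator \<Omega> x *\<^sub>R ((f (Y i) x - f 0 x) / Y i)) \<longlonglongrightarrow> indicator \<Omega> x *\<^sub>R f' 0 x"
          by (intro tendsto_intros)
      qed
      show "AE x in vol A g. norm (indicator \<Omega> x *\<^sub>R ((f (Y i) x - f 0 x) / Y i)) \<le> indicator \<Omega> x *\<^sub>R B" for i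
        using bound[OF Y] by (intro AE_I2) (auto simp: indicator_def)
    qed
    moreover have "(LINT x:\<Omega>|vol A g. (f (Y i) x - f 0 x) / Y i) =
        ((LINT x:\<Omega>|vol A g. f (Y i) x) - (LINT x:\<Omega>|vol A g. f 0 x)) / (Y i - 0)" for i
      using int by (simp add: set_integral_diff)
    ultimately have "(\<lambda>i. ((LINT x:\<Omega>|vol A g. f (X (i + N)) x) - (LINT x:\<Omega>|vol A g. f 0 x)) / (X (i + N) - 0))
        \<longlonglongrightarrow> (LINT x:\<Omega>|vol A g. f' 0 x)"
      by (simp only: Y_def)
    then show "(\<lambda>i. ((LINT x:\<Omega>|vol A g. f (X i) x) - (LINT x:\<Omega>|vol A g. f 0 x)) / (X i - 0))
        \<longlonglongrightarrow> (LINT x:\<Omega>|vol A g. f' 0 x)"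
      by (rule LIMSEQ_offset)
  qed
  then show ?thesis by (simp add: has_field_derivative_iff)
qed

text \<open>By continuity the set where \<open>f\<close> is positive is open, and a nonempty open
  set has positive volume.\<close>

lemma set_integral_nonneg_eq_0:
  fixes f :: "'m \<Rightarrow> real"
  assumes \<Omega>: "open \<Omega>" "compact (closure \<Omega>)" and f: "continuous_on UNIV f" "\<And>x. 0 \<le> f x"
    and 0: "(LINT x:\<Omega>|vol A g. f x) = 0" and x: "x \<in> \<Omega>"
  shows "f x = 0"
proof (rule ccontr)
  assume "f x \<noteq> 0"
  have fm: "f \<in> borel_measurable borel" using f(1) by (rule borel_measurable_continuous_onI)
  have bor: "\<Omega> \<in> sets borel" using \<Omega>(1) by (rule borel_open)
  obtain M where M: "\<And>x. x \<in> closure \<Omega> \<Longrightarrow> \<bar>f x\<bar> \<le> M"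
    by (rule compact_continuous_bound[OF \<Omega>(2) continuous_on_subset[OF f(1) subset_UNIV]]) (rule that)
  have "set_integrable (vol A g) \<Omega> f"
    using closure_subset[of \<Omega>] M by (intro set_integrable_bounded[OF fm \<Omega>(2) bor]) auto
  then have ae: "AE x in vol A g. indicator \<Omega> x *\<^sub>R f x = 0"
    using 0 f(2) integral_nonneg_eq_0_iff_AE[of "vol A g" "\<lambda>x. indicator \<Omega> x *\<^sub>R f x"]
    by (auto simp: set_integrable_def set_lebesgue_integral_def)
  define U where "U = \<Omega> \<inter> {x. f x > 0}"
  have U: "open U" unfolding U_def
    by (intro open_Int \<Omega> open_Collect_less continuous_on_const f)
  have xU: "x \<in> U" using x f(2)[of x] \<open>f x \<noteq> 0\<close> by (simp add: U_def)
  have "AE x in vol A g. x \<notin> U"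
    using ae by (rule eventually_mono) (auto simp: U_def indicator_def split: if_splits)
  then have "emeasure (vol A g) U = 0"
    using U by (intro AE_iff_measurable[THEN iffD1, of U "vol A g" "\<lambda>x. x \<notin> U"]) (auto simp: borel_open)
  then show False using emeasure_vol_open_pos[OF U xU] by simp
qed

section \<open>The weak form of harmonicity\<close>

lemma cometric_eq_0:
  assumes "open W" "x \<in> W" "\<And>y. y \<in> W \<Longrightarrow> f y = 0"
  shows "cometric f k x = 0"
proof -
  have "differential A f x v = 0" for v
    using differential_cong[OF assms(1,2), of f "\<lambda>_. 0"] assms(3) by (simp add: differential_const)
  then show ?thesis by (simp add: cometric_def metric_trace_def)
qed

text \<open>In coordinates let u = \<psi> and X = sqrt (det G) grad N. The product rule gives sqrt
  (det G) \<langle>d\<psi>, dN\<rangle> = div (u X) - u div X. Harmonicity of N means div X = 0, and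
  div (u X) has integral 0 because u X has compact support in the chart range.\<close>

lemma harmonic_weak:
  assumes N: "harmonic_function A g N" and c: "c \<in> A" and \<psi>: "smooth_map_on A UNIV \<psi>"
    and K: "compact K" "K \<subseteq> fst c" "\<And>x. x \<notin> K \<Longrightarrow> \<psi> x = 0"
  shows "(LINT x|vol A g. cometric \<psi> N x) = 0"
proof -
  have Ns: "smooth_map_on A UNIV N" using N by (simp add: harmonic_function_def)
  note linN = linear_differential[OF Ns UNIV_I]
  define S where "S = snd c ` fst c"
  have S: "open S" unfolding S_def by (rule chart_range_open[OF c])
  define C where "C = snd c ` K"
  have C: "compact C" "C \<subseteq> S"
    unfolding C_def S_def using K by (auto intro: compact_continuous_image continuous_on_subset[OF chart_continuous[OF c]])
  define X where "X a y = sqrt (det (metric_matrix A g c (chart_inv c y))) *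
      components A c (chart_inv c y) (gradient A g N (chart_inv c y)) $ a" for a y
  define u where "u y = \<psi> (chart_inv_total c y)" for y
  have inv: "chart_inv_total c y = chart_inv c y" if "y \<in> S" for y
    using that by (simp add: chart_inv_total_def S_def)
  have us: "smooth_on S u"
    using smooth_map_onD[OF smooth_map_on_subset[OF \<psi> subset_UNIV[of "fst c"]] c]
    by (subst smooth_on_cong[OF S, of u "\<psi> \<circ> chart_inv c"]) (auto simp: u_def inv S_def)
  have u0: "u y = 0" if "y \<in> S" "y \<notin> C" for y
  proof -
    have "snd c (chart_inv c y) = y" using that(1) by (simp add: S_def chart_inv_right[OF c])
    then have "chart_inv c y \<notin> K" using that(2) unfolding C_def by (metis imageI)
    then show ?thesis using K(3) by (simp add: u_def inv[OF that(1)])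
  qed
  have comp: "components A c x (gradient A g N x) $ a = (\<Sum>b\<in>UNIV. matrix_inv (metric_matrix A g c x) $ a $ b *
      chart_derivative c N x (axis b 1))" if "x \<in> fst c" for x a
    using components_gradient[OF c that linN] differential_coord_vector[OF c that Ns UNIV_I] by simp
  have Xs: "smooth_on S (X a)" for a
  proof -
    have "smooth_map_on A (fst c) (\<lambda>x. sqrt (det (metric_matrix A g c x)) * (\<Sum>b\<in>UNIV. matrix_inv (metric_matrix A g c x) $ a $ b *
      chart_derivative c N x (axis b 1)))"
      using smooth_map_on_chart_derivative[OF c open_UNIV Ns]
      by (intro smooth_map_on_mult smooth_map_on_sum chart_open c smooth_sqrt_det_metric_matrix smooth_matrix_inv_metric_matrix) simp
    from smooth_map_onD[OF this c] show ?thesis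
      by (subst smooth_on_cong[OF S, of "X a"]) (auto simp: X_def S_def comp chart_inv_mem[OF c])
  qed
  have divX: "(\<Sum>a\<in>UNIV. frechet_derivative (X a) (at y) (axis a 1)) = 0" if "y \<in> S" for y
  proof -
    obtain x where x: "x \<in> fst c" "y = snd c x" using \<open>y \<in> S\<close> by (auto simp: S_def)
    then have "laplacian_in A g c N x = 0" using N c by (simp add: harmonic_function_def)
    moreover have "(\<lambda>z. sqrt (det (metric_matrix A g c z)) * components A c z (gradient A g N z) $ i) \<circ> chart_inv c = X i" for i
      by (simp add: X_def fun_eq_iff)
    ultimately show ?thesis
      using metric_matrix_det_pos[OF c x(1)] by (simp add: laplacian_in_def divergence_in_def x(2))
  qed
  \<comment> \<open>The extension by 0 is smooth on all of \<open>real ^ 'n\<close> because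
    \<open>u\<close> vanishes on \<open>S\<close> outside the compact set \<open>C\<close>, and
    \<open>C\<close> lies in the open range \<open>S\<close>.\<close>
  define f where "f a y = (if y \<in> S then u y * X a y else 0)" for a y
  have f0: "f a y = 0" if "y \<notin> C" for a y using u0[of y] that by (simp add: f_def)
  have fS: "smooth_on S (f a)" for a
    by (subst smooth_on_cong[OF S, of _ "\<lambda>y. u y * X a y"]) (auto simp: f_def intro!: smooth_on_mult S us Xs)
  have fs: "smooth_on UNIV (f a)" for a
    by (rule smooth_on_zero_extension[OF S compact_imp_closed[OF C(1)] C(2) fS f0])
  have cont: "continuous_on UNIV (cometric \<psi> N)"
    by (intro smooth_map_on_imp_continuous_on smooth_cometric open_UNIV \<psi> Ns)
  have clK: "open (- K)" using K(1) compact_imp_closed by blast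
  have 0: "cometric \<psi> N x = 0" if "x \<notin> K" for x
    by (rule cometric_eq_0[OF clK]) (use that K(3) in auto)
  have "(LINT x|vol A g. cometric \<psi> N x) = (LINT y|lborel. chart_density c y * cometric \<psi> N (chart_inv_total c y))"
    by (rule integral_vol_chart[OF c borel_measurable_continuous_onI[OF cont]]) (use 0 K(2) in blast)
  also have "\<dots> = (LINT y|lborel. (\<Sum>a\<in>UNIV. frechet_derivative (f a) (at y) (axis a 1)))"
  proof (intro Bochner_Integration.integral_cong refl)
    fix y
    show "chart_density c y * cometric \<psi> N (chart_inv_total c y) = (\<Sum>a\<in>UNIV. frechet_derivative (f a) (at y) (axis a 1))"
    proof (cases "y \<in> S")
      case True
      then obtain x where x: "x \<in> fst c" "y = snd c x" by (auto simp: S_def)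
      have xy: "chart_inv c y = x" using chart_inv_left[OF c x(1)] x(2) by simp
      have uder: "chart_derivative c \<psi> x \<xi> = frechet_derivative u (at y) \<xi>" for \<xi>
        unfolding x(2)[symmetric]
        by (rule fun_cong[OF frechet_derivative_cong_open[OF S True]]) (simp add: u_def inv)
      have "frechet_derivative (f a) (at y) \<xi> = u y * frechet_derivative (X a) (at y) \<xi> + frechet_derivative u (at y) \<xi> * X a y" for a \<xi>
      proof -
        have "frechet_derivative (f a) (at y) = frechet_derivative (\<lambda>y. u y * X a y) (at y)"
          by (rule frechet_derivative_cong_open[OF S True]) (simp add: f_def)
        also have "\<dots> = (\<lambda>\<xi>. u y * frechet_derivative (X a) (at y) \<xi> + frechet_derivative u (at y) \<xi> * X a y)"
          by (rule frechet_derivative_at[symmetric])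
            (rule has_derivative_mult[OF smooth_on_has_derivative[OF us True] smooth_on_has_derivative[OF Xs True]])
        finally show ?thesis by simp
      qed
      then have "(\<Sum>a\<in>UNIV. frechet_derivative (f a) (at y) (axis a 1)) =
          u y * (\<Sum>a\<in>UNIV. frechet_derivative (X a) (at y) (axis a 1)) + (\<Sum>a\<in>UNIV. frechet_derivative u (at y) (axis a 1) * X a y)"
        by (simp add: sum.distrib sum_distrib_left)
      also have "\<dots> = (\<Sum>a\<in>UNIV. frechet_derivative u (at y) (axis a 1) * X a y)"
        by (simp add: divX[OF True])
      also have "\<dots> = sqrt (det (metric_matrix A g c x)) * (\<Sum>a\<in>UNIV. \<Sum>b\<in>UNIV. matrix_inv (metric_matrix A g c x) $ a $ b *
        (chart_derivative c \<psi> x (axis a 1) * chart_derivative c N x (axis b 1)))"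
        by (simp add: X_def xy comp[OF x(1)] uder sum_distrib_left sum_distrib_right mult_ac)
      also have "\<dots> = sqrt (det (metric_matrix A g c x)) * cometric \<psi> N x"
        by (simp add: cometric_coord[OF c x(1) \<psi> Ns UNIV_I])
      finally show ?thesis
        using True by (simp add: chart_density_def inv xy S_def)
    next
      case False
      then have "y \<notin> C" using C(2) by blast
      then have "frechet_derivative (f a) (at y) \<xi> = 0" for a \<xi>
        by (intro compact_support_derivative(3)[OF fs C(1)] f0)
      then show ?thesis using False by (simp add: chart_density_def S_def)
    qed
  qed
  also have "\<dots> = 0"
    by (simp add: Bochner_Integration.integral_sum compact_support_derivative(1,2)[OF fs C(1) f0])
  finally show ?thesis .
qed

end

section \<open>Radial variations\<close>

text \<open>\<open>radial_density\<close> is the energy density of the section \<open>(1 + t f) \<sigma>\<close>, where \<open>N\<close> and \<open>S\<close>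
  stand for \<open>|\<sigma>|\<^sup>2\<close> and \<open>|\<nabla>\<sigma>|\<^sup>2\<close>, and where \<open>P\<close>, \<open>R\<close> and \<open>Q\<close> stand for the products
  \<open>\<langle>\<nabla>f, \<nabla>f\<rangle>\<close>, \<open>\<langle>\<nabla>f, \<nabla>N\<rangle>\<close> and \<open>\<langle>\<nabla>N, \<nabla>N\<rangle>\<close>.\<close>

definition radial_density :: "real \<Rightarrow> real \<Rightarrow> real \<Rightarrow> real \<Rightarrow> real \<Rightarrow> real \<Rightarrow> real \<Rightarrow> real \<Rightarrow> real \<Rightarrow> real" where
  "radial_density p q f N S P R Q t =
     (1 + (1 + t * f)\<^sup>2 * N) powr (- p) *
     ((1 + t * f)\<^sup>2 * S + (1 + t * f) * t * R + t\<^sup>2 * N * P +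
      q / 4 * ((2 * (1 + t * f) * t * N)\<^sup>2 * P + 2 * (2 * (1 + t * f) * t * N) * (1 + t * f)\<^sup>2 * R + ((1 + t * f)\<^sup>2)\<^sup>2 * Q))"

text \<open>The derivative in t, in closed form because the domination argument requires continuity
  jointly in t and in the point.\<close>

definition radial_density' :: "real \<Rightarrow> real \<Rightarrow> real \<Rightarrow> real \<Rightarrow> real \<Rightarrow> real \<Rightarrow> real \<Rightarrow> real \<Rightarrow> real \<Rightarrow> real" where
  "radial_density' p q f N S P R Q t =
     - p * (1 + (1 + t * f)\<^sup>2 * N) powr (- p - 1) * (2 * (1 + t * f) * f * N) *
     ((1 + t * f)\<^sup>2 * S + (1 + t * f) * t * R + t\<^sup>2 * N * P +
      q / 4 * ((2 * (1 + t * f) * t * N)\<^sup>2 * P + 2 * (2 * (1 + t * f) * t * N) * (1 + t * f)\<^sup>2 * R + ((1 + t * f)\<^sup>2)\<^sup>2 * Q)) +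
     (1 + (1 + t * f)\<^sup>2 * N) powr (- p) *
     (2 * (1 + t * f) * f * S + (f * t + (1 + t * f)) * R + 2 * t * N * P +
      q / 4 * (2 * (2 * (1 + t * f) * t * N) * (2 * N * (f * t + (1 + t * f))) * P +
        (4 * N * (f * t + (1 + t * f)) * (1 + t * f)\<^sup>2 + 4 * ((1 + t * f) * t * N) * (2 * (1 + t * f) * f)) * R +
        4 * (1 + t * f) ^ 3 * f * Q))"

lemma radial_density_derivative:
  assumes "N \<ge> 0"
  shows "(radial_density p q f N S P R Q has_real_derivative radial_density' p q f N S P R Q t) (at t)"
proof -
  have pos: "1 + (1 + t * f)\<^sup>2 * N > 0" using assms by (smt (verit) mult_nonneg_nonneg zero_le_power2)
  have "((\<lambda>t. 1 + (1 + t * f)\<^sup>2 * N) has_real_derivative 2 * (1 + t * f) * f * N) (at t)"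
    by (auto intro!: derivative_eq_intros)
  from DERIV_fun_powr[OF this pos, of "- p"]
  have w: "((\<lambda>t. (1 + (1 + t * f)\<^sup>2 * N) powr (- p)) has_real_derivative
      - p * (1 + (1 + t * f)\<^sup>2 * N) powr (- p - 1) * (2 * (1 + t * f) * f * N)) (at t)" by simp
  have H: "((\<lambda>t. (1 + t * f)\<^sup>2 * S + (1 + t * f) * t * R + t\<^sup>2 * N * P +
      q / 4 * ((2 * (1 + t * f) * t * N)\<^sup>2 * P + 2 * (2 * (1 + t * f) * t * N) * (1 + t * f)\<^sup>2 * R + ((1 + t * f)\<^sup>2)\<^sup>2 * Q))
     has_real_derivative
     (2 * (1 + t * f) * f * S + (f * t + (1 + t * f)) * R + 2 * t * N * P +
      q / 4 * (2 * (2 * (1 + t * f) * t * N) * (2 * N * (f * t + (1 + t * f))) * P +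
        (4 * N * (f * t + (1 + t * f)) * (1 + t * f)\<^sup>2 + 4 * ((1 + t * f) * t * N) * (2 * (1 + t * f) * f)) * R +
        4 * (1 + t * f) ^ 3 * f * Q))) (at t)"
    by (rule derivative_eq_intros refl | simp)+ (simp add: algebra_simps power2_eq_square power3_eq_cube)
  show ?thesis
    unfolding radial_density_def[abs_def] radial_density'_def
    using DERIV_mult[OF w H] by (simp add: mult_ac)
qed

text \<open>The coefficient of \<open>f\<close> that is left in the first variation after the integration by parts
  against \<open>\<psi> = f (1 + N)\<^sup>-\<^sup>p (1 + q N)\<close>, whose gradient enters below through \<open>\<langle>\<nabla>\<psi>, \<nabla>N\<rangle>\<close>.\<close>

lemma radial_density'_at_0:
  assumes "N \<ge> 0"
  shows "radial_density' p q f N S P R Q 0 =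
    ((1 + N) powr (- p) * (1 + q * N) * R +
      f * (- p * (1 + N) powr (- p - 1) * (1 + q * N) + (1 + N) powr (- p) * q) * Q) +
    f * ((1 + N) powr (- p - 1) * (2 * S * (1 + (1 - p) * N) + p / 2 * Q * (2 + q * N)))"
proof -
  have "(1 + N) powr (- p) = (1 + N) powr (- p - 1) * (1 + N)"
    using assms by (simp add: powr_diff)
  then show ?thesis
    unfolding radial_density'_def by (simp add: algebra_simps add_divide_distrib)
qed

lemma continuous_on_radial_density [continuous_intros]:
  fixes f N S P R Q t :: "'a::topological_space \<Rightarrow> real"
  assumes "continuous_on X f" "continuous_on X N" "continuous_on X S" "continuous_on X P" "continuous_on X R"
    "continuous_on X Q" "continuous_on X t" and "\<And>x. N x \<ge> 0"
  shows "continuous_on X (\<lambda>x. radial_density p q (f x) (N x) (S x) (P x) (R x) (Q x) (t x))"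
    and "continuous_on X (\<lambda>x. radial_density' p q (f x) (N x) (S x) (P x) (R x) (Q x) (t x))"
proof -
  have "1 + (1 + t x * f x)\<^sup>2 * N x \<noteq> 0" for x
    using assms(8)[of x] by (smt (verit) mult_nonneg_nonneg zero_le_power2)
  then show "continuous_on X (\<lambda>x. radial_density p q (f x) (N x) (S x) (P x) (R x) (Q x) (t x))"
    and "continuous_on X (\<lambda>x. radial_density' p q (f x) (N x) (S x) (P x) (R x) (Q x) (t x))"
    unfolding radial_density_def radial_density'_def by (intro continuous_intros assms; simp)+
qed

context riemannian_manifold
begin

lemma cometric_combination:
  assumes "\<And>v. differential A k x v = a * differential A f x v + b * differential A N x v"
  shows "cometric k k x = a\<^sup>2 * cometric f f x + 2 * a * b * cometric f N x + b\<^sup>2 * cometric N N x"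
proof -
  have "cometric k k x = metric_trace (g x) (\<lambda>v w. (a\<^sup>2 * (differential A f x v * differential A f x w) +
      2 * a * b * (differential A f x v * differential A N x w)) + b\<^sup>2 * (differential A N x v * differential A N x w))"
    unfolding cometric_def
    by (rule metric_trace_cong) (simp add: assms power2_eq_square algebra_simps)
  then show ?thesis
    by (simp only: metric_trace_add metric_trace_scale cometric_def)
qed

end

context riemannian_vector_bundle
begin

lemma fibre_square:
  assumes "u \<in> E x" "v \<in> E x"
  shows "h x (a *\<^sub>R u + b *\<^sub>R v) (a *\<^sub>R u + b *\<^sub>R v) = a\<^sup>2 * h x u u + 2 * a * b * h x u v + b\<^sup>2 * h x v v"
proof -
  have mem: "r *\<^sub>R u \<in> E x" "r *\<^sub>R v \<in> E x" "a *\<^sub>R u + b *\<^sub>R v \<in> E x" for r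
    using assms subspace_scale[OF subspace_fibre] subspace_add[OF subspace_fibre] by auto
  show ?thesis
    using assms mem
    by (simp add: fibre_add_left[OF mem(1,2)] fibre_add_right[OF mem(1,2)] fibre_scale_left fibre_scale_right
        fibre_sym[OF assms(2,1)] power2_eq_square algebra_simps)
qed

text \<open>The energy is formulated with F, the harmonicity hypothesis with twice this function;
  the factor 1/4 is the square of the 1/2 in F.\<close>

lemma gradient_half_norm_sq:
  assumes "smooth_section A E T \<tau>"
  shows "(let w = gradient A g (\<lambda>y. 1 / 2 * norm_sq h \<tau> y) x in g x w w) =
    1 / 4 * cometric (norm_sq h \<tau>) (norm_sq h \<tau>) x"
proof -
  note sm = smooth_norm_sq[OF assms]
  have d: "differential A (\<lambda>y. 1 / 2 * norm_sq h \<tau> y) x v = 1 / 2 * differential A (norm_sq h \<tau>) x v" for v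
    by (rule differential_compose[OF sm UNIV_I]) (auto intro!: derivative_eq_intros)
  have "smooth_map_on A UNIV (\<lambda>y. 1 / 2 * norm_sq h \<tau> y)"
    by (intro smooth_map_on_mult sm open_UNIV smooth_map_on_const)
  note lin = linear_differential[OF this UNIV_I]
  have "(let w = gradient A g (\<lambda>y. 1 / 2 * norm_sq h \<tau> y) x in g x w w) =
      metric_trace (g x) (\<lambda>v w. 1 / 4 * (differential A (norm_sq h \<tau>) x v * differential A (norm_sq h \<tau>) x w))"
    unfolding Let_def gradient_norm_sq[OF lin]
  proof (rule metric_trace_cong)
    fix v
    have "1 / 2 * r * (1 / 2 * r) = 1 / 4 * (r * r)" for r :: real by simp
    then show "differential A (\<lambda>y. 1 / 2 * norm_sq h \<tau> y) x v * differential A (\<lambda>y. 1 / 2 * norm_sq h \<tau> y) x v =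
        1 / 4 * (differential A (norm_sq h \<tau>) x v * differential A (norm_sq h \<tau>) x v)"
      unfolding d .
  qed
  then show ?thesis by (simp only: metric_trace_scale cometric_def)
qed

lemma smooth_radial_section:
  assumes "smooth_map_on A UNIV \<phi>" "smooth_section A E T \<sigma>"
  shows "smooth_section A E T (\<lambda>x. (1 + t * \<phi> x) *\<^sub>R \<sigma> x)"
  by (intro smooth_section_scale smooth_map_on_add smooth_map_on_mult open_UNIV smooth_map_on_const assms)

lemma radial_smooth_variation:
  assumes \<phi>: "smooth_map_on A UNIV \<phi>" and \<sigma>: "smooth_section A E T \<sigma>"
  shows "smooth_variation A E T \<epsilon> \<sigma> (\<lambda>t x. (1 + t * \<phi> x) *\<^sub>R \<sigma> x)"
  unfolding smooth_variation_def
proof (intro conjI ballI allI)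
  show "(1 + t * \<phi> x) *\<^sub>R \<sigma> x \<in> E x" for t x
    by (intro subspace_scale[OF subspace_fibre] smooth_section_fibre[OF \<sigma>])
  fix c b assume c: "c \<in> A" and "b \<in> T"
  obtain V \<Psi> where b: "b = (V, \<Psi>)" by fastforce
  with \<open>b \<in> T\<close> have V: "(V, \<Psi>) \<in> T" by simp
  define Y where "Y = snd c ` (fst c \<inter> V)"
  define I where "I = {-\<epsilon><..<\<epsilon>}"
  have Y: "open Y" unfolding Y_def by (rule chart_image_Int_open[OF c triv_open[OF V]])
  have IY: "open (I \<times> Y)" using Y by (simp add: I_def open_Times)
  have sm: "smooth_on (I \<times> Y) (\<lambda>z. k (snd z))" if "smooth_on Y k" for k :: "real ^ 'n \<Rightarrow> 'z::euclidean_space"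
    by (rule smooth_on_compose[OF IY Y _ that smooth_on_bounded_linear[OF bounded_linear_snd]]) auto
  have "smooth_on Y (\<lambda>y. \<phi> (chart_inv c y))"
    using smooth_map_onD[OF smooth_map_on_subset[OF \<phi> subset_UNIV[of V]] c] by (simp add: Y_def o_def)
  moreover have "smooth_on Y (\<lambda>y. inv (\<Psi> (chart_inv c y)) (\<sigma> (chart_inv c y)))"
    using smooth_map_onD[OF smooth_sectionD[OF \<sigma> V] c] by (simp add: Y_def o_def)
  ultimately have "smooth_on (I \<times> Y) (\<lambda>z. (1 + fst z * \<phi> (chart_inv c (snd z))) *\<^sub>R
      inv (\<Psi> (chart_inv c (snd z))) (\<sigma> (chart_inv c (snd z))))"
    by (intro smooth_on_scaleR smooth_on_add smooth_on_mult smooth_on_const IY sm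
        smooth_on_bounded_linear[OF bounded_linear_fst])
  then have "smooth_on (I \<times> Y) (\<lambda>(t, y). inv (\<Psi> (chart_inv c y)) ((1 + t * \<phi> (chart_inv c y)) *\<^sub>R \<sigma> (chart_inv c y)))"
  proof (rule smooth_on_cong[OF IY, THEN iffD1, rotated])
    fix z assume "z \<in> I \<times> Y"
    then have "chart_inv c (snd z) \<in> V" using chart_inv_left[OF c] by (auto simp: Y_def)
    then show "(1 + fst z * \<phi> (chart_inv c (snd z))) *\<^sub>R inv (\<Psi> (chart_inv c (snd z))) (\<sigma> (chart_inv c (snd z))) =
        (case z of (t, y) \<Rightarrow> inv (\<Psi> (chart_inv c y)) ((1 + t * \<phi> (chart_inv c y)) *\<^sub>R \<sigma> (chart_inv c y)))"
      using linear_inv_triv(2)[OF V _ smooth_section_fibre[OF \<sigma>]] by (simp add: split_def)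
  qed
  then show "case b of (V, \<Psi>) \<Rightarrow> smooth_on ({-\<epsilon><..<\<epsilon>} \<times> snd c ` (fst c \<inter> V))
      (\<lambda>(t, y). inv (\<Psi> (chart_inv c y)) ((1 + t * \<phi> (chart_inv c y)) *\<^sub>R \<sigma> (chart_inv c y)))"
    by (simp add: b I_def Y_def)
qed simp

text \<open>Put a = 1 + t \<phi>. The Leibniz rule gives \<nabla>(a \<sigma>) = t d\<phi> \<otimes>
  \<sigma> + a \<nabla>\<sigma>, and metric compatibility, 2 \<langle>\<nabla>\<sigma>,
  \<sigma>\<rangle> = dN, turns the cross term of its square into a t \<langle>d\<phi>, dN\<rangle>.
  The q-term comes from d(a^2 N) = 2 a t N d\<phi> + a^2 dN.\<close>

lemma radial_energy:
  assumes \<phi>: "smooth_map_on A UNIV \<phi>" and \<sigma>: "smooth_section A E T \<sigma>"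
  defines "N \<equiv> norm_sq h \<sigma>"
  shows "vertical_energy A g h D p q \<Omega> (\<lambda>x. (1 + t * \<phi> x) *\<^sub>R \<sigma> x) =
    1 / 2 * (LINT x:\<Omega>|vol A g. radial_density p q (\<phi> x) (N x) (nabla_norm_sq g h D \<sigma> x)
      (cometric \<phi> \<phi> x) (cometric \<phi> N x) (cometric N N x) t)"
proof -
  define s where "s x = (1 + t * \<phi> x) *\<^sub>R \<sigma> x" for x
  have s: "smooth_section A E T s" unfolding s_def by (rule smooth_radial_section[OF \<phi> \<sigma>])
  define a where "a x = 1 + t * \<phi> x" for x
  have as: "smooth_map_on A UNIV a"
    unfolding a_def by (intro smooth_map_on_add smooth_map_on_mult open_UNIV smooth_map_on_const \<phi>)
  have Ns: "smooth_map_on A UNIV N" unfolding N_def by (rule smooth_norm_sq[OF \<sigma>])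
  have da: "differential A a x v = t * differential A \<phi> x v" for x v
    unfolding a_def by (rule differential_compose[OF \<phi> UNIV_I]) (auto intro!: derivative_eq_intros)
  have mem: "\<sigma> x \<in> E x" "D x v \<sigma> \<in> E x" for x v
    using smooth_section_fibre[OF \<sigma>] conn_fibre[OF \<sigma>] by auto
  have mem2: "r *\<^sub>R \<sigma> x \<in> E x" "r *\<^sub>R D x v \<sigma> \<in> E x" "r *\<^sub>R \<sigma> x + r' *\<^sub>R D x v \<sigma> \<in> E x" for x v r r'
    using mem subspace_scale[OF subspace_fibre] subspace_add[OF subspace_fibre] by auto
  have norm_s: "norm_sq h s = (\<lambda>x. (a x)\<^sup>2 * N x)"
    by (simp add: fun_eq_iff norm_sq_def s_def N_def a_def fibre_scale_left fibre_scale_right mem mem2 power2_eq_square)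
  have Ds: "D x v s = (t * differential A \<phi> x v) *\<^sub>R \<sigma> x + a x *\<^sub>R D x v \<sigma>" for x v
    using conn_Leibniz[OF as \<sigma>, of x v] by (simp add: s_def[abs_def] a_def[symmetric] da)
  have dN: "differential A N x v = 2 * h x (D x v \<sigma>) (\<sigma> x)" for x v
    unfolding N_def by (rule differential_norm_sq[OF \<sigma>])
  have nabla: "nabla_norm_sq g h D s x = (a x)\<^sup>2 * nabla_norm_sq g h D \<sigma> x + a x * t * cometric \<phi> N x + t\<^sup>2 * N x * cometric \<phi> \<phi> x" for x
  proof -
    have "nabla_norm_sq g h D s x = metric_trace (g x) (\<lambda>v w. ((a x)\<^sup>2 * h x (D x v \<sigma>) (D x w \<sigma>) +
        a x * t * (differential A \<phi> x v * differential A N x w)) + t\<^sup>2 * N x * (differential A \<phi> x v * differential A \<phi> x w))"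
      unfolding nabla_norm_sq_eq_trace Ds
      by (rule metric_trace_cong, simp only: fibre_square[OF mem(1,2)] dN)
        (simp add: fibre_sym[OF mem(1,2)] N_def norm_sq_def power2_eq_square algebra_simps)
    then show ?thesis
      by (simp only: metric_trace_add metric_trace_scale nabla_norm_sq_eq_trace cometric_def)
  qed
  have "differential A (norm_sq h s) x v = (2 * a x * t * N x) * differential A \<phi> x v + (a x)\<^sup>2 * differential A N x v" for x v
    using differential_mult[OF smooth_map_on_mult[OF open_UNIV as as] Ns UNIV_I, of x v]
      differential_mult[OF as as UNIV_I, of x v]
    by (simp add: norm_s power2_eq_square da algebra_simps)
  then have com: "cometric (norm_sq h s) (norm_sq h s) x = (2 * a x * t * N x)\<^sup>2 * cometric \<phi> \<phi> x +
      2 * (2 * a x * t * N x) * (a x)\<^sup>2 * cometric \<phi> N x + ((a x)\<^sup>2)\<^sup>2 * cometric N N x" for x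
    by (rule cometric_combination)
  have "1 / (1 + norm_sq h s x) powr p * (nabla_norm_sq g h D s x +
        q * (let w = gradient A g (\<lambda>y. 1 / 2 * norm_sq h s y) x in g x w w)) =
      radial_density p q (\<phi> x) (N x) (nabla_norm_sq g h D \<sigma> x)
      (cometric \<phi> \<phi> x) (cometric \<phi> N x) (cometric N N x) t" for x
    unfolding gradient_half_norm_sq[OF s] com nabla
    by (simp add: norm_s radial_density_def a_def powr_minus_divide)
  then show ?thesis
    unfolding vertical_energy_def s_def[abs_def, symmetric] by simp
qed

end

context riemannian_vector_bundle
begin

section \<open>Harmonic sections with harmonic length are parallel\<close>

text \<open>\<open>dom\<close> treats both cases of \<open>pq_harmonic_section\<close> at once: the
  domain is the whole manifold if that is compact, and otherwise a connected relatively compact open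
  set containing \<open>K\<close>.\<close>

lemma radial_first_variation:
  assumes \<sigma>: "smooth_section A E T \<sigma>" and harm: "pq_harmonic_section A g E T h D p q \<sigma>"
    and \<phi>: "smooth_map_on A UNIV \<phi>" "compact K" "\<And>x. x \<notin> K \<Longrightarrow> \<phi> x = 0"
    and \<Omega>: "open \<Omega>" "compact (closure \<Omega>)" "K \<subseteq> \<Omega>"
    and dom: "if compact (UNIV :: 'm set) then \<Omega> = UNIV else connected \<Omega>"
  defines "N \<equiv> norm_sq h \<sigma>"
  shows "(LINT x:\<Omega>|vol A g. radial_density' p q (\<phi> x) (N x) (nabla_norm_sq g h D \<sigma> x)
      (cometric \<phi> \<phi> x) (cometric \<phi> N x) (cometric N N x) 0) = 0"
proof -
  have var: "smooth_variation A E T 1 \<sigma> (\<lambda>t x. (1 + t * \<phi> x) *\<^sub>R \<sigma> x)"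
    by (rule radial_smooth_variation[OF \<phi>(1) \<sigma>])
  have 0: "((\<lambda>t. vertical_energy A g h D p q \<Omega> (\<lambda>x. (1 + t * \<phi> x) *\<^sub>R \<sigma> x)) has_real_derivative 0) (at 0)"
  proof (cases "compact (UNIV :: 'm set)")
    case True
    then have "\<forall>\<epsilon>>0. \<forall>s. smooth_variation A E T \<epsilon> \<sigma> s \<longrightarrow>
        ((\<lambda>t. vertical_energy A g h D p q UNIV (s t)) has_real_derivative 0) (at 0)"
      using harm unfolding pq_harmonic_section_def by simp
    from this[rule_format, OF zero_less_one var] True dom show ?thesis by simp
  next
    case False
    then have "\<forall>\<epsilon>>0. \<forall>s K \<Omega>. smooth_variation A E T \<epsilon> \<sigma> s \<and>
          compact K \<and> (\<forall>t\<in>{-\<epsilon><..<\<epsilon>}. \<forall>x. x \<notin> K \<longrightarrow> s t x = \<sigma> x) \<and>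
          open \<Omega> \<and> connected \<Omega> \<and> compact (closure \<Omega>) \<and> K \<subseteq> \<Omega> \<longrightarrow>
          ((\<lambda>t. vertical_energy A g h D p q \<Omega> (s t)) has_real_derivative 0) (at 0)"
      using harm unfolding pq_harmonic_section_def by simp
    moreover have "smooth_variation A E T 1 \<sigma> (\<lambda>t x. (1 + t * \<phi> x) *\<^sub>R \<sigma> x) \<and>
          compact K \<and> (\<forall>t\<in>{-1<..<1}. \<forall>x. x \<notin> K \<longrightarrow> (1 + t * \<phi> x) *\<^sub>R \<sigma> x = \<sigma> x) \<and>
          open \<Omega> \<and> connected \<Omega> \<and> compact (closure \<Omega>) \<and> K \<subseteq> \<Omega>"
      using var \<phi> \<Omega> dom False by simp
    ultimately show ?thesis using zero_less_one by blast
  qed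
  have Ns: "smooth_map_on A UNIV N" unfolding N_def by (rule smooth_norm_sq[OF \<sigma>])
  note cont = smooth_map_on_imp_continuous_on[OF open_UNIV]
  have c: "continuous_on UNIV \<phi>" "continuous_on UNIV N" "continuous_on UNIV (nabla_norm_sq g h D \<sigma>)"
    "continuous_on UNIV (cometric \<phi> \<phi>)" "continuous_on UNIV (cometric \<phi> N)" "continuous_on UNIV (cometric N N)"
    by (intro cont \<phi> Ns smooth_nabla_norm_sq \<sigma> smooth_cometric open_UNIV)+
  have N0: "N x \<ge> 0" for x unfolding N_def by (rule norm_sq_nonneg[OF \<sigma>])
  have "((\<lambda>t. LINT x:\<Omega>|vol A g. radial_density p q (\<phi> x) (N x) (nabla_norm_sq g h D \<sigma> x)
      (cometric \<phi> \<phi> x) (cometric \<phi> N x) (cometric N N x) t) has_real_derivative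
      (LINT x:\<Omega>|vol A g. radial_density' p q (\<phi> x) (N x) (nabla_norm_sq g h D \<sigma> x)
      (cometric \<phi> \<phi> x) (cometric \<phi> N x) (cometric N N x) 0)) (at 0)"
  proof (rule has_derivative_set_integral[OF \<Omega>(1,2) zero_less_one])
    show "continuous_on UNIV (\<lambda>x. radial_density p q (\<phi> x) (N x) (nabla_norm_sq g h D \<sigma> x)
      (cometric \<phi> \<phi> x) (cometric \<phi> N x) (cometric N N x) t)" for t
      by (intro continuous_on_radial_density c continuous_on_const N0)
    show "continuous_on UNIV (\<lambda>x. radial_density' p q (\<phi> x) (N x) (nabla_norm_sq g h D \<sigma> x)
      (cometric \<phi> \<phi> x) (cometric \<phi> N x) (cometric N N x) 0)"
      by (intro continuous_on_radial_density c continuous_on_const N0)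
    have sn: "continuous_on X (\<lambda>z. k (snd z))" if "continuous_on UNIV k" for X :: "(real \<times> 'm) set" and k :: "'m \<Rightarrow> real"
      by (rule continuous_on_compose2[OF that continuous_on_snd[OF continuous_on_id]]) auto
    show "continuous_on ({-1..1} \<times> closure \<Omega>) (\<lambda>(t, x). radial_density' p q (\<phi> x) (N x) (nabla_norm_sq g h D \<sigma> x)
      (cometric \<phi> \<phi> x) (cometric \<phi> N x) (cometric N N x) t)"
      unfolding split_def
      by (intro continuous_on_radial_density sn c continuous_on_fst continuous_on_id N0)
  qed (rule radial_density_derivative[OF N0])
  from DERIV_cmult[OF this, of "1/2"]
  have "((\<lambda>t. vertical_energy A g h D p q \<Omega> (\<lambda>x. (1 + t * \<phi> x) *\<^sub>R \<sigma> x)) has_real_derivative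
      1 / 2 * (LINT x:\<Omega>|vol A g. radial_density' p q (\<phi> x) (N x) (nabla_norm_sq g h D \<sigma> x)
      (cometric \<phi> \<phi> x) (cometric \<phi> N x) (cometric N N x) 0)) (at 0)"
    unfolding radial_energy[OF \<phi>(1) \<sigma>] N_def .
  from DERIV_unique[OF this 0] show ?thesis by simp
qed

lemma harmonic_section_pointwise:
  assumes \<sigma>: "smooth_section A E T \<sigma>" and harm: "pq_harmonic_section A g E T h D p q \<sigma>"
    and N: "harmonic_function A g (norm_sq h \<sigma>)" and p: "p > 0"
    and nonneg: "\<And>x. 1 + (1 - p) * norm_sq h \<sigma> x \<ge> 0" "\<And>x. 2 + q * norm_sq h \<sigma> x \<ge> 0"
  shows "nabla_norm_sq g h D \<sigma> x * (1 + (1 - p) * norm_sq h \<sigma> x) = 0"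
proof -
  define N where "N = norm_sq h \<sigma>"
  define S where "S = nabla_norm_sq g h D \<sigma>"
  have Ns: "smooth_map_on A UNIV N" unfolding N_def by (rule smooth_norm_sq[OF \<sigma>])
  have N0: "N x \<ge> 0" for x unfolding N_def by (rule norm_sq_nonneg[OF \<sigma>])
  have S0: "S x \<ge> 0" for x unfolding S_def by (rule nabla_norm_sq_nonneg[OF \<sigma>])
  define G where "G = (\<lambda>x. (1 + N x) powr (- p - 1) * (2 * S x * (1 + (1 - p) * N x) + p / 2 * cometric N N x * (2 + q * N x)))"
  have G0: "2 * S x * (1 + (1 - p) * N x) \<ge> 0" "p / 2 * cometric N N x * (2 + q * N x) \<ge> 0" for x
    using S0 nonneg cometric_nonneg p by (auto simp: N_def)
  have Gs: "smooth_map_on A UNIV G"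
    unfolding G_def S_def
    by (intro smooth_map_on_mult smooth_map_on_add smooth_map_on_powr smooth_map_on_const open_UNIV Ns
        smooth_nabla_norm_sq[OF \<sigma>] smooth_cometric) (use N0 add_pos_nonneg[OF zero_less_one] in blast)
  obtain c where c: "c \<in> A" "x \<in> fst c" by (rule chart_exists)
  obtain \<phi> :: "'m \<Rightarrow> real" and U K \<Omega> where \<phi>: "smooth_map_on A UNIV \<phi>" "\<And>y. 0 \<le> \<phi> y" "open U" "x \<in> U" "\<And>y. y \<in> U \<Longrightarrow> \<phi> y = 1"
    "compact K" "U \<subseteq> K" "K \<subseteq> \<Omega>" "\<And>y. y \<notin> K \<Longrightarrow> \<phi> y = 0"
    and \<Omega>: "open \<Omega>" "connected \<Omega>" "compact (closure \<Omega>)" "closure \<Omega> \<subseteq> fst c"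
    by (rule bump_exists[OF c(1) chart_open[OF c(1)] c(2) order_refl]) (rule that)
  \<comment> \<open>In the compact case the definition of harmonicity prescribes the whole manifold;
    the coordinate ball serves as domain only otherwise.\<close>
  define \<Theta> where "\<Theta> = (if compact (UNIV :: 'm set) then UNIV else \<Omega>)"
  have \<Theta>: "open \<Theta>" "compact (closure \<Theta>)" "K \<subseteq> \<Theta>" "x \<in> \<Theta>"
    "if compact (UNIV :: 'm set) then \<Theta> = UNIV else connected \<Theta>"
    using \<Omega> \<phi> by (auto simp: \<Theta>_def)
  have Kc: "K \<subseteq> fst c" using \<phi>(8) \<Omega>(4) closure_subset[of \<Omega>] by blast
  \<comment> \<open>The coefficient of \<langle>\<nabla>\<phi>, \<nabla>N\<rangle> in the first
    variation is \<open>v (N x)\<close>, a function of N alone. Hence the gradient of \<phi> v(N)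
    reproduces this term and adds only a multiple of |\<nabla>N|^2, governed by
    \<open>v'\<close>.\<close>
  define v where "v r = (1 + r) powr (- p) * (1 + q * r)" for r
  define v' where "v' r = - p * (1 + r) powr (- p - 1) * (1 + q * r) + (1 + r) powr (- p) * q" for r
  have v': "(v has_real_derivative v' r) (at r)" if "r \<ge> 0" for r
  proof -
    have "((\<lambda>r. 1 + r) has_real_derivative 1) (at r)" by (auto intro!: derivative_eq_intros)
    from DERIV_fun_powr[OF this, of "- p"] that
    have a: "((\<lambda>r. (1 + r) powr (- p)) has_real_derivative - p * (1 + r) powr (- p - 1)) (at r)" by simp
    have b: "((\<lambda>r. 1 + q * r) has_real_derivative q) (at r)" by (auto intro!: derivative_eq_intros)
    from DERIV_mult[OF a b] show ?thesis
      by (simp only: v_def[abs_def] v'_def mult.commute[of q "(1 + r) powr (- p)"])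
  qed
  have vs: "smooth_map_on A UNIV (\<lambda>x. v (N x))"
    unfolding v_def
    by (intro smooth_map_on_mult smooth_map_on_add smooth_map_on_powr smooth_map_on_const open_UNIV Ns)
      (use N0 add_pos_nonneg[OF zero_less_one] in blast)
  define \<psi> where "\<psi> x = \<phi> x * v (N x)" for x
  have \<psi>s: "smooth_map_on A UNIV \<psi>"
    unfolding \<psi>_def by (intro smooth_map_on_mult open_UNIV \<phi>(1) vs)
  have \<psi>0: "\<psi> y = 0" if "y \<notin> K" for y using \<phi>(9)[OF that] by (simp add: \<psi>_def)
  have "differential A \<psi> y w = v (N y) * differential A \<phi> y w + (\<phi> y * v' (N y)) * differential A N y w" for y w
    unfolding \<psi>_def differential_mult[OF \<phi>(1) vs UNIV_I] differential_compose[OF Ns UNIV_I v'[OF N0]]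
    by (simp add: algebra_simps)
  then have com: "cometric \<psi> N y = v (N y) * cometric \<phi> N y + (\<phi> y * v' (N y)) * cometric N N y" for y
    unfolding cometric_def by (simp only: distrib_right mult.assoc metric_trace_add metric_trace_scale)
  have clK: "open (- K)" using \<phi>(6) compact_imp_closed by blast
  have com0: "cometric \<psi> N y = 0" if "y \<notin> K" for y
    by (rule cometric_eq_0[OF clK]) (use that \<psi>0 in auto)
  have cont: "continuous_on UNIV (cometric \<psi> N)" "continuous_on UNIV (\<lambda>y. \<phi> y * G y)"
    by (intro smooth_map_on_imp_continuous_on[OF open_UNIV] smooth_cometric smooth_map_on_mult open_UNIV \<psi>s Ns \<phi>(1) Gs)+
  have int: "set_integrable (vol A g) \<Theta> k" if k: "continuous_on UNIV k" for k :: "'m \<Rightarrow> real"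
  proof -
    obtain M where "\<And>x. x \<in> closure \<Theta> \<Longrightarrow> \<bar>k x\<bar> \<le> M"
      by (rule compact_continuous_bound[OF \<Theta>(2) continuous_on_subset[OF k subset_UNIV]]) (rule that)
    then show ?thesis
      using closure_subset[of \<Theta>]
      by (intro set_integrable_bounded[OF borel_measurable_continuous_onI[OF k] \<Theta>(2) borel_open[OF \<Theta>(1)]]) auto
  qed
  have "(LINT y:\<Theta>|vol A g. cometric \<psi> N y) = (LINT y|vol A g. cometric \<psi> N y)"
    unfolding set_lebesgue_integral_def
    by (intro Bochner_Integration.integral_cong refl) (use com0 \<Theta>(3) in \<open>auto simp: indicator_def\<close>)
  also have "\<dots> = 0"
    by (rule harmonic_weak[OF N[folded N_def] c(1) \<psi>s \<phi>(6) Kc \<psi>0])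
  finally have IBP: "(LINT y:\<Theta>|vol A g. cometric \<psi> N y) = 0" .
  have "0 = (LINT y:\<Theta>|vol A g. radial_density' p q (\<phi> y) (N y) (S y) (cometric \<phi> \<phi> y) (cometric \<phi> N y) (cometric N N y) 0)"
    unfolding N_def S_def by (rule radial_first_variation[OF \<sigma> harm \<phi>(1,6,9) \<Theta>(1,2,3,5), symmetric])
  also have "\<dots> = (LINT y:\<Theta>|vol A g. cometric \<psi> N y + \<phi> y * G y)"
    by (simp add: radial_density'_at_0[OF N0] com v_def v'_def G_def)
  also have "\<dots> = (LINT y:\<Theta>|vol A g. cometric \<psi> N y) + (LINT y:\<Theta>|vol A g. \<phi> y * G y)"
    by (intro set_integral_add int cont)
  finally have "(LINT y:\<Theta>|vol A g. \<phi> y * G y) = 0" using IBP by simp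
  \<comment> \<open>Both summands of \<open>G\<close> are nonnegative, so the integrand is
    continuous and nonnegative with integral 0; it vanishes at \<open>x\<close>, where \<phi> is
    1.\<close>
  then have "\<phi> x * G x = 0"
    using G0 \<phi>(2)
    by (intro set_integral_nonneg_eq_0[OF \<Theta>(1,2) cont(2) _ _ \<Theta>(4)]) (auto simp: G_def)
  then have "G x = 0" using \<phi>(4,5) by simp
  moreover have "(1 + N x) powr (- p - 1) \<noteq> 0" using N0[of x] by simp
  ultimately have "2 * S x * (1 + (1 - p) * N x) + p / 2 * cometric N N x * (2 + q * N x) = 0"
    unfolding G_def mult_eq_0_iff[of "(1 + N x) powr (- p - 1)"] by blast
  then have "2 * S x * (1 + (1 - p) * N x) = 0"
    using G0[of x] by linarith
  then show ?thesis by (simp add: S_def N_def)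
qed

text \<open>A coordinate ball is convex, so a vanishing derivative makes the function constant on
  it.\<close>

lemma locally_constant_if_differential_0:
  fixes f :: "'m \<Rightarrow> real"
  assumes f: "smooth_map_on A UNIV f" and W: "open W" "x \<in> W" and 0: "\<And>y v. y \<in> W \<Longrightarrow> differential A f y v = 0"
  shows "\<exists>U. open U \<and> x \<in> U \<and> (\<forall>y\<in>U. f y = f x)"
proof -
  obtain c where c: "c \<in> A" "x \<in> fst c" by (rule chart_exists)
  obtain r where r: "r > 0" "cball (snd c x) r \<subseteq> snd c ` (fst c \<inter> W)"
    by (rule chart_ball_exists[OF c W])
  define B where "B = ball (snd c x) r"
  have B: "B \<subseteq> snd c ` (fst c \<inter> W)" "B \<subseteq> snd c ` fst c" "snd c x \<in> B" 
  proof -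
    have "B \<subseteq> cball (snd c x) r" by (auto simp: B_def)
    then show "B \<subseteq> snd c ` (fst c \<inter> W)" using r(2) by (rule order_trans)
    then show "B \<subseteq> snd c ` fst c" by blast
  qed (use r in \<open>simp add: B_def\<close>)
  have "\<exists>k. \<forall>y\<in>B. (f \<circ> chart_inv c) y = k"
  proof (rule has_derivative_zero_constant)
    show "convex B" by (simp add: B_def)
    fix z assume "z \<in> B"
    then obtain w where w: "w \<in> fst c" "w \<in> W" "z = snd c w" using B(1) by blast
    have "chart_derivative c f w \<xi> = 0" for \<xi>
      using differential_coord_vector[OF c(1) w(1) f UNIV_I] 0[OF w(2)] by simp
    then have "chart_derivative c f w = (\<lambda>_. 0)" by (simp add: fun_eq_iff)
    then show "((f \<circ> chart_inv c) has_derivative (\<lambda>_. 0)) (at z within B)"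
      using smooth_map_on_chart_has_derivative[OF f c(1) w(1) UNIV_I] w(3) has_derivative_at_withinI by metis
  qed
  then have eq: "(f \<circ> chart_inv c) y = (f \<circ> chart_inv c) (snd c x)" if "y \<in> B" for y
    using B(3) that by metis
  have "f y = f x" if "y \<in> chart_inv c ` B" for y
    using that eq by (auto simp: chart_inv_left[OF c])
  moreover have "open (chart_inv c ` B)"
    by (rule chart_inv_image_open[OF c(1) _ B(2)]) (simp add: B_def)
  moreover have "x \<in> chart_inv c ` B"
    using B(3) chart_inv_left[OF c] by (metis imageI)
  ultimately show ?thesis by blast
qed

lemma harmonic_section_imp_parallel:
  assumes conn: "connected (UNIV :: 'm set)"
    and \<nu>: "\<nu> > 0" "p > 1" "q \<ge> 2 * \<nu> * (1 - p)"
    and \<sigma>: "smooth_section A E T \<sigma>"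
    and Riem: "(\<nu> > 1 \<and> r_Riemannian h (\<nu> * (1 - p)) \<sigma>) \<or> (\<nu> = 1 \<and> strictly_r_Riemannian h (1 - p) \<sigma>)"
    and N: "harmonic_function A g (norm_sq h \<sigma>)"
    and harm: "pq_harmonic_section A g E T h D p q \<sigma>"
  shows "parallel_section D \<sigma>"
proof -
  define N where "N = norm_sq h \<sigma>"
  have Ns: "smooth_map_on A UNIV N" unfolding N_def by (rule smooth_norm_sq[OF \<sigma>])
  have N0: "N x \<ge> 0" for x unfolding N_def by (rule norm_sq_nonneg[OF \<sigma>])
  have R: "\<nu> * (1 - p) * N x \<ge> -1" for x
    using Riem by (auto simp: r_Riemannian_def strictly_r_Riemannian_def N_def)
  \<comment> \<open>As N \<ge> 0, the bound on q gives q N \<ge> 2 \<nu> (1 - p) N, and the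
    Riemannian condition bounds this below by -2.\<close>
  have 2: "2 + q * N x \<ge> 0" for x
    using mult_right_mono[OF \<nu>(3) N0[of x]] R[of x] by (simp add: algebra_simps)
  \<comment> \<open>Since p > 1, the number (1 - p) N is nonpositive, and multiplication by \<nu>
    \<ge> 1 can only lower it. So the lower bound -1 for the product with \<nu> holds for (1 - p) N
    as well.\<close>
  have "(1 - p) * N x \<ge> \<nu> * ((1 - p) * N x)" if "\<nu> \<ge> 1" for x
  proof -
    have "(1 - p) * N x \<le> 0" using \<nu>(2) N0[of x] by (simp add: mult_nonpos_nonneg)
    then show ?thesis using mult_right_mono_neg[OF \<open>\<nu> \<ge> 1\<close>, of "(1 - p) * N x"] by simp
  qed
  moreover have "\<nu> \<ge> 1" using Riem by auto
  moreover have "\<nu> * ((1 - p) * N x) \<ge> -1" for x using R[of x] by (simp add: mult.assoc)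
  ultimately have 1: "1 + (1 - p) * N x \<ge> 0" for x
    by (smt (verit))
  have key: "nabla_norm_sq g h D \<sigma> x * (1 + (1 - p) * N x) = 0" for x
    using harmonic_section_pointwise[OF \<sigma> harm N _ 1[unfolded N_def] 2[unfolded N_def], of x] \<nu>(2) by (simp add: N_def)
  have pos: "1 + (1 - p) * N x > 0" for x
  proof (cases "\<nu> > 1")
    case True
    \<comment> \<open>Otherwise \<nu> (1 - p) N \<le> -\<nu> < -1, against the Riemannian condition:
      here \<nu> > 1 does the work of strictness.\<close>
    have "(1 - p) * N x > -1"
    proof (rule ccontr)
      assume "\<not> ?thesis"
      then have "(1 - p) * N x \<le> -1" by simp
      then have "\<nu> * ((1 - p) * N x) \<le> - \<nu>"
        using mult_left_mono[of "(1 - p) * N x" "-1" \<nu>] \<nu>(1) by simp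
      then show False using R[of x] True by (simp add: mult.assoc)
    qed
    then show ?thesis by simp
  next
    case False
    then have "strictly_r_Riemannian h (1 - p) \<sigma>" using Riem by blast
    then obtain x0 where "(1 - p) * N x0 > -1"
      unfolding strictly_r_Riemannian_def N_def by blast
    then have x0: "1 + (1 - p) * N x0 > 0" by simp
    \<comment> \<open>A level set of N rather than the positivity set of 1 + (1 - p) N: it is closed
      by continuity, and it is open because the factor is positive near each of its points, which
      forces \<nabla>\<sigma> = 0 and then dN = 0 there.\<close>
    define Z where "Z = {x. N x = N x0}"
    have contN: "continuous_on UNIV N" by (rule smooth_map_on_imp_continuous_on[OF open_UNIV Ns])
    have "closed Z" unfolding Z_def by (intro closed_Collect_eq contN continuous_on_const)
    moreover have "open Z"
    proof (subst open_subopen, rule ballI)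
      fix y assume y: "y \<in> Z"
      define W where "W = {x. 1 + (1 - p) * N x > 0}"
      have W1: "open W" unfolding W_def
        by (intro open_Collect_less continuous_on_const continuous_on_add continuous_on_mult contN)
      have W2: "y \<in> W" using y x0 by (simp add: W_def Z_def)
      have W3: "differential A N z v = 0" if "z \<in> W" for z v
      proof -
        have "nabla_norm_sq g h D \<sigma> z = 0" using key[of z] that by (auto simp: W_def)
        then have "D z v \<sigma> = 0" using nabla_norm_sq_eq_0_iff[OF \<sigma>] by blast
        moreover have "h z 0 (\<sigma> z) = 0"
          using fibre_scale_left[OF smooth_section_fibre[OF \<sigma>, of z] smooth_section_fibre[OF \<sigma>, of z], where r=0] by simp
        ultimately show ?thesis by (simp add: N_def differential_norm_sq[OF \<sigma>])
      qed
      obtain U where U: "open U" "y \<in> U" "\<forall>z\<in>U. N z = N y"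
        using locally_constant_if_differential_0[OF Ns W1 W2 W3] by blast
      have "z \<in> Z" if "z \<in> U" for z
      proof -
        have "N z = N y" using U(3) that by (rule bspec)
        also have "N y = N x0" using y by (simp add: Z_def)
        finally show ?thesis by (simp add: Z_def)
      qed
      then show "\<exists>T. open T \<and> y \<in> T \<and> T \<subseteq> Z" using U(1,2) by (intro exI[of _ U]) auto
    qed
    moreover have "x0 \<in> Z" by (simp add: Z_def)
    ultimately have "- Z = {}"
      using connectedD[OF conn, of Z "- Z"] by (auto simp: open_Compl)
    then have "N x = N x0" by (auto simp: Z_def)
    then show ?thesis using x0 by simp
  qed
  have "nabla_norm_sq g h D \<sigma> x = 0" for x using key[of x] pos[of x] by auto
  then show ?thesis
    using nabla_norm_sq_eq_0_iff[OF \<sigma>] by (simp add: parallel_section_def)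
qed

end

section \<open>Parallel sections are harmonic\<close>

text \<open>The mean value inequality in t, with the t-derivative bounded on a compact product
  neighbourhood. The filter \<open>nhds (0, y0)\<close> on the product encodes a bound that is
  uniform in y near \<open>y0\<close> and that includes t = 0.\<close>

lemma bigo_smooth_difference:
  fixes m :: "real \<times> 'a::euclidean_space \<Rightarrow> real"
  assumes I: "open I" "0 \<in> I" and Y: "open Y" "y0 \<in> Y" and m: "smooth_on (I \<times> Y) m"
  shows "(\<lambda>z. m z - m (0, snd z)) \<in> O[nhds (0, y0)](\<lambda>z. fst z)"
proof -
  obtain \<delta> where \<delta>: "\<delta> > 0" "cball 0 \<delta> \<subseteq> I" using I open_contains_cball by blast
  obtain r where r: "r > 0" "cball y0 r \<subseteq> Y" using Y open_contains_cball by blast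
  define m' where "m' z = frechet_derivative m (at z) (1, 0)" for z
  define Q where "Q = cball (0::real) \<delta> \<times> cball y0 r"
  have Q: "Q \<subseteq> I \<times> Y" "compact Q" using \<delta> r by (auto simp: Q_def compact_Times)
  have "continuous_on Q m'"
    unfolding m'_def
    by (rule continuous_on_subset[OF smooth_on_imp_continuous_on[OF smooth_on_frechet_derivative[OF m]] Q(1)])
  then have "bounded (m' ` Q)" using Q by (intro compact_imp_bounded compact_continuous_image)
  then obtain C where C: "\<And>z. z \<in> Q \<Longrightarrow> \<bar>m' z\<bar> \<le> C" by (auto simp: bounded_iff)
  have bound: "\<bar>m (t, y) - m (0, y)\<bar> \<le> C * \<bar>t\<bar>" if t: "t \<in> cball 0 \<delta>" and y: "y \<in> cball y0 r" for t y
  proof -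
    have "norm (m (t, y) - m (0, y)) \<le> C * norm (t - 0)"
    proof (rule field_differentiable_bound[of "cball 0 \<delta>" "\<lambda>t. m (t, y)" "\<lambda>t. m' (t, y)"])
      fix u :: real assume u: "u \<in> cball 0 \<delta>"
      then have "(u, y) \<in> Q" using y by (auto simp: Q_def)
      then have z: "(u, y) \<in> I \<times> Y" "(u, y) \<in> Q" using Q(1) by blast+
      have d: "(m has_derivative frechet_derivative m (at (u, y))) (at (u, y))"
        by (rule smooth_on_has_derivative[OF m z(1)])
      have "((\<lambda>t. (t, y)) has_derivative (\<lambda>k. (k, 0))) (at u within cball 0 \<delta>)"
        by (auto intro!: derivative_eq_intros)
      from has_derivative_compose[OF this d]
      have "((\<lambda>t. m (t, y)) has_derivative (\<lambda>k. frechet_derivative m (at (u, y)) (k, 0))) (at u within cball 0 \<delta>)" .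
      moreover have "frechet_derivative m (at (u, y)) (k, 0) = m' (u, y) * k" for k
        using linear_scale[OF has_derivative_linear[OF d], of k "(1, 0)"] by (simp add: m'_def mult.commute)
      ultimately show "((\<lambda>t. m (t, y)) has_field_derivative m' (u, y)) (at u within cball 0 \<delta>)"
        by (simp add: has_field_derivative_def)
      show "norm (m' (u, y)) \<le> C" using C[OF z(2)] by simp
    qed (use t \<delta> in auto)
    then show ?thesis by simp
  qed
  have "\<forall>\<^sub>F z in nhds (0, y0). norm (m z - m (0, snd z)) \<le> C * norm (fst z)"
    unfolding eventually_nhds
    by (rule exI[of _ "ball 0 \<delta> \<times> ball y0 r"]) (use \<delta> r bound in \<open>auto simp: open_Times less_imp_le\<close>)
  then show ?thesis by (rule bigoI)
qed

text \<open>Coefficients that do not depend on t are bounded near \<open>x\<close>, so they do not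
  affect the order in t.\<close>

lemma bigo_continuous:
  fixes k :: "'a::t2_space \<Rightarrow> real"
  assumes "isCont k x"
  shows "(\<lambda>z. k (snd z)) \<in> O[nhds (0::real, x)](\<lambda>_. 1)"
proof -
  have "((\<lambda>z. k (snd z)) \<longlongrightarrow> k x) (nhds (0::real, x))"
    using assms unfolding isCont_def tendsto_at_iff_tendsto_nhds nhds_prod
    by (rule filterlim_compose[OF _ filterlim_snd])
  then have "\<forall>\<^sub>F z in nhds (0::real, x). dist (k (snd z)) (k x) < 1" by (rule tendstoD) simp
  then have "\<forall>\<^sub>F z in nhds (0::real, x). norm (k (snd z)) \<le> (\<bar>k x\<bar> + 1) * norm (1::real)"
    by (rule eventually_mono) (auto simp: dist_real_def)
  then show ?thesis by (rule bigoI)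
qed

lemma metric_trace_sum: "metric_trace b (\<lambda>v w. \<Sum>j\<in>J. B j v w) = (\<Sum>j\<in>J. metric_trace b (B j))"
  unfolding metric_trace_def Let_def by (rule sum.swap)

context riemannian_vector_bundle
begin

lemma connection_zero: "smooth_section A E T \<sigma> \<Longrightarrow> D x v (\<lambda>_. 0) = 0"
  using conn_Leibniz[OF smooth_map_on_const, of \<sigma> x v 0] by (simp add: differential_const)

lemma smooth_section_zero: "smooth_section A E T \<sigma> \<Longrightarrow> smooth_section A E T (\<lambda>_. 0)"
  using smooth_section_scale[OF smooth_map_on_const, of \<sigma> 0] by simp

text \<open>The section \<sigma> serves to show that the zero section is smooth, which starts the
  induction at the empty sum.\<close>

lemma connection_sum:
  assumes "smooth_section A E T \<sigma>" and "finite J" "\<And>j. j \<in> J \<Longrightarrow> smooth_section A E T (\<tau> j)"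
  shows "D x v (\<lambda>y. \<Sum>j\<in>J. \<tau> j y) = (\<Sum>j\<in>J. D x v (\<tau> j))"
proof -
  have "smooth_section A E T (\<lambda>y. \<Sum>j\<in>J. \<tau> j y) \<and> D x v (\<lambda>y. \<Sum>j\<in>J. \<tau> j y) = (\<Sum>j\<in>J. D x v (\<tau> j))"
    using assms(2,3)
  proof (induction J rule: finite_induct)
    case empty
    then show ?case using connection_zero[OF assms(1)] smooth_section_zero[OF assms(1)] by simp
  next
    case (insert j J)
    then show ?case
      using smooth_section_add[of "\<tau> j" "\<lambda>y. \<Sum>j\<in>J. \<tau> j y"] conn_add[of "\<tau> j" "\<lambda>y. \<Sum>j\<in>J. \<tau> j y"] by simp
  qed
  then show ?thesis by blast
qed

text \<open>Each summand costs a factor 2, by |a + b|^2 \<le> 2 |a|^2 + 2 |b|^2. Any constant would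
  do, as only an O(t^2) bound is sought.\<close>

lemma fibre_sum_bound:
  assumes "finite J" "\<And>j. j \<in> J \<Longrightarrow> z j \<in> E x"
  shows "h x (\<Sum>j\<in>J. z j) (\<Sum>j\<in>J. z j) \<le> 2 ^ card J * (\<Sum>j\<in>J. h x (z j) (z j))"
  using assms
proof (induction J rule: finite_induct)
  case empty
  then show ?case by (simp add: fibre_zero)
next
  case (insert j J)
  define Z where "Z = (\<Sum>j\<in>J. z j)"
  have mem: "z j \<in> E x" "Z \<in> E x"
    unfolding Z_def by (auto intro!: subspace_sum[OF subspace_fibre] insert.prems)
  have 2: "h x (z j + Z) (z j + Z) \<le> 2 * h x (z j) (z j) + 2 * h x Z Z"
    using fibre_square[OF mem, of 1 1] fibre_square[OF mem, of 1 "-1"]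
      fibre_nonneg[OF subspace_diff[OF subspace_fibre mem]] by simp
  have IH: "h x Z Z \<le> 2 ^ card J * (\<Sum>j\<in>J. h x (z j) (z j))"
    unfolding Z_def using insert by auto
  have "1 * h x (z j) (z j) \<le> 2 ^ card J * h x (z j) (z j)"
    using fibre_nonneg[OF mem(1)] by (intro mult_right_mono) auto
  with 2 IH show ?case
    using insert.hyps by (simp add: Z_def[symmetric] algebra_simps)
qed

lemma smooth_variation_section:
  assumes s: "smooth_variation A E T \<epsilon> \<sigma> s" and t: "t \<in> {-\<epsilon><..<\<epsilon>}"
  shows "smooth_section A E T (s t)"
  unfolding smooth_section_def smooth_map_on_def
proof (intro conjI allI ballI, goal_cases)
  case (1 x)
  then show ?case using s t by (simp add: smooth_variation_def)
next
  case (2 b)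
  obtain V \<Psi> where b: "b = (V, \<Psi>)" by fastforce
  have V: "(V, \<Psi>) \<in> T" using 2 b by simp
  have "smooth_on (snd c ` (fst c \<inter> V)) ((\<lambda>x. inv (\<Psi> x) (s t x)) \<circ> chart_inv c)" if c: "c \<in> A" for c
  proof -
    define Y where "Y = snd c ` (fst c \<inter> V)"
    have Y: "open Y" unfolding Y_def by (rule chart_image_Int_open[OF c triv_open[OF V]])
    define F where "F = (\<lambda>(t, y). inv (\<Psi> (chart_inv c y)) (s t (chart_inv c y)))"
    have F: "smooth_on ({-\<epsilon><..<\<epsilon>} \<times> Y) F"
      using s c V unfolding smooth_variation_def Y_def F_def by blast
    have t_slice: "smooth_on Y (\<lambda>y. (t, y))"
    proof -
      have "smooth_on Y (\<lambda>y. (t, 0) + (0, y))"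
        by (intro smooth_on_add Y smooth_on_const smooth_on_bounded_linear bounded_linear_Pair
            bounded_linear_zero bounded_linear_ident)
      then show ?thesis by simp
    qed
    have "smooth_on Y (\<lambda>y. F (t, y))"
      by (rule smooth_on_compose[OF Y _ _ F t_slice]) (use t Y in \<open>auto simp: open_Times\<close>)
    then show ?thesis by (simp add: o_def Y_def F_def)
  qed
  then show ?case by (simp add: b)
qed

text \<open>The connection differentiates global sections, so a local frame has to be cut off.
  Outside \<open>V\<close> the vector \<open>\<Psi> x a\<close> need not lie in the fibre, but
  \<phi> vanishes there.\<close>

lemma frame_section:
  assumes V: "(V, \<Psi>) \<in> T" and \<phi>: "smooth_map_on A UNIV \<phi>" and K: "compact K" "K \<subseteq> V" "\<And>x. x \<notin> K \<Longrightarrow> \<phi> x = 0"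
  shows "smooth_section A E T (\<lambda>x. \<phi> x *\<^sub>R \<Psi> x a)"
proof (rule smooth_sectionI)
  note Vo = triv_open[OF V]
  show "\<phi> x *\<^sub>R \<Psi> x a \<in> E x" for x
  proof (cases "x \<in> V")
    case True
    then show ?thesis by (intro subspace_scale[OF subspace_fibre] triv_mem[OF V])
  next
    case False
    then have "\<phi> x = 0" using K by blast
    then show ?thesis using subspace_0[OF subspace_fibre] by simp
  qed
  have cl: "open (- K)" using K compact_imp_closed by blast
  show "\<exists>(V, \<Psi>')\<in>T. \<exists>U. open U \<and> x \<in> U \<and> U \<subseteq> V \<and> smooth_map_on A U (\<lambda>x. inv (\<Psi>' x) (\<phi> x *\<^sub>R \<Psi> x a))" for x
  proof (cases "x \<in> K")
    case True
    have "smooth_map_on A V (\<lambda>x. \<phi> x *\<^sub>R a)"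
      by (intro smooth_map_on_scaleR Vo smooth_map_on_const smooth_map_on_subset[OF \<phi>]) auto
    then have "smooth_map_on A V (\<lambda>x. inv (\<Psi> x) (\<phi> x *\<^sub>R \<Psi> x a))"
      by (rule smooth_map_on_cong[OF Vo, THEN iffD1, rotated])
        (simp add: linear_inv_triv(2)[OF V _ triv_mem[OF V]] triv_inv_left[OF V])
    then show ?thesis using True K(2) Vo V by blast
  next
    case False
    obtain W \<Theta> where W: "(W, \<Theta>) \<in> T" "x \<in> W" by (rule triv_exists)
    have op: "open (W \<inter> - K)" using triv_open[OF W(1)] cl by (rule open_Int)
    have "smooth_map_on A (W \<inter> - K) (\<lambda>x. inv (\<Theta> x) (\<phi> x *\<^sub>R \<Psi> x a))"
    proof (rule smooth_map_on_cong[OF op, THEN iffD1, OF _ smooth_map_on_const])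
      fix y assume y: "y \<in> W \<inter> - K"
      have "inv (\<Theta> y) (0 *\<^sub>R 0) = 0 *\<^sub>R inv (\<Theta> y) 0"
        using y by (intro linear_inv_triv(2)[OF W(1)] subspace_0[OF subspace_fibre]) auto
      then show "0 = inv (\<Theta> y) (\<phi> y *\<^sub>R \<Psi> y a)" using y K(3) by simp
    qed
    then show ?thesis using W op False by blast
  qed
qed

text \<open>The difference of s t and \<sigma> has the same covariant derivative as s t, since
  \<sigma> is parallel. In a frame its coefficients and their first derivatives are increments, from
  time 0 to time t, of smooth functions of (t, y). They are O(t) locally uniformly, so the squared
  norm is O(t^2).\<close>

lemma variation_nabla_bigo:
  assumes par: "parallel_section D \<sigma>" and \<sigma>: "smooth_section A E T \<sigma>"
    and \<epsilon>: "\<epsilon> > 0" and s: "smooth_variation A E T \<epsilon> \<sigma> s"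
  shows "(\<lambda>z. nabla_norm_sq g h D (s (fst z)) (snd z)) \<in> O[nhds (0, x0)](\<lambda>z. fst z * fst z)"
proof -
  obtain V \<Psi> where V: "(V, \<Psi>) \<in> T" "x0 \<in> V" by (rule triv_exists)
  obtain c where c: "c \<in> A" "x0 \<in> fst c" by (rule chart_exists)
  note Vo = triv_open[OF V(1)]
  have op: "open (fst c \<inter> V)" using chart_open[OF c(1)] Vo by (rule open_Int)
  have xW: "x0 \<in> fst c \<inter> V" using c V by simp
  obtain \<phi> :: "'m \<Rightarrow> real" and U K \<Omega> where \<phi>: "smooth_map_on A UNIV \<phi>" "\<And>y. 0 \<le> \<phi> y" "open U" "x0 \<in> U" "\<And>y. y \<in> U \<Longrightarrow> \<phi> y = 1"
    "compact K" "U \<subseteq> K" "K \<subseteq> \<Omega>" "\<And>y. y \<notin> K \<Longrightarrow> \<phi> y = 0"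
    and \<Omega>: "open \<Omega>" "connected \<Omega>" "compact (closure \<Omega>)" "closure \<Omega> \<subseteq> fst c \<inter> V"
    by (rule bump_exists[OF c(1) op xW Int_lower1]) (rule that)
  have K: "K \<subseteq> V" "K \<subseteq> fst c" using \<phi>(8) \<Omega>(4) closure_subset[of \<Omega>] by blast+
  have UV: "U \<subseteq> V" "U \<subseteq> fst c" using K \<phi>(7) by auto
  define I where "I = {-\<epsilon><..<\<epsilon>}"
  define Y where "Y = snd c ` (fst c \<inter> V)"
  have Y: "open Y" "snd c x0 \<in> Y" unfolding Y_def using chart_image_Int_open[OF c(1) Vo] xW by auto
  have I: "open I" "0 \<in> I" using \<epsilon> by (auto simp: I_def)
  define \<tau> where "\<tau> t x = s t x + (-1) *\<^sub>R \<sigma> x" for t x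
  have st: "smooth_section A E T (s t)" if "t \<in> I" for t
    using smooth_variation_section[OF s] that by (simp add: I_def)
  have \<tau>s: "smooth_section A E T (\<tau> t)" if "t \<in> I" for t
    unfolding \<tau>_def by (intro smooth_section_add smooth_section_scale st that smooth_map_on_const \<sigma>)
  define u where "u j t x = \<phi> x * inv (\<Psi> x) (\<tau> t x) $ j" for j t x
  define f where "f j x = \<phi> x *\<^sub>R \<Psi> x (axis j 1)" for j x
  have fs: "smooth_section A E T (f j)" for j
    unfolding f_def by (rule frame_section[OF V(1) \<phi>(1,6) K(1) \<phi>(9)])
  have us: "smooth_map_on A UNIV (u j t)" if "t \<in> I" for j t
  proof (rule smooth_map_on_zero_extension[OF Vo compact_imp_closed[OF \<phi>(6)] K(1)])
    show "smooth_map_on A V (u j t)" unfolding u_def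
      by (intro smooth_map_on_mult smooth_map_on_vec_nth Vo smooth_map_on_subset[OF \<phi>(1)] smooth_sectionD[OF \<tau>s V(1)] that) auto
  qed (simp add: u_def \<phi>(9))
  \<comment> \<open>One factor \<phi> makes the coefficients \<open>u j t\<close> global functions,
    the other makes the frame vectors \<open>f j\<close> global sections; hence the square on the
    left.\<close>
  have expand: "(\<phi> y * \<phi> y) *\<^sub>R \<tau> t y = (\<Sum>j\<in>UNIV. u j t y *\<^sub>R f j y)" if "t \<in> I" for t y
  proof (cases "y \<in> V")
    case True
    note lin = triv_linear[OF V(1) True]
    define r where "r = inv (\<Psi> y) (\<tau> t y)"
    have uj: "u j t y = \<phi> y * r $ j" for j by (simp add: u_def r_def)
    have "\<tau> t y = \<Psi> y r" unfolding r_def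
      by (rule triv_inv_right[OF V(1) True smooth_section_fibre[OF \<tau>s[OF that]], symmetric])
    also have "r = (\<Sum>j\<in>UNIV. r $ j *\<^sub>R axis j 1)"
      using basis_expansion[of r] by (simp add: scalar_mult_eq_scaleR)
    also have "\<Psi> y (\<Sum>j\<in>UNIV. r $ j *\<^sub>R axis j 1) = (\<Sum>j\<in>UNIV. r $ j *\<^sub>R \<Psi> y (axis j 1))"
      by (simp add: linear_sum[OF lin] linear_scale[OF lin])
    finally show ?thesis
      by (simp only: uj f_def scaleR_sum_right scaleR_scaleR mult_ac)
  next
    case False
    then have "\<phi> y = 0" using K \<phi>(9) by blast
    then show ?thesis by (simp add: u_def)
  qed
  have D\<tau>: "D x v (s t) = (\<Sum>j\<in>UNIV. differential A (u j t) x v *\<^sub>R f j x + u j t x *\<^sub>R D x v (f j))"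
    if "t \<in> I" "x \<in> U" for t x v
  proof -
    have "s t = (\<lambda>y. \<sigma> y + \<tau> t y)" by (simp add: \<tau>_def fun_eq_iff)
    then have "D x v (s t) = D x v (\<tau> t)"
      using conn_add[OF \<sigma> \<tau>s[OF that(1)], of x v] par by (simp add: parallel_section_def)
    \<comment> \<open>Near \<open>x\<close> the function \<phi>^2 is constantly 1, so the Leibniz
      rule produces no extra term. This is how the locality of the connection is obtained.\<close>
    also have "\<dots> = D x v (\<lambda>y. (\<phi> y * \<phi> y) *\<^sub>R \<tau> t y)"
    proof -
      have "differential A (\<lambda>y. \<phi> y * \<phi> y) x v = differential A (\<lambda>y. 1) x v"
        by (rule differential_cong[OF \<phi>(3) that(2)]) (simp add: \<phi>(5))
      then show ?thesis
        using conn_Leibniz[OF smooth_map_on_mult[OF open_UNIV \<phi>(1,1)] \<tau>s[OF that(1)], of x v] \<phi>(5)[OF that(2)]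
        by (simp add: differential_const)
    qed
    also have "(\<lambda>y. (\<phi> y * \<phi> y) *\<^sub>R \<tau> t y) = (\<lambda>y. \<Sum>j\<in>UNIV. u j t y *\<^sub>R f j y)"
      using expand[OF that(1)] by (simp add: fun_eq_iff)
    also have "D x v (\<lambda>y. \<Sum>j\<in>UNIV. u j t y *\<^sub>R f j y) = (\<Sum>j\<in>UNIV. D x v (\<lambda>y. u j t y *\<^sub>R f j y))"
      by (rule connection_sum[OF \<sigma> finite]) (intro smooth_section_scale us that fs)
    also have "\<dots> = (\<Sum>j\<in>UNIV. differential A (u j t) x v *\<^sub>R f j x + u j t x *\<^sub>R D x v (f j))"
      by (intro sum.cong refl conn_Leibniz us that fs)
    finally show ?thesis .
  qed
  \<comment> \<open>The power of 2 comes from \<open>fibre_sum_bound\<close>; the inner factor 2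
    separates the two terms that the Leibniz rule produces for each frame vector.\<close>
  define B where "B t x = 2 ^ CARD('k) * (\<Sum>j\<in>UNIV. 2 * (norm_sq h (f j) x * cometric (u j t) (u j t) x +
      u j t x * u j t x * nabla_norm_sq g h D (f j) x))" for t x
  have SB: "nabla_norm_sq g h D (s t) x \<le> B t x" if tx: "t \<in> I" "x \<in> U" for t x
  proof -
    have "nabla_norm_sq g h D (s t) x \<le> metric_trace (g x) (\<lambda>v w. 2 ^ CARD('k) * (\<Sum>j\<in>UNIV.
        2 * (norm_sq h (f j) x * (differential A (u j t) x v * differential A (u j t) x w) +
          u j t x * u j t x * h x (D x v (f j)) (D x w (f j)))))"
      unfolding nabla_norm_sq_eq_trace
    proof (rule metric_trace_mono)
      fix v
      define z where "z j = differential A (u j t) x v *\<^sub>R f j x + u j t x *\<^sub>R D x v (f j)" for j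
      have mem: "f j x \<in> E x" "D x v (f j) \<in> E x" for j
        using smooth_section_fibre[OF fs] conn_fibre[OF fs] by auto
      have zE: "z j \<in> E x" for j
        unfolding z_def by (intro subspace_add[OF subspace_fibre] subspace_scale[OF subspace_fibre] mem)
      have "h x (D x v (s t)) (D x v (s t)) \<le> 2 ^ CARD('k) * (\<Sum>j\<in>UNIV. h x (z j) (z j))"
        using fibre_sum_bound[where J=UNIV and z=z, OF finite zE] by (simp add: D\<tau>[OF tx] z_def)
      also have "\<dots> \<le> 2 ^ CARD('k) * (\<Sum>j\<in>UNIV. 2 * (norm_sq h (f j) x * (differential A (u j t) x v * differential A (u j t) x v) +
          u j t x * u j t x * h x (D x v (f j)) (D x v (f j))))"
      proof (intro mult_left_mono sum_mono)
        fix j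
        define a b where "a = differential A (u j t) x v" and "b = u j t x"
        \<comment> \<open>Expanding this square with the opposite sign bounds the mixed term of |a f
          + b Df|^2 by the two pure ones.\<close>
        have "0 \<le> h x (a *\<^sub>R f j x + (- b) *\<^sub>R D x v (f j)) (a *\<^sub>R f j x + (- b) *\<^sub>R D x v (f j))"
          by (intro fibre_nonneg subspace_add[OF subspace_fibre] subspace_scale[OF subspace_fibre] mem)
        then have "h x (a *\<^sub>R f j x + b *\<^sub>R D x v (f j)) (a *\<^sub>R f j x + b *\<^sub>R D x v (f j)) \<le>
            2 * (a\<^sup>2 * h x (f j x) (f j x) + b\<^sup>2 * h x (D x v (f j)) (D x v (f j)))"
          unfolding fibre_square[OF mem] by simp
        then show "h x (z j) (z j) \<le> 2 * (norm_sq h (f j) x * (differential A (u j t) x v * differential A (u j t) x v) +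
          u j t x * u j t x * h x (D x v (f j)) (D x v (f j)))"
          by (simp add: z_def a_def b_def norm_sq_def power2_eq_square mult_ac)
      qed simp
      finally show "h x (D x v (s t)) (D x v (s t)) \<le> 2 ^ CARD('k) * (\<Sum>j\<in>UNIV.
        2 * (norm_sq h (f j) x * (differential A (u j t) x v * differential A (u j t) x v) +
          u j t x * u j t x * h x (D x v (f j)) (D x v (f j))))" .
    qed
    then show ?thesis
      unfolding B_def
      by (simp only: metric_trace_scale metric_trace_sum metric_trace_add cometric_def nabla_norm_sq_eq_trace)
  qed
  define \<s> where "\<s> = (\<lambda>(t, y). inv (\<Psi> (chart_inv c y)) (s t (chart_inv c y)))"
  have \<s>: "smooth_on (I \<times> Y) \<s>"
    using s c V unfolding smooth_variation_def Y_def I_def \<s>_def by blast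
  have IY: "open (I \<times> Y)" using I Y by (simp add: open_Times)
  have s0: "s 0 = \<sigma>" using s by (simp add: smooth_variation_def)
  have u_eq: "u j t x = \<s> (t, snd c x) $ j - \<s> (0, snd c x) $ j" if "x \<in> U" "t \<in> I" for j t x
  proof -
    have xV: "x \<in> V" "x \<in> fst c" using that UV by auto
    have \<sigma>E: "(-1) *\<^sub>R \<sigma> x \<in> E x"
      by (intro subspace_scale[OF subspace_fibre] smooth_section_fibre[OF \<sigma>])
    show ?thesis
      using linear_inv_triv(1)[OF V(1) xV(1) smooth_section_fibre[OF st[OF that(2)]] \<sigma>E]
        linear_inv_triv(2)[OF V(1) xV(1) smooth_section_fibre[OF \<sigma>], of "-1"]
      by (simp add: u_def \<phi>(5)[OF that(1)] \<tau>_def \<s>_def chart_inv_left[OF c(1) xV(2)] s0)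
  qed
  \<comment> \<open>Derivatives of \<s> in coordinate directions of the base are again smooth in (t,
    y), so \<open>bigo_smooth_difference\<close> applies to them as it does to \<s>.\<close>
  define m where "m a j z = frechet_derivative \<s> (at z) (0, axis a 1) $ j" for a j z
  have du_eq: "chart_derivative c (u j t) x (axis a 1) = m a j (t, snd c x) - m a j (0, snd c x)" if "x \<in> U" "t \<in> I" for a j t x
  proof -
    have y: "snd c x \<in> Y" unfolding Y_def using that UV by blast
    have d: "((\<lambda>y. \<s> (r, y) $ j) has_derivative (\<lambda>\<xi>. frechet_derivative \<s> (at (r, snd c x)) (0, \<xi>) $ j)) (at (snd c x))"
      if "r \<in> I" for r
    proof -
      have "((\<lambda>y. (r, y)) has_derivative (\<lambda>\<xi>. (0, \<xi>))) (at (snd c x))"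
        by (auto intro!: derivative_eq_intros)
      from has_derivative_compose[OF this smooth_on_has_derivative[OF \<s>, of "(r, snd c x)"]]
      show ?thesis
        using that y by (intro bounded_linear.has_derivative[OF bounded_linear_vec_nth]) auto
    qed
    have "((u j t \<circ> chart_inv c) has_derivative (\<lambda>\<xi>. frechet_derivative \<s> (at (t, snd c x)) (0, \<xi>) $ j -
        frechet_derivative \<s> (at (0, snd c x)) (0, \<xi>) $ j)) (at (snd c x))"
    proof (rule has_derivative_transform_within_open[OF has_derivative_diff[OF d[OF that(2)] d[OF I(2)]]])
      show "open (snd c ` U)" by (rule chart_image_open[OF c(1) \<phi>(3) UV(2)])
      show "snd c x \<in> snd c ` U" using that by blast
      fix y assume "y \<in> snd c ` U"
      then obtain w where w: "w \<in> U" "y = snd c w" by blast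
      then have "chart_inv c y = w" using chart_inv_left[OF c(1)] UV by auto
      then show "\<s> (t, y) $ j - \<s> (0, y) $ j = (u j t \<circ> chart_inv c) y"
        using u_eq[OF w(1) that(2)] w(2) by simp
    qed
    from fun_cong[OF frechet_derivative_at[OF this], of "axis a 1"] show ?thesis
      by (simp add: m_def)
  qed
  define F where "F = nhds (0::real, x0)"
  have lim: "filterlim (\<lambda>z. (fst z, snd c (snd z))) (nhds (0, snd c x0)) F"
  proof -
    have "isCont (snd c) x0"
      using chart_continuous[OF c(1)] chart_open[OF c(1)] c(2) continuous_on_eq_continuous_at by blast
    then have "((\<lambda>z. snd c (snd z)) \<longlongrightarrow> snd c x0) F"
      unfolding isCont_def tendsto_at_iff_tendsto_nhds F_def nhds_prod
      by (rule filterlim_compose[OF _ filterlim_snd])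
    moreover have "(fst \<longlongrightarrow> 0) F" unfolding F_def nhds_prod by (rule filterlim_fst)
    ultimately show ?thesis by (intro tendsto_Pair)
  qed
  have evU: "\<forall>\<^sub>F z in F. fst z \<in> I \<and> snd z \<in> U"
    unfolding F_def eventually_nhds using I \<phi>(3,4) by (intro exI[of _ "I \<times> U"]) (auto simp: open_Times)
  have o1: "(\<lambda>z. k (fst z, snd c (snd z)) - k (0, snd c (snd z))) \<in> O[F](\<lambda>z. fst z)"
    if "smooth_on (I \<times> Y) k" for k :: "real \<times> (real ^ 'n) \<Rightarrow> real"
    using landau_o.big.compose[OF bigo_smooth_difference[OF I Y that] lim] by simp
  have ou: "(\<lambda>z. u j (fst z) (snd z)) \<in> O[F](\<lambda>z. fst z)" for j
  proof (rule landau_o.big.in_cong[THEN iffD2])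
    show "\<forall>\<^sub>F z in F. u j (fst z) (snd z) = \<s> (fst z, snd c (snd z)) $ j - \<s> (0, snd c (snd z)) $ j"
      using evU by (rule eventually_mono) (simp add: u_eq)
    show "(\<lambda>z. \<s> (fst z, snd c (snd z)) $ j - \<s> (0, snd c (snd z)) $ j) \<in> O[F](\<lambda>z. fst z)"
      by (rule o1[OF smooth_on_vec_nth[OF IY \<s>]])
  qed
  have odu: "(\<lambda>z. chart_derivative c (u j (fst z)) (snd z) (axis a 1)) \<in> O[F](\<lambda>z. fst z)" for j a
  proof (rule landau_o.big.in_cong[THEN iffD2])
    show "\<forall>\<^sub>F z in F. chart_derivative c (u j (fst z)) (snd z) (axis a 1) = m a j (fst z, snd c (snd z)) - m a j (0, snd c (snd z))"
      using evU by (rule eventually_mono) (simp add: du_eq)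
    show "(\<lambda>z. m a j (fst z, snd c (snd z)) - m a j (0, snd c (snd z))) \<in> O[F](\<lambda>z. fst z)"
      by (rule o1) (simp add: m_def[abs_def] smooth_on_vec_nth[OF IY smooth_on_frechet_derivative[OF \<s>]])
  qed
  have o0: "(\<lambda>z. k (snd z)) \<in> O[F](\<lambda>_. 1)" if "smooth_map_on A W k" "open W" "x0 \<in> W" for k :: "'m \<Rightarrow> real" and W
    unfolding F_def using smooth_map_on_imp_continuous_on[OF that(2,1)] that(2,3) continuous_on_eq_continuous_at
    by (intro bigo_continuous) blast
  have ocom: "(\<lambda>z. cometric (u j (fst z)) (u j (fst z)) (snd z)) \<in> O[F](\<lambda>z. fst z * fst z)" for j
  proof (rule landau_o.big.in_cong[THEN iffD2])
    show "\<forall>\<^sub>F z in F. cometric (u j (fst z)) (u j (fst z)) (snd z) =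
        (\<Sum>a\<in>UNIV. \<Sum>b\<in>UNIV. matrix_inv (metric_matrix A g c (snd z)) $ a $ b *
        (chart_derivative c (u j (fst z)) (snd z) (axis a 1) * chart_derivative c (u j (fst z)) (snd z) (axis b 1)))"
      using evU by (rule eventually_mono) (use UV in \<open>auto intro!: cometric_coord[OF c(1) _ us us UNIV_I]\<close>)
    show "(\<lambda>z. \<Sum>a\<in>UNIV. \<Sum>b\<in>UNIV. matrix_inv (metric_matrix A g c (snd z)) $ a $ b *
        (chart_derivative c (u j (fst z)) (snd z) (axis a 1) * chart_derivative c (u j (fst z)) (snd z) (axis b 1)))
        \<in> O[F](\<lambda>z. fst z * fst z)"
    proof (intro big_sum_in_bigo)
      fix a b
      show "(\<lambda>z. matrix_inv (metric_matrix A g c (snd z)) $ a $ b *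
        (chart_derivative c (u j (fst z)) (snd z) (axis a 1) * chart_derivative c (u j (fst z)) (snd z) (axis b 1)))
        \<in> O[F](\<lambda>z. fst z * fst z)"
        using landau_o.big.mult[OF o0[OF smooth_matrix_inv_metric_matrix[OF c(1)] chart_open[OF c(1)] c(2), of a b]
            landau_o.big.mult[OF odu[of j a] odu[of j b]]] by simp
    qed
  qed
  have oB: "(\<lambda>z. B (fst z) (snd z)) \<in> O[F](\<lambda>z. fst z * fst z)"
  proof -
    have "(\<lambda>z. norm_sq h (f j) (snd z) * cometric (u j (fst z)) (u j (fst z)) (snd z) +
      u j (fst z) (snd z) * u j (fst z) (snd z) * nabla_norm_sq g h D (f j) (snd z)) \<in> O[F](\<lambda>z. fst z * fst z)" for j
      using landau_o.big.mult[OF o0[OF smooth_norm_sq[OF fs] open_UNIV UNIV_I, of j] ocom[of j]]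
        landau_o.big.mult[OF landau_o.big.mult[OF ou[of j] ou[of j]] o0[OF smooth_nabla_norm_sq[OF fs] open_UNIV UNIV_I, of j]]
      by (intro sum_in_bigo) simp_all
    then show ?thesis
      unfolding B_def by (intro landau_o.big.cmult_in_iff[THEN iffD2, OF _] big_sum_in_bigo) simp_all
  qed
  have le: "\<forall>\<^sub>F z in F. norm (nabla_norm_sq g h D (s (fst z)) (snd z)) \<le> norm (B (fst z) (snd z))"
    using evU
  proof (rule eventually_mono)
    fix z assume "fst z \<in> I \<and> snd z \<in> U"
    then show "norm (nabla_norm_sq g h D (s (fst z)) (snd z)) \<le> norm (B (fst z) (snd z))"
      using SB[of "fst z" "snd z"] nabla_norm_sq_nonneg[OF st, of "fst z" "snd z"] by simp
  qed
  show ?thesis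
    using landau_o.big_trans[OF landau_o.big_mono[OF le] oB] unfolding F_def .
qed

text \<open>If the integrand is not integrable, its integral is 0 by convention and the bound is
  trivial; energies can thus be estimated without discussing the measurability of their
  densities.\<close>

lemma set_integral_abs_le:
  fixes f :: "'m \<Rightarrow> real"
  assumes \<Omega>: "\<Omega> \<in> sets borel" "emeasure (vol A g) \<Omega> < \<infinity>" and f: "\<And>x. x \<in> \<Omega> \<Longrightarrow> \<bar>f x\<bar> \<le> B" and B: "0 \<le> B"
  shows "\<bar>LINT x:\<Omega>|vol A g. f x\<bar> \<le> B * measure (vol A g) \<Omega>"
proof (cases "integrable (vol A g) (\<lambda>x. indicator \<Omega> x *\<^sub>R f x)")
  case True
  have "\<bar>LINT x:\<Omega>|vol A g. f x\<bar> \<le> (LINT x|vol A g. norm (indicator \<Omega> x *\<^sub>R f x))"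
    unfolding set_lebesgue_integral_def real_norm_def[symmetric] by (rule integral_norm_bound)
  also have "\<dots> \<le> (LINT x|vol A g. B * indicator \<Omega> x)"
  proof (rule integral_mono)
    show "integrable (vol A g) (\<lambda>x. norm (indicator \<Omega> x *\<^sub>R f x))" using True by (rule integrable_norm)
    show "integrable (vol A g) (\<lambda>x. B * indicator \<Omega> x)"
      using \<Omega> by (intro integrable_mult_right integrable_real_indicator) auto
    show "norm (indicator \<Omega> x *\<^sub>R f x) \<le> B * indicator \<Omega> x" for x
      using f[of x] by (simp add: indicator_def)
  qed
  also have "\<dots> = B * measure (vol A g) \<Omega>" by simp
  finally show ?thesis .
next
  case False
  then show ?thesis using B by (simp add: set_lebesgue_integral_def not_integrable_integral_eq)
qed

text \<open>Cauchy-Schwarz gives |\<nabla>N|^2 \<le> 4 N |\<nabla>\<tau>|^2 for N = |\<tau>|^2, and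
  the weight absorbs the factor N, since (1 + N)^p \<ge> 1 + N for p \<ge> 1.\<close>

lemma energy_density_bound:
  assumes \<tau>: "smooth_section A E T \<tau>" and p: "p \<ge> 1"
  shows "\<bar>1 / (1 + norm_sq h \<tau> x) powr p * (nabla_norm_sq g h D \<tau> x +
        q * (let w = gradient A g (\<lambda>y. 1 / 2 * norm_sq h \<tau> y) x in g x w w))\<bar> \<le> (1 + \<bar>q\<bar>) * nabla_norm_sq g h D \<tau> x"
proof -
  define N S Q where "N = norm_sq h \<tau> x" and "S = nabla_norm_sq g h D \<tau> x"
    and "Q = cometric (norm_sq h \<tau>) (norm_sq h \<tau>) x"
  have N0: "N \<ge> 0" unfolding N_def by (rule norm_sq_nonneg[OF \<tau>])
  have S0: "S \<ge> 0" unfolding S_def by (rule nabla_norm_sq_nonneg[OF \<tau>])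
  have Q0: "Q \<ge> 0" unfolding Q_def by (rule cometric_nonneg)
  have "Q \<le> metric_trace (g x) (\<lambda>v w. 4 * N * h x (D x v \<tau>) (D x w \<tau>))"
    unfolding Q_def cometric_def
  proof (rule metric_trace_mono)
    fix v
    show "differential A (norm_sq h \<tau>) x v * differential A (norm_sq h \<tau>) x v \<le> 4 * N * h x (D x v \<tau>) (D x v \<tau>)"
      using fibre_Cauchy_Schwarz[OF conn_fibre[OF \<tau>] smooth_section_fibre[OF \<tau>], of x v]
      by (simp add: differential_norm_sq[OF \<tau>] N_def norm_sq_def power2_eq_square mult_ac)
  qed
  then have Q: "Q \<le> 4 * N * S"
    by (simp only: metric_trace_scale nabla_norm_sq_eq_trace S_def)
  define r where "r = (1 + N) powr p"
  have r: "r \<ge> 1 + N" using powr_mono[of 1 p "1 + N"] p N0 by (simp add: r_def)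
  have "\<bar>S + q * (1 / 4 * Q)\<bar> \<le> \<bar>S\<bar> + \<bar>q * (1 / 4 * Q)\<bar>" by (rule abs_triangle_ineq)
  also have "\<dots> = S + \<bar>q\<bar> * (1 / 4 * Q)" using S0 Q0 by (simp add: abs_mult)
  also have "\<dots> \<le> S + \<bar>q\<bar> * (N * S)" using Q by (intro add_left_mono mult_left_mono) auto
  also have "\<dots> \<le> (1 + \<bar>q\<bar>) * S * r"
  proof -
    have "S * 1 \<le> S * r" "(\<bar>q\<bar> * S) * N \<le> (\<bar>q\<bar> * S) * r"
      using r N0 S0 by (intro mult_left_mono; simp)+
    then show ?thesis by (simp add: algebra_simps)
  qed
  finally have "\<bar>S + q * (1 / 4 * Q)\<bar> / r \<le> (1 + \<bar>q\<bar>) * S"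
    using r N0 by (simp add: divide_le_eq)
  then show ?thesis
    unfolding gradient_half_norm_sq[OF \<tau>] Q_def[symmetric] S_def[symmetric] N_def[symmetric] r_def[symmetric]
    using r N0 by (simp add: abs_mult)
qed

text \<open>The energy is bounded by a multiple of t^2, so it vanishes at t = 0 together with its
  derivative; no Euler-Lagrange equation is involved. Compactness of the closure of \<Omega> turns
  the local O(t^2) bounds into a single one.\<close>

lemma parallel_energy_derivative:
  assumes par: "parallel_section D \<sigma>" and \<sigma>: "smooth_section A E T \<sigma>" and p: "p \<ge> 1"
    and \<epsilon>: "\<epsilon> > 0" and s: "smooth_variation A E T \<epsilon> \<sigma> s" and \<Omega>: "open \<Omega>" "compact (closure \<Omega>)"
  shows "((\<lambda>t. vertical_energy A g h D p q \<Omega> (s t)) has_real_derivative 0) (at 0)"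
proof -
  have "\<exists>C X Y. open X \<and> 0 \<in> X \<and> open Y \<and> x \<in> Y \<and>
      (\<forall>t\<in>X. \<forall>y\<in>Y. nabla_norm_sq g h D (s t) y \<le> C * t\<^sup>2)" for x
  proof -
    obtain C where "C > 0" and ev: "\<forall>\<^sub>F z in nhds (0, x). norm (nabla_norm_sq g h D (s (fst z)) (snd z)) \<le> C * norm (fst z * fst z)"
      using landau_o.bigE[OF variation_nabla_bigo[OF par \<sigma> \<epsilon> s, of x]] by blast
    then obtain P where P: "open P" "(0, x) \<in> P"
      "\<And>z. z \<in> P \<Longrightarrow> norm (nabla_norm_sq g h D (s (fst z)) (snd z)) \<le> C * norm (fst z * fst z)"
      unfolding eventually_nhds by blast
    obtain X Y where XY: "open X" "open Y" "(0, x) \<in> X \<times> Y" "X \<times> Y \<subseteq> P"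
      using open_prod_elim[OF P(1,2)] by blast
    have "nabla_norm_sq g h D (s t) y \<le> C * t\<^sup>2" if "t \<in> X" "y \<in> Y" for t y
    proof -
      have "(t, y) \<in> P" using that XY(4) by blast
      from P(3)[OF this] show ?thesis by (simp add: power2_eq_square abs_mult)
    qed
    then show ?thesis
      using XY by (intro exI[of _ C] exI[of _ X] exI[of _ Y]) auto
  qed
  then have "\<forall>x. \<exists>C X Y. open X \<and> 0 \<in> X \<and> open Y \<and> x \<in> Y \<and>
      (\<forall>t\<in>X. \<forall>y\<in>Y. nabla_norm_sq g h D (s t) y \<le> C * t\<^sup>2)" by blast
  then obtain C X Y where "\<forall>x. open (X x) \<and> (0::real) \<in> X x \<and> open (Y x) \<and> x \<in> Y x \<and>
      (\<forall>t\<in>X x. \<forall>y\<in>Y x. nabla_norm_sq g h D (s t) y \<le> C x * t\<^sup>2)"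
    unfolding choice_iff by blast
  then have XY: "\<And>x. open (X x)" "\<And>x. (0::real) \<in> X x" "\<And>x. open (Y x)" "\<And>x. x \<in> Y x"
    and CXY: "\<And>x t y. t \<in> X x \<Longrightarrow> y \<in> Y x \<Longrightarrow> nabla_norm_sq g h D (s t) y \<le> C x * t\<^sup>2"
    by blast+
  have "closure \<Omega> \<subseteq> (\<Union>x\<in>UNIV. Y x)" using XY(4) by blast
  then obtain J where J: "finite J" "closure \<Omega> \<subseteq> (\<Union>x\<in>J. Y x)"
    by (rule compactE_image[OF \<Omega>(2) XY(3)])
  \<comment> \<open>The sum of absolute values dominates each \<open>C x\<close> of the finite
    subcover and is nonnegative even if \<open>J\<close> is empty.\<close>
  define M where "M = (\<Sum>x\<in>J. \<bar>C x\<bar>)"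
  have "open ({-\<epsilon><..<\<epsilon>} \<inter> (\<Inter>x\<in>J. X x))" "0 \<in> {-\<epsilon><..<\<epsilon>} \<inter> (\<Inter>x\<in>J. X x)"
    using J(1) XY(1,2) \<epsilon> by (auto intro!: open_Int open_INT)
  then obtain \<delta> where \<delta>: "\<delta> > 0" "ball 0 \<delta> \<subseteq> {-\<epsilon><..<\<epsilon>} \<inter> (\<Inter>x\<in>J. X x)"
    using open_contains_ball by meson
  have bound: "nabla_norm_sq g h D (s t) y \<le> M * t\<^sup>2" if t: "t \<in> ball 0 \<delta>" and y: "y \<in> \<Omega>" for t y
  proof -
    obtain x where x: "x \<in> J" "y \<in> Y x" using y J(2) closure_subset[of \<Omega>] by blast
    then have "nabla_norm_sq g h D (s t) y \<le> C x * t\<^sup>2" using CXY \<delta>(2) t by blast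
    also have "C x \<le> M" unfolding M_def
      using member_le_sum[OF x(1), of "\<lambda>x. \<bar>C x\<bar>"] J(1) by (simp add: abs_le_iff)
    finally show ?thesis by (simp add: mult_right_mono)
  qed
  have M: "M \<ge> 0" unfolding M_def by (intro sum_nonneg) auto
  define V where "V = measure (vol A g) \<Omega>"
  have bor: "\<Omega> \<in> sets borel" using \<Omega>(1) by (rule borel_open)
  have "emeasure (vol A g) \<Omega> \<le> emeasure (vol A g) (closure \<Omega>)"
    using closure_subset by (intro emeasure_mono) (auto intro: borel_closed)
  then have fin: "emeasure (vol A g) \<Omega> < \<infinity>"
    using emeasure_vol_compact_finite[OF \<Omega>(2)] by (rule le_less_trans)
  define W where "W t = vertical_energy A g h D p q \<Omega> (s t)" for t
  have Wb: "\<bar>W t\<bar> \<le> 1 / 2 * ((1 + \<bar>q\<bar>) * (M * t\<^sup>2) * V)" if t: "t \<in> ball 0 \<delta>" for t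
  proof -
    have st: "smooth_section A E T (s t)" using smooth_variation_section[OF s] \<delta>(2) t by blast
    have "\<bar>1 / (1 + norm_sq h (s t) x) powr p * (nabla_norm_sq g h D (s t) x +
        q * (let w = gradient A g (\<lambda>y. 1 / 2 * norm_sq h (s t) y) x in g x w w))\<bar> \<le> (1 + \<bar>q\<bar>) * (M * t\<^sup>2)"
      if "x \<in> \<Omega>" for x
      by (rule order_trans[OF energy_density_bound[OF st p]]) (intro mult_left_mono bound t that; simp)
    then show ?thesis
      unfolding W_def vertical_energy_def V_def abs_mult
      using set_integral_abs_le[OF bor fin] M by (intro mult_mono) auto
  qed
  have "W 0 = 0" using Wb[of 0] \<delta>(1) by simp
  have "((\<lambda>t. (W t - W 0) / (t - 0)) \<longlongrightarrow> 0) (at 0)"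
  proof (rule Lim_null_comparison)
    show "\<forall>\<^sub>F t in at 0. norm ((W t - W 0) / (t - 0)) \<le> 1 / 2 * ((1 + \<bar>q\<bar>) * M * V) * \<bar>t\<bar>"
      unfolding eventually_at
    proof (intro exI[of _ \<delta>] conjI ballI impI \<delta>(1))
      fix t :: real assume "t \<noteq> 0 \<and> dist t 0 < \<delta>"
      then have t: "t \<noteq> 0" "t \<in> ball 0 \<delta>" by (auto simp: dist_commute)
      have "\<bar>W t\<bar> / \<bar>t\<bar> \<le> 1 / 2 * ((1 + \<bar>q\<bar>) * (M * t\<^sup>2) * V) / \<bar>t\<bar>"
        by (rule divide_right_mono[OF Wb[OF t(2)]]) simp
      also have "\<dots> = 1 / 2 * ((1 + \<bar>q\<bar>) * M * V) * \<bar>t\<bar>"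
        using t(1) by (simp add: field_simps power2_eq_square abs_if)
      finally show "norm ((W t - W 0) / (t - 0)) \<le> 1 / 2 * ((1 + \<bar>q\<bar>) * M * V) * \<bar>t\<bar>"
        by (simp add: \<open>W 0 = 0\<close>)
    qed
    show "((\<lambda>t. 1 / 2 * ((1 + \<bar>q\<bar>) * M * V) * \<bar>t\<bar>) \<longlongrightarrow> 0) (at 0)"
      by (rule tendsto_eq_rhs[OF tendsto_mult_left[OF tendsto_rabs[OF tendsto_ident_at]]]) simp
  qed
  then show ?thesis unfolding W_def by (simp add: has_field_derivative_iff)
qed

lemma parallel_imp_harmonic_section:
  assumes "parallel_section D \<sigma>" "smooth_section A E T \<sigma>" "p \<ge> 1"
  shows "pq_harmonic_section A g E T h D p q \<sigma>"
  unfolding pq_harmonic_section_def using parallel_energy_derivative[OF assms] by auto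

end

theorem theorem4p5:
  fixes A :: "('m::{t2_space, second_countable_topology}, 'n::finite) chart set"
    and g :: "'m \<Rightarrow> real ^ 'n \<Rightarrow> real ^ 'n \<Rightarrow> real"
    and E :: "'m \<Rightarrow> 'v::real_vector set"
    and T :: "('m, 'k::finite, 'v) trivialisation set"
    and h :: "'m \<Rightarrow> 'v \<Rightarrow> 'v \<Rightarrow> real"
    and D :: "'m \<Rightarrow> real ^ 'n \<Rightarrow> ('m \<Rightarrow> 'v) \<Rightarrow> 'v"
    and \<nu> p q :: real
    and \<sigma> :: "'m \<Rightarrow> 'v"
  assumes "riemannian_vector_bundle A g E T h D"
    and "connected (UNIV :: 'm set)"
    and "\<nu> > 0" and "p > 1" and "q \<ge> 2 * \<nu> * (1 - p)"
    and "smooth_section A E T \<sigma>"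
    and "(\<nu> > 1 \<and> r_Riemannian h (\<nu> * (1 - p)) \<sigma>) \<or>
         (\<nu> = 1 \<and> strictly_r_Riemannian h (1 - p) \<sigma>)"
    and "harmonic_function A g (norm_sq h \<sigma>)"
  shows "pq_harmonic_section A g E T h D p q \<sigma> \<longleftrightarrow> parallel_section D \<sigma>"
proof -
  interpret riemannian_vector_bundle A g E T h D by (rule assms(1))
  show ?thesis
    using harmonic_section_imp_parallel[OF assms(2-8)] parallel_imp_harmonic_section[OF _ assms(6)] assms(4) by auto
qed

end
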